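(* For every finite-dimensional quantum strategy $(\rho,M,N)$ for the game $G_5$ and every $\varepsilon\in[0,1]$: if $\omega(G_5;\rho,M,N)\ge 1-\varepsilon$, then $$d_{\mathrm{ext}}(\rho,\psi_\star)\le\min\{1,\,2^{21}\sqrt{\varepsilon}\}.$$
   Context: **The game $G_5$.** Let $e_0,\dots,e_4$ be the standard basis of $\mathbb R^5$ and $D=\mathrm{diag}(2,2,2,2,1)$. Put $c_0=(-e_0-e_1-e_2+e_3)/2$, $c_1=(e_0+e_1-e_2+e_3)/2$, $h=(-e_0+e_1-e_2-e_3)/2$, $h'=(e_0-e_1-e_2-e_3)/2$, $d_0=(-e_0+e_1-e_2+e_3)/2$, $d_1=(e_0+e_1+e_2+e_3)/2$, $k=(e_0+e_1-e_2-e_3)/2$, $k'=(-e_0+e_1+e_2-e_3)/2$. For $x\in\{0,1,2,3\}$ and $a\in\{0,\dots,4\}$ let $u_{xa}$ be the normalization (to unit length) of the $a$-th vector of row $x$: row 0: $(e_0-e_1,\ e_0+e_1,\ e_2-e_3,\ e_2+e_3,\ e_4)$; row 1: $(e_4,\ e_0-e_2,\ e_0+e_2,\ e_1-e_3,\ e_1+e_3)$; row 2: $(e_1-e_2,\ e_1+e_2,\ e_0-e_4,\ e_0+e_4,\ e_3)$; row 3: $(e_0-e_3,\ e_0+e_3,\ e_2-e_4,\ e_2+e_4,\ e_1)$. For $y\in\{0,1,2\}$ and $b\in\{0,\dots,4\}$ let $v_{yb}$ be the normalization of the $b$-th vector of row $y$: row 0: $(e_0,e_1,e_2,e_3,e_4)$;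 row 1: $(c_0,\ c_1,\ h+e_4,\ h-e_4,\ h')$; row 2: $(d_0,\ d_1,\ k+e_4,\ k-e_4,\ k')$. Each of the 12 question pairs $(x,y)$ (Alice gets $x$, Bob gets $y$) has probability $1/12$; answers are $a,b\in\{0,\dots,4\}$; the winning predicate is $\mathsf w(x,y,a,b)=1$ if $u_{xa}^{\mathsf T}Dv_{yb}\neq0$ and $0$ otherwise. **Strategies.** A (finite-dimensional) quantum strategy consists of finite-dimensional complex Hilbert spaces $\mathcal H_A,\mathcal H_B$, a density operator $\rho$ on $\mathcal H_A\otimes\mathcal H_B$, and POVMs $\{M_{a|x}\}_{a=0}^4$ on $\mathcal H_A$ for each $x$ and $\{N_{b|y}\}_{b=0}^4$ on $\mathcal H_B$ for each $y$. Its winning probability is $\omega(G_5;\rho,M,N)=\frac1{12}\sum_{x,y,a,b}\mathsf w(x,y,a,b)\,\mathrm{Tr}[\rho(M_{a|x}\otimes N_{b|y})]$. **Target and extraction distance.** $|\psi_\star\rangle=(2|00\rangle+2|11\rangle+2|22\rangle+2|33\rangle+|44\rangle)/\sqrt{17}\in\mathbb C^5\otimes\mathbb C^5$. Define $\Xi(\rho,\psi_\star)=\max_{\Lambda_A,\Lambda_B}\langle\psi_\star|(\Lambda_A\otimes\Lambda_B)(\rho)|\psi_\star\rangle$, where the maximum is over quantum channels (completely positive trace-preserving maps) $\Lambda_A,\Lambda_B$ from operators on $\mathcal H_A$, respectively $\mathcal H_B$, to operators on $\mathbb C^5$, and $d_{\mathrm{ext}}(\rho,\psi_\star)=\sqrt{1-\Xi(\rho,\psi_\star)}$.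 *)

theory Defs
  imports "HOL-Analysis.Analysis"
begin

section \<open>The game\<close>

text \<open>Basis vectors are indexed from 0, by the elements 0, 1, 2, 3, 4 of the type \<open>5\<close>.
  Alice's questions are the naturals below 4, Bob's those below 3, all answers those below 5.\<close>

definition bas :: "5 \<Rightarrow> real^5" where
  "bas i = axis i 1"

definition Dmat :: "real^5^5" where
  "Dmat = (\<chi> i j. if i = j then (if i = 4 then 1 else 2) else 0)"

definition cvec0 :: "real^5" where "cvec0 = (- bas 0 - bas 1 - bas 2 + bas 3) /\<^sub>R 2"
definition cvec1 :: "real^5" where "cvec1 = (bas 0 + bas 1 - bas 2 + bas 3) /\<^sub>R 2"
definition hvec :: "real^5" where "hvec = (- bas 0 + bas 1 - bas 2 - bas 3) /\<^sub>R 2"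
definition hvec' :: "real^5" where "hvec' = (bas 0 - bas 1 - bas 2 - bas 3) /\<^sub>R 2"
definition dvec0 :: "real^5" where "dvec0 = (- bas 0 + bas 1 - bas 2 + bas 3) /\<^sub>R 2"
definition dvec1 :: "real^5" where "dvec1 = (bas 0 + bas 1 + bas 2 + bas 3) /\<^sub>R 2"
definition kvec :: "real^5" where "kvec = (bas 0 + bas 1 - bas 2 - bas 3) /\<^sub>R 2"
definition kvec' :: "real^5" where "kvec' = (- bas 0 + bas 1 + bas 2 - bas 3) /\<^sub>R 2"

definition alice_rows :: "(real^5) list list" where
  "alice_rows =
    [[bas 0 - bas 1, bas 0 + bas 1, bas 2 - bas 3, bas 2 + bas 3, bas 4],
     [bas 4, bas 0 - bas 2, bas 0 + bas 2, bas 1 - bas 3, bas 1 + bas 3],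
     [bas 1 - bas 2, bas 1 + bas 2, bas 0 - bas 4, bas 0 + bas 4, bas 3],
     [bas 0 - bas 3, bas 0 + bas 3, bas 2 - bas 4, bas 2 + bas 4, bas 1]]"

definition bob_rows :: "(real^5) list list" where
  "bob_rows =
    [[bas 0, bas 1, bas 2, bas 3, bas 4],
     [cvec0, cvec1, hvec + bas 4, hvec - bas 4, hvec'],
     [dvec0, dvec1, kvec + bas 4, kvec - bas 4, kvec']]"

definition uvec :: "nat \<Rightarrow> nat \<Rightarrow> real^5" where
  "uvec x a = (alice_rows ! x ! a) /\<^sub>R norm (alice_rows ! x ! a)"

definition vvec :: "nat \<Rightarrow> nat \<Rightarrow> real^5" where
  "vvec y b = (bob_rows ! y ! b) /\<^sub>R norm (bob_rows ! y ! b)"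

definition wins :: "nat \<Rightarrow> nat \<Rightarrow> nat \<Rightarrow> nat \<Rightarrow> real" where
  "wins x y a b = (if uvec x a \<bullet> (Dmat *v vvec y b) \<noteq> 0 then 1 else 0)"

section \<open>Operators and quantum strategies\<close>

text \<open>Finite-dimensional Hilbert spaces are \<open>complex^'n\<close>, their operators square matrices, and
  the tensor product of \<open>complex^'a\<close> and \<open>complex^'b\<close> is \<open>complex^('a \<times> 'b)\<close>. The inner product is
  the complex one, conjugate-linear in the first argument; the class operation \<open>\<bullet>\<close> on \<open>complex^'n\<close>
  is only its real part.\<close>

definition cinner :: "complex^'n \<Rightarrow> complex^'n \<Rightarrow> complex" where
  "cinner x y = (\<Sum>i\<in>UNIV. cnj (x $ i) * y $ i)"

definition dagger :: "complex^'n^'n \<Rightarrow> complex^'n^'n" where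
  "dagger A = (\<chi> i j. cnj (A $ j $ i))"

definition psd :: "complex^'n^'n \<Rightarrow> bool" where
  "psd A \<longleftrightarrow> dagger A = A \<and> (\<forall>x. 0 \<le> Re (cinner x (A *v x)))"

definition cscale :: "complex \<Rightarrow> complex^'n^'m \<Rightarrow> complex^'n^'m" where
  "cscale c A = (\<chi> i j. c * A $ i $ j)"

definition kron :: "complex^'a^'a \<Rightarrow> complex^'b^'b \<Rightarrow> complex^('a::finite \<times> 'b::finite)^('a \<times> 'b)" where
  "kron A B = (\<chi> p q. A $ fst p $ fst q * B $ snd p $ snd q)"

definition density :: "complex^'n^'n \<Rightarrow> bool" where
  "density rho \<longleftrightarrow> psd rho \<and> trace rho = 1"

definition povm5 :: "(nat \<Rightarrow> complex^'n^'n) \<Rightarrow> bool" where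
  "povm5 P \<longleftrightarrow> (\<forall>a<5. psd (P a)) \<and> (\<Sum>a<5. P a) = mat 1"

text \<open>\<open>M x a\<close> is Alice's operator for answer \<open>a\<close> to question \<open>x\<close>, \<open>N y b\<close> Bob's operator for
  answer \<open>b\<close> to question \<open>y\<close>.\<close>

definition quantum_strategy ::
  "complex^('a::finite \<times> 'b::finite)^('a \<times> 'b) \<Rightarrow> (nat \<Rightarrow> nat \<Rightarrow> complex^'a^'a) \<Rightarrow>
   (nat \<Rightarrow> nat \<Rightarrow> complex^'b^'b) \<Rightarrow> bool" where
  "quantum_strategy rho M N \<longleftrightarrow>
     density rho \<and> (\<forall>x<4. povm5 (M x)) \<and> (\<forall>y<3. povm5 (N y))"

text \<open>The trace below is real for every strategy, so taking \<open>Re\<close> is only a type conversion.\<close>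

definition winning_prob ::
  "complex^('a::finite \<times> 'b::finite)^('a \<times> 'b) \<Rightarrow> (nat \<Rightarrow> nat \<Rightarrow> complex^'a^'a) \<Rightarrow>
   (nat \<Rightarrow> nat \<Rightarrow> complex^'b^'b) \<Rightarrow> real" where
  "winning_prob rho M N =
     (1/12) * (\<Sum>x<4. \<Sum>y<3. \<Sum>a<5. \<Sum>b<5.
        wins x y a b * Re (trace (rho ** kron (M x a) (N y b))))"

section \<open>Channels and the extraction distance\<close>

definition clinear_map :: "(complex^'n^'n \<Rightarrow> complex^'m^'m) \<Rightarrow> bool" where
  "clinear_map L \<longleftrightarrow>
     (\<forall>A B. L (A + B) = L A + L B) \<and> (\<forall>c A. L (cscale c A) = cscale c (L A))"

text \<open>Positivity of the \<open>r \<times> r\<close> block matrix with blocks \<open>X i j\<close>, i.e. of the operator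
  \<open>\<Sum>i j. |i\<rangle>\<langle>j| \<otimes> X i j\<close> on the tensor product of the \<open>r\<close>-dimensional space with \<open>complex^'n\<close>;
  a vector of that space is a family of \<open>r\<close> vectors in \<open>complex^'n\<close>. The blocks are indexed by
  natural numbers because complete positivity quantifies over the dimension \<open>r\<close>.\<close>

definition block_psd :: "nat \<Rightarrow> (nat \<Rightarrow> nat \<Rightarrow> complex^'n^'n) \<Rightarrow> bool" where
  "block_psd r X \<longleftrightarrow>
     (\<forall>i<r. \<forall>j<r. dagger (X j i) = X i j) \<and>
     (\<forall>w :: nat \<Rightarrow> complex^'n. 0 \<le> Re (\<Sum>i<r. \<Sum>j<r. cinner (w i) (X i j *v w j)))"

text \<open>The map \<open>id \<otimes> L\<close> acts on a block matrix by applying \<open>L\<close> to each block.\<close>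

definition completely_positive :: "(complex^'n^'n \<Rightarrow> complex^'m^'m) \<Rightarrow> bool" where
  "completely_positive L \<longleftrightarrow>
     (\<forall>r X. block_psd r X \<longrightarrow> block_psd r (\<lambda>i j. L (X i j)))"

definition channel :: "(complex^'n^'n \<Rightarrow> complex^'m^'m) \<Rightarrow> bool" where
  "channel L \<longleftrightarrow>
     clinear_map L \<and> completely_positive L \<and> (\<forall>A. trace (L A) = trace A)"

definition matrix_unit :: "'n \<Rightarrow> 'n \<Rightarrow> complex^'n^'n" where
  "matrix_unit i j = (\<chi> p q. if p = i \<and> q = j then 1 else 0)"

text \<open>The tensor product of two linear maps, obtained by expanding the argument in the product
  basis \<open>kron (matrix_unit i j) (matrix_unit s t)\<close>.\<close>

definition tensor_map ::
  "(complex^'a^'a \<Rightarrow> complex^'c^'c) \<Rightarrow> (complex^'b^'b \<Rightarrow> complex^'d^'d) \<Rightarrow>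
   complex^('a::finite \<times> 'b::finite)^('a \<times> 'b) \<Rightarrow> complex^('c::finite \<times> 'd::finite)^('c \<times> 'd)" where
  "tensor_map L K rho =
     (\<Sum>i\<in>UNIV. \<Sum>j\<in>UNIV. \<Sum>s\<in>UNIV. \<Sum>t\<in>UNIV.
        cscale (rho $ (i, s) $ (j, t)) (kron (L (matrix_unit i j)) (K (matrix_unit s t))))"

definition ket :: "5 \<Rightarrow> 5 \<Rightarrow> complex^(5 \<times> 5)" where
  "ket i j = axis (i, j) 1"

definition psi_star :: "complex^(5 \<times> 5)" where
  "psi_star =
     (2 *\<^sub>R ket 0 0 + 2 *\<^sub>R ket 1 1 + 2 *\<^sub>R ket 2 2 + 2 *\<^sub>R ket 3 3 + ket 4 4) /\<^sub>R sqrt 17"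

text \<open>The set of fidelities is nonempty, contained in \<open>[0, 1]\<close> and compact when \<open>rho\<close> is a density
  operator and \<open>psi\<close> a unit vector, so the supremum is the maximum over pairs of channels. The
  inner product is then real.\<close>

definition Xi :: "complex^('a::finite \<times> 'b::finite)^('a \<times> 'b) \<Rightarrow> complex^(5 \<times> 5) \<Rightarrow> real" where
  "Xi rho psi =
     Sup {Re (cinner psi (tensor_map L K rho *v psi)) | L K.
       channel (L :: complex^'a^'a \<Rightarrow> complex^5^5) \<and> channel (K :: complex^'b^'b \<Rightarrow> complex^5^5)}"

definition d_ext :: "complex^('a::finite \<times> 'b::finite)^('a \<times> 'b) \<Rightarrow> complex^(5 \<times> 5) \<Rightarrow> real" where
  "d_ext rho psi = sqrt (1 - Xi rho psi)"

end

theory Submission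
  imports Defs
begin

text \<open>A strategy is purified, \<open>rho = R ** dagger R\<close>, and its operators act on the purification by
  left multiplication. A coarse-graining of Alice's measurement that determines one of Bob's agrees
  with it on \<open>R\<close> up to the square root \<open>\<eta>\<close> of the losing probability, and both are projective up to
  \<open>\<eta>\<close>. Hence a relation between Bob's operators that holds on \<open>R\<close> may be multiplied from the right by
  any operator of Bob that has such a mirror image on Alice's side.

  Bob's first question gives five blocks \<open>Q 0, \<dots>, Q 4\<close>; the answers to his other two questions give
  reflections \<open>B1, B2\<close> and \<open>C1, C2\<close>. On block \<open>Q i\<close>, \<open>i < 4\<close>, the reflections \<open>C1\<close>, \<open>C2\<close> and the product
  \<open>C1 * C2\<close> agree with \<open>B1\<close>, \<open>B2\<close> and \<open>B1 * B2\<close> up to signs whose product is \<open>-1\<close>, as in the magic square.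
  So \<open>B1\<close> and \<open>B2\<close> have no diagonal part on these blocks and permute them like the Pauli flips of two
  qubits. The answers \<open>h \<plusminus> e4\<close> and \<open>k \<plusminus> e4\<close> tie the fifth block to block \<open>Q 0\<close>, with relative weight
  \<open>1/2\<close>.

  Multiplying each block by the reflections that carry it to \<open>Q 0\<close>, on both sides, yields Kraus
  operators \<open>W i\<close>, \<open>W' j\<close> for which \<open>W i \<otimes> W' j\<close> maps \<open>R\<close> to \<open>0\<close> if \<open>i \<noteq> j\<close> and to the coefficient \<open>i\<close> of the
  target state times a fixed vector if \<open>i = j\<close>, up to a multiple of \<open>\<eta>\<close>. The resulting channels have
  fidelity \<open>1 - O(\<eta>\<^sup>2)\<close>.\<close>

section \<open>Relations between operators tested on a state\<close>

text \<open>The POVMs are not dilated to projective ones, which would enlarge the local spaces.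
  Every effect \<open>E\<close> keeps its defect instead, the expectation of
  \<open>E - E * E\<close>: it is a probability-like quantity, so the losing probability bounds it
  directly, and \<open>sn\<close> is its square root. The obstacle is that most single answers of
  Bob have no counterpart on Alice's side; only certain unions of answers do. Facts about single
  answers must be assembled from overlapping unions, and vanishing is shown by closed loops of
  relations whose signs multiply to \<open>-1\<close>, so that an operator equals its own negative.
  All relations have errors linear in \<eta>, where \<open>\<eta>\<^sup>2 = 12 * \<epsilon>\<close>
  because one of twelve equally likely question pairs may carry the whole loss. The last step is
  quadratic: norm losses are sums of squared seminorms, and completing a square compares fidelity
  with squared errors. Thus 1 - Xi is linear in \<epsilon>, which a plain triangle inequality would
  not give. The weight 1/2 of the fifth block comes from the squared overlaps of e0 with h and k,
  1/4 each, whose cross terms with the other blocks cancel.\<close>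

locale op_state =
  fixes act :: "'r::real_algebra_1 \<Rightarrow> 'v::real_inner \<Rightarrow> 'v" (infixr "\<cdot>" 76)
    and \<psi> :: 'v and \<eta> :: real
  assumes act_add: "(S + T) \<cdot> v = S \<cdot> v + T \<cdot> v"
    and act_scale: "(c *\<^sub>R S) \<cdot> v = c *\<^sub>R (S \<cdot> v)"
    and act_mult: "(S * T) \<cdot> v = S \<cdot> T \<cdot> v"
    and act_one: "1 \<cdot> v = v"
    and act_add_right: "S \<cdot> (u + v) = S \<cdot> u + S \<cdot> v"
    and act_scale_right: "S \<cdot> (c *\<^sub>R v) = c *\<^sub>R (S \<cdot> v)"
    and eta_nonneg: "0 \<le> \<eta>"
    and norm_psi: "norm \<psi> = 1"
begin

lemma act_zero [simp]: "0 \<cdot> v = 0"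
  using act_scale[of 0 0 v] by simp

lemma act_minus: "(- S) \<cdot> v = - (S \<cdot> v)"
  using act_scale[of "-1" S v] by simp

lemma act_minus_right: "S \<cdot> (- v) = - (S \<cdot> v)"
  using act_scale_right[of S "-1" v] by simp

lemma act_diff: "(S - T) \<cdot> v = S \<cdot> v - T \<cdot> v"
  using act_add[of S "- T" v] by (simp add: act_minus)

lemma act_diff_right: "S \<cdot> (u - v) = S \<cdot> u - S \<cdot> v"
  using act_add_right[of S u "- v"] by (simp add: act_minus_right)

lemmas act_simps = act_add act_diff act_minus act_scale act_mult act_one
  act_add_right act_diff_right act_minus_right act_scale_right

lemma act_sum: "(\<Sum>i\<in>I. S i) \<cdot> v = (\<Sum>i\<in>I. S i \<cdot> v)"
  by (induction I rule: infinite_finite_induct) (auto simp: act_add)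

definition contr :: "'r \<Rightarrow> bool" where
  "contr T \<longleftrightarrow> (\<forall>v. norm (T \<cdot> v) \<le> norm v)"

definition pos :: "'r \<Rightarrow> bool" where
  "pos T \<longleftrightarrow> (\<forall>u v. u \<bullet> (T \<cdot> v) = (T \<cdot> u) \<bullet> v) \<and> (\<forall>v. 0 \<le> v \<bullet> (T \<cdot> v))"

definition eff :: "'r \<Rightarrow> bool" where
  "eff T \<longleftrightarrow> pos T \<and> pos (1 - T)"

text \<open>The seminorm of a positive operator; \<open>ap k S T\<close> says that \<open>S\<close> and \<open>T\<close> agree on \<open>\<psi>\<close> up to \<open>k * \<eta>\<close>.\<close>

definition sn :: "'r \<Rightarrow> 'v \<Rightarrow> real" where
  "sn T v = sqrt (v \<bullet> (T \<cdot> v))"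

definition ap :: "real \<Rightarrow> 'r \<Rightarrow> 'r \<Rightarrow> bool" where
  "ap k S T \<longleftrightarrow> norm ((S - T) \<cdot> \<psi>) \<le> k * \<eta>"

text \<open>The seminorm is the stronger choice: by \<open>norm_le_sn\<close> and
  \<open>defect_eff\<close> it bounds the norm of the defect on the state, and it can be compared
  along the order of positive operators.\<close>

definition proj :: "real \<Rightarrow> 'r \<Rightarrow> bool" where
  "proj k E \<longleftrightarrow> sn (E - E * E) \<psi> \<le> k * \<eta>"

lemma contrD: "contr T \<Longrightarrow> norm (T \<cdot> v) \<le> norm v"
  by (simp add: contr_def)

lemma contr_one [simp, intro]: "contr 1"
  by (simp add: contr_def act_one)

lemma contr_mult [intro]: "contr S \<Longrightarrow> contr T \<Longrightarrow> contr (S * T)"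
  unfolding contr_def by (metis act_mult order_trans)

lemma contr_minus [intro]: "contr S \<Longrightarrow> contr (- S)"
  by (simp add: contr_def act_minus)

lemma posD: "pos T \<Longrightarrow> 0 \<le> v \<bullet> (T \<cdot> v)"
  unfolding pos_def by blast

lemma pos_sym: "pos T \<Longrightarrow> u \<bullet> (T \<cdot> v) = (T \<cdot> u) \<bullet> v"
  unfolding pos_def by blast

lemma pos_zero [simp, intro]: "pos 0"
  by (simp add: pos_def)

lemma pos_one [simp, intro]: "pos 1"
  by (simp add: pos_def act_one)

lemma pos_add [intro]: "pos S \<Longrightarrow> pos T \<Longrightarrow> pos (S + T)"
  unfolding pos_def act_add inner_add_left inner_add_right by (metis add_nonneg_nonneg)

lemma pos_sum: "(\<And>i. i \<in> I \<Longrightarrow> pos (S i)) \<Longrightarrow> pos (\<Sum>i\<in>I. S i)"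
  by (induction I rule: infinite_finite_induct) auto

lemma effD: "eff T \<Longrightarrow> pos T" "eff T \<Longrightarrow> pos (1 - T)"
  by (auto simp: eff_def)

lemma eff_compl: "eff T \<Longrightarrow> eff (1 - T)"
  by (simp add: eff_def)

lemma pos_compress:
  assumes "pos S" "pos T"
  shows "pos (S * T * S)"
proof -
  have "u \<bullet> ((S * T * S) \<cdot> v) = (S \<cdot> u) \<bullet> (T \<cdot> S \<cdot> v)" for u v
    using assms(1) by (simp add: act_mult pos_sym)
  then show ?thesis
    unfolding pos_def using assms(2)
    by (metis act_mult assms(1) pos_def)
qed

lemma eff_compress:
  assumes "eff S" "pos T"
  shows "pos (S * T * S)"
  using assms pos_compress effD by blast

text \<open>Two compressions add up to the defect, so no square root of \<open>E\<close> or of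
  \<open>1 - E\<close> is involved.\<close>

lemma eff_square: "eff E \<Longrightarrow> pos (E - E * E)"
proof -
  assume E: "eff E"
  have "E - E * E = E * (1 - E) * E + (1 - E) * E * (1 - E)"
    by (simp add: algebra_simps)
  moreover have "pos (E * (1 - E) * E)" "pos ((1 - E) * E * (1 - E))"
    using E effD pos_compress by blast+
  ultimately show ?thesis by (simp add: pos_add)
qed

lemma inner_mult_self:
  assumes "pos E"
  shows "v \<bullet> ((E * E) \<cdot> v) = (norm (E \<cdot> v))\<^sup>2"
  using pos_sym[OF assms, of v "E \<cdot> v"] by (simp add: act_mult power2_norm_eq_inner)

lemma sn_nonneg [simp]: "pos T \<Longrightarrow> 0 \<le> sn T v"
  by (simp add: sn_def posD)

lemma sn_sq: "pos T \<Longrightarrow> (sn T v)\<^sup>2 = v \<bullet> (T \<cdot> v)"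
  by (simp add: sn_def posD)

lemma sn_le_iff: "pos T \<Longrightarrow> 0 \<le> k \<Longrightarrow> sn T v \<le> k \<longleftrightarrow> v \<bullet> (T \<cdot> v) \<le> k\<^sup>2"
  by (metis sn_nonneg sn_sq power2_le_imp_le power_mono)

lemma sn_mono: "pos S \<Longrightarrow> pos (T - S) \<Longrightarrow> sn S v \<le> sn T v"
  using posD[of "T - S" v] by (simp add: sn_def act_diff inner_diff_right)

lemma pos_cauchy_schwarz:
  assumes "pos T"
  shows "u \<bullet> (T \<cdot> v) \<le> sn T u * sn T v"
proof -
  let ?a = "u \<bullet> (T \<cdot> u)" and ?b = "u \<bullet> (T \<cdot> v)" and ?c = "v \<bullet> (T \<cdot> v)"
  have q: "0 \<le> ?a + 2 * t * ?b + t\<^sup>2 * ?c" for t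
  proof -
    have "v \<bullet> (T \<cdot> u) = ?b"
      using pos_sym[OF assms, of v u] by (simp add: inner_commute)
    then show ?thesis
      using posD[OF assms, of "u + t *\<^sub>R v"]
      by (simp add: act_simps inner_add_left inner_add_right algebra_simps power2_eq_square)
  qed
  have "?b\<^sup>2 \<le> ?a * ?c"
  proof (cases "?c = 0")
    case True
    have "?b = 0"
    proof (rule ccontr)
      assume "?b \<noteq> 0"
      \<comment> \<open>With \<open>?c = 0\<close> the quadratic is affine in \<open>t\<close>, and
        at this \<open>t\<close> it equals \<open>-1\<close>.\<close>
      then show False
        using q[of "- (?a + 1) / (2 * ?b)"] True by (simp add: field_simps)
    qed
    then show ?thesis using True by simp
  next
    case False
    then have c: "0 < ?c" using posD[OF assms, of v] by linarith
    have "0 \<le> ?a - ?b\<^sup>2 / ?c"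
      using q[of "- ?b / ?c"] c by (simp add: field_simps power2_eq_square)
    then show ?thesis using c by (simp add: field_simps)
  qed
  then have "\<bar>?b\<bar> \<le> sqrt (?a * ?c)"
    by (metis real_sqrt_abs real_sqrt_le_mono)
  then show ?thesis by (simp add: sn_def real_sqrt_mult)
qed

lemma sn_triangle:
  assumes "pos T"
  shows "sn T (u + v) \<le> sn T u + sn T v"
proof -
  have "(u + v) \<bullet> (T \<cdot> (u + v)) = (sn T u)\<^sup>2 + 2 * (u \<bullet> (T \<cdot> v)) + (sn T v)\<^sup>2"
    using pos_sym[OF assms, of v u]
    by (simp add: sn_sq assms act_add_right inner_add_left inner_add_right inner_commute)
  also have "\<dots> \<le> (sn T u + sn T v)\<^sup>2"
    using pos_cauchy_schwarz[OF assms, of u v] by (simp add: power2_sum)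
  finally show ?thesis
    using sn_le_iff[OF assms] assms by simp
qed

lemma sn_eff_le_norm:
  assumes "eff T"
  shows "sn T v \<le> norm v"
proof -
  have "0 \<le> v \<bullet> ((1 - T) \<cdot> v)" using assms effD posD by blast
  then show ?thesis
    using assms by (subst sn_le_iff) (auto simp: effD act_simps inner_diff_right power2_norm_eq_inner)
qed

lemma norm_le_sn:
  assumes "eff T"
  shows "norm (T \<cdot> v) \<le> sn T v"
proof -
  have "0 \<le> v \<bullet> ((T - T * T) \<cdot> v)" using assms eff_square posD by blast
  then have "(norm (T \<cdot> v))\<^sup>2 \<le> (sn T v)\<^sup>2"
    using inner_mult_self[of T v] assms by (simp add: act_diff inner_diff_right sn_sq effD)
  then show ?thesis using assms effD by (simp add: abs_le_square_iff[symmetric])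
qed

lemma eff_contr [intro]: "eff T \<Longrightarrow> contr T"
  using norm_le_sn sn_eff_le_norm order_trans unfolding contr_def by blast

lemma defect_eff:
  assumes "eff E"
  shows "eff (E - E * E)"
proof -
  have "1 - (E - E * E) = (1 - E) + E * E" by (simp add: algebra_simps)
  moreover have "pos (E * 1 * E)" using assms by (blast intro: eff_compress)
  ultimately show ?thesis
    using assms unfolding eff_def by (metis eff_def eff_square mult.right_neutral pos_add)
qed

text \<open>This is \<open>(2 * E - 1)\<^sup>2 = 1 - 4 * (E - E * E)\<close> as a quadratic form.
  Being an identity, it later gives both contractivity and the exact norm lost by a
  reflection.\<close>

lemma reflection_norm:
  assumes "eff E"
  shows "(norm ((2 * E - 1) \<cdot> v))\<^sup>2 = (norm v)\<^sup>2 - 4 * (sn (E - E * E) v)\<^sup>2"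
proof -
  have e: "(2 * E) \<cdot> v = 2 *\<^sub>R (E \<cdot> v)"
    by (simp add: mult_2 act_add scaleR_2)
  have "(norm (2 *\<^sub>R (E \<cdot> v) - v))\<^sup>2
      = 4 * (norm (E \<cdot> v))\<^sup>2 - 4 * (v \<bullet> (E \<cdot> v)) + (norm v)\<^sup>2"
    unfolding power2_norm_eq_inner
    by (simp add: inner_diff_left inner_diff_right inner_commute algebra_simps)
  moreover have "(sn (E - E * E) v)\<^sup>2 = v \<bullet> (E \<cdot> v) - (norm (E \<cdot> v))\<^sup>2"
    using assms by (simp add: sn_sq eff_square act_diff inner_diff_right inner_mult_self effD)
  ultimately show ?thesis by (simp add: act_diff act_one e)
qed

lemma contr_reflection: "eff E \<Longrightarrow> contr (2 * E - 1)"
proof -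
  assume E: "eff E"
  have "(norm ((2 * E - 1) \<cdot> v))\<^sup>2 \<le> (norm v)\<^sup>2" for v
    unfolding reflection_norm[OF E] by simp
  then show ?thesis
    unfolding contr_def by (meson norm_ge_zero power2_le_imp_le)
qed

lemma contr_half: "contr S \<Longrightarrow> contr T \<Longrightarrow> contr ((1/2) *\<^sub>R (S + T))"
proof -
  assume *: "contr S" "contr T"
  have "norm ((1/2) *\<^sub>R (S \<cdot> v + T \<cdot> v)) \<le> norm v" for v
    using norm_triangle_ineq[of "S \<cdot> v" "T \<cdot> v"] contrD[OF *(1), of v] contrD[OF *(2), of v] by simp
  then show ?thesis by (simp add: contr_def act_scale act_add)
qed

text \<open>A difference of effects is the mean of a reflection and a negated reflection, hence has
  norm at most 1 rather than 2.\<close>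

lemma contr_diff:
  assumes "eff S" "eff T"
  shows "contr (S - T)"
proof -
  have "S - T = (1/2) *\<^sub>R ((2 * S - 1) + - (2 * T - 1))"
    by (simp add: mult_2 algebra_simps flip: scaleR_2)
  then show ?thesis
    using assms by (metis contr_half contr_reflection contr_minus)
qed

lemma ap_refl [simp, intro]: "0 \<le> k \<Longrightarrow> ap k S S"
  by (simp add: ap_def eta_nonneg)

lemma ap_sym: "ap k S T \<Longrightarrow> ap k T S"
  by (simp add: ap_def act_diff norm_minus_commute)

lemma ap_add: "ap k S T \<Longrightarrow> ap l S' T' \<Longrightarrow> ap (k + l) (S + S') (T + T')"
proof -
  assume "ap k S T" "ap l S' T'"
  moreover have "(S + S' - (T + T')) \<cdot> \<psi> = (S - T) \<cdot> \<psi> + (S' - T') \<cdot> \<psi>"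
    by (simp add: act_simps)
  ultimately show ?thesis
    using norm_triangle_ineq[of "(S - T) \<cdot> \<psi>" "(S' - T') \<cdot> \<psi>"]
    by (simp add: ap_def algebra_simps)
qed

lemma ap_neg: "ap k S T \<Longrightarrow> ap k (- S) (- T)"
  using norm_minus_commute[of "S \<cdot> \<psi>" "T \<cdot> \<psi>"] by (simp add: ap_def act_diff act_minus)

lemma ap_diff: "ap k S T \<Longrightarrow> ap l S' T' \<Longrightarrow> ap (k + l) (S - S') (T - T')"
  using ap_add[of k S T l "- S'" "- T'"] ap_neg by simp

lemma ap_scale: "ap k S T \<Longrightarrow> ap (\<bar>c\<bar> * k) (c *\<^sub>R S) (c *\<^sub>R T)"
proof -
  assume "ap k S T"
  then have "\<bar>c\<bar> * norm ((S - T) \<cdot> \<psi>) \<le> \<bar>c\<bar> * (k * \<eta>)"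
    unfolding ap_def by (rule mult_left_mono) simp
  moreover have "(c *\<^sub>R S - c *\<^sub>R T) \<cdot> \<psi> = c *\<^sub>R ((S - T) \<cdot> \<psi>)"
    by (simp add: act_simps scaleR_diff_right)
  ultimately show ?thesis by (simp add: ap_def mult.assoc)
qed

lemma ap_trans [trans]: "ap k S T \<Longrightarrow> ap l T U \<Longrightarrow> ap (k + l) S U"
proof -
  assume "ap k S T" "ap l T U"
  moreover have "(S - U) \<cdot> \<psi> = (S - T) \<cdot> \<psi> + (T - U) \<cdot> \<psi>" by (simp add: act_diff)
  ultimately show ?thesis
    using norm_triangle_ineq[of "(S - T) \<cdot> \<psi>" "(T - U) \<cdot> \<psi>"]
    by (simp add: ap_def algebra_simps)
qed

lemma ap_mono: "ap k S T \<Longrightarrow> k \<le> l \<Longrightarrow> ap l S T"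
  unfolding ap_def by (meson eta_nonneg mult_right_mono order_trans)

lemma ap_left: "ap k S T \<Longrightarrow> contr C \<Longrightarrow> ap k (C * S) (C * T)"
  unfolding ap_def right_diff_distrib[symmetric] act_mult using contrD order_trans by blast

lemma ap_cong_diff: "ap k S T \<Longrightarrow> S - T = S' - T' \<Longrightarrow> ap k S' T'"
  by (simp add: ap_def)

lemma sn_ap:
  assumes "eff E" "norm (u - v) \<le> l"
  shows "sn E u \<le> sn E v + l"
proof -
  have "sn E u \<le> sn E v + sn E (u - v)"
    using sn_triangle[of E v "u - v"] assms effD by simp
  then show ?thesis using sn_eff_le_norm[OF assms(1), of "u - v"] assms(2) by linarith
qed

end

text \<open>The factorizations \<open>A_root\<close> and \<open>B_root\<close> replace square roots: they make \<open>sn T\<close> decrease under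
  contractions of the other side.\<close>

locale bipartite = op_state act \<psi> \<eta>
  for act :: "'r::real_algebra_1 \<Rightarrow> 'v::real_inner \<Rightarrow> 'v" (infixr "\<cdot>" 76)
    and \<psi> \<eta> +
  fixes \<A> \<B> :: "'r set"
  assumes A_one: "1 \<in> \<A>" and A_add: "S \<in> \<A> \<Longrightarrow> T \<in> \<A> \<Longrightarrow> S + T \<in> \<A>"
    and A_scale: "S \<in> \<A> \<Longrightarrow> c *\<^sub>R S \<in> \<A>" and A_mult: "S \<in> \<A> \<Longrightarrow> T \<in> \<A> \<Longrightarrow> S * T \<in> \<A>"
    and A_root: "T \<in> \<A> \<Longrightarrow> pos T \<Longrightarrow> \<exists>F\<in>\<A>. \<forall>v. (norm (F \<cdot> v))\<^sup>2 = v \<bullet> (T \<cdot> v)"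
    and B_one: "1 \<in> \<B>" and B_add: "S \<in> \<B> \<Longrightarrow> T \<in> \<B> \<Longrightarrow> S + T \<in> \<B>"
    and B_scale: "S \<in> \<B> \<Longrightarrow> c *\<^sub>R S \<in> \<B>" and B_mult: "S \<in> \<B> \<Longrightarrow> T \<in> \<B> \<Longrightarrow> S * T \<in> \<B>"
    and B_root: "T \<in> \<B> \<Longrightarrow> pos T \<Longrightarrow> \<exists>F\<in>\<B>. \<forall>v. (norm (F \<cdot> v))\<^sup>2 = v \<bullet> (T \<cdot> v)"
    and commute: "S \<in> \<A> \<Longrightarrow> T \<in> \<B> \<Longrightarrow> S * T = T * S"

text \<open>The axioms are symmetric in the two sides, so each lemma is proved for one side and used
  for the other under the prefix \<open>swap\<close>.\<close>

sublocale bipartite \<subseteq> swap: bipartite act \<psi> \<eta> \<B> \<A>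
  by unfold_locales (use A_one A_add A_scale A_mult A_root B_one B_add B_scale B_mult B_root commute in auto)

context bipartite
begin

lemma A_minus: "S \<in> \<A> \<Longrightarrow> - S \<in> \<A>"
  using A_scale[of S "-1"] by simp

lemma A_diff: "S \<in> \<A> \<Longrightarrow> T \<in> \<A> \<Longrightarrow> S - T \<in> \<A>"
  using A_add[of S "- T"] A_minus by simp

lemma A_zero: "0 \<in> \<A>"
  using A_scale[OF A_one, of 0] by simp

lemma A_numeral: "numeral n \<in> \<A>"
  using A_scale[OF A_one, of "numeral n"] by (simp add: scaleR_conv_of_real)

lemma A_sum: "(\<And>i. i \<in> I \<Longrightarrow> S i \<in> \<A>) \<Longrightarrow> (\<Sum>i\<in>I. S i) \<in> \<A>"
  by (induction I rule: infinite_finite_induct) (auto intro: A_zero A_add)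

lemmas A_mem [simp] = A_one A_add A_scale A_mult A_minus A_diff A_zero A_numeral

text \<open>Polarization: the root is only assumed to reproduce the quadratic form.\<close>

lemma root_inner:
  assumes T: "pos T" and F: "\<And>v. (norm (F \<cdot> v))\<^sup>2 = v \<bullet> (T \<cdot> v)"
  shows "u \<bullet> (T \<cdot> v) = (F \<cdot> u) \<bullet> (F \<cdot> v)"
proof -
  have "(norm (F \<cdot> (u + v)))\<^sup>2 = (norm (F \<cdot> u))\<^sup>2 + 2 * ((F \<cdot> u) \<bullet> (F \<cdot> v)) + (norm (F \<cdot> v))\<^sup>2"
    by (simp add: act_add_right power2_norm_eq_inner inner_add_left inner_add_right inner_commute)
  moreover have "(u + v) \<bullet> (T \<cdot> (u + v)) = u \<bullet> (T \<cdot> u) + 2 * (u \<bullet> (T \<cdot> v)) + v \<bullet> (T \<cdot> v)"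
    using pos_sym[OF T, of v u]
    by (simp add: act_add_right inner_add_left inner_add_right inner_commute)
  ultimately show ?thesis by (simp add: F)
qed

lemma sn_commute:
  assumes "T \<in> \<A>" "pos T" "C \<in> \<B>" "contr C"
  shows "sn T (C \<cdot> v) \<le> sn T v"
proof -
  obtain F where F: "F \<in> \<A>" "\<And>v. (norm (F \<cdot> v))\<^sup>2 = v \<bullet> (T \<cdot> v)"
    using A_root assms by meson
  have "sn T w = norm (F \<cdot> w)" for w
    by (simp add: sn_def flip: F(2))
  moreover have "norm (F \<cdot> C \<cdot> v) \<le> norm (F \<cdot> v)"
    using commute[OF F(1) assms(3)] contrD[OF assms(4)] by (metis act_mult)
  ultimately show ?thesis by simp
qed

text \<open>Conditioning on an outcome: \<open>w\<close> is the unnormalized vector after the effect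
  \<open>q\<close>, and the correlation of \<open>q\<close> with the other side becomes an
  expectation in \<open>w\<close>.\<close>

lemma inner_prod:
  assumes "q \<in> \<A>" "pos q" "r \<in> \<B>" "pos r"
  obtains w where "\<And>S. S \<in> \<B> \<Longrightarrow> v \<bullet> ((q * S) \<cdot> v) = w \<bullet> (S \<cdot> w)"
proof -
  obtain F where F: "F \<in> \<A>" "\<And>v. (norm (F \<cdot> v))\<^sup>2 = v \<bullet> (q \<cdot> v)"
    using A_root assms by meson
  have "v \<bullet> ((q * S) \<cdot> v) = (F \<cdot> v) \<bullet> (S \<cdot> F \<cdot> v)" if "S \<in> \<B>" for S
    using commute[OF F(1) that] by (metis act_mult assms(2) F(2) root_inner)
  then show ?thesis using that by blast
qed

lemma prod_nonneg:
  assumes "q \<in> \<A>" "pos q" "r \<in> \<B>" "pos r"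
  shows "0 \<le> v \<bullet> ((q * r) \<cdot> v)"
proof -
  obtain w where "\<And>S. S \<in> \<B> \<Longrightarrow> v \<bullet> ((q * S) \<cdot> v) = w \<bullet> (S \<cdot> w)"
    using inner_prod[OF assms] by blast
  then show ?thesis using assms posD by simp
qed

lemma sn_prod:
  assumes "q \<in> \<A>" "pos q" "r \<in> \<B>" "eff r"
  shows "(sn q (r \<cdot> v))\<^sup>2 \<le> v \<bullet> ((q * r) \<cdot> v)"
proof -
  have r: "pos r" using assms effD by blast
  obtain w where w: "\<And>S. S \<in> \<B> \<Longrightarrow> v \<bullet> ((q * S) \<cdot> v) = w \<bullet> (S \<cdot> w)"
    using inner_prod[OF assms(1,2,3) r] by blast
  have "(sn q (r \<cdot> v))\<^sup>2 = (r \<cdot> v) \<bullet> (q \<cdot> r \<cdot> v)" using assms by (simp add: sn_sq)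
  also have "\<dots> = v \<bullet> ((q * (r * r)) \<cdot> v)"
    using commute[OF assms(1,3)] pos_sym[OF r] by (metis act_mult mult.assoc)
  also have "\<dots> = w \<bullet> ((r * r) \<cdot> w)" using w assms swap.A_mult by blast
  also have "\<dots> \<le> w \<bullet> (r \<cdot> w)"
    using posD[OF eff_square[OF assms(4)], of w] by (simp add: act_diff inner_diff_right)
  finally show ?thesis using w assms by simp
qed

end

section \<open>Mirror images and joint effects on the state\<close>

context op_state
begin

text \<open>A joint probability, hence compared with \<open>\<eta>\<^sup>2\<close>; its square root
  gives the linear bounds of \<open>small_sn\<close>.\<close>

definition small :: "'r \<Rightarrow> 'r \<Rightarrow> bool" where
  "small q r \<longleftrightarrow> \<psi> \<bullet> ((q * r) \<cdot> \<psi>) \<le> \<eta>\<^sup>2"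

text \<open>\<open>mir X m c\<close>: on \<open>\<psi>\<close>, the operator \<open>c\<close> has a mirror image in \<open>X\<close>, up to \<open>m * \<eta>\<close>.\<close>

definition mir :: "'r set \<Rightarrow> real \<Rightarrow> 'r \<Rightarrow> bool" where
  "mir X m c \<longleftrightarrow> (\<exists>d\<in>X. contr d \<and> ap m c d)"

lemma mirI: "d \<in> X \<Longrightarrow> contr d \<Longrightarrow> ap m c d \<Longrightarrow> mir X m c"
  by (auto simp: mir_def)

lemma mir_mono: "mir X m c \<Longrightarrow> m \<le> n \<Longrightarrow> mir X n c"
  unfolding mir_def using ap_mono by blast

lemma proj_compl: "proj k E \<Longrightarrow> proj k (1 - E)"
  by (simp add: proj_def algebra_simps)

lemma proj_mono: "proj k E \<Longrightarrow> k \<le> l \<Longrightarrow> proj l E"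
  unfolding proj_def by (meson eta_nonneg mult_right_mono order_trans)

text \<open>The compression \<open>(1 - F) * F * (1 - F)\<close> lies below the defect
  \<open>F - F * F\<close>, their difference being \<open>F * (1 - F) * F\<close>.\<close>

lemma proj_sn_compl:
  assumes "eff F" "proj k F"
  shows "sn F ((1 - F) \<cdot> \<psi>) \<le> k * \<eta>"
proof -
  have F: "pos F" "pos (1 - F)" using assms effD by auto
  have k: "0 \<le> k * \<eta>"
    using assms sn_nonneg[OF eff_square[OF assms(1)]] unfolding proj_def by (meson order_trans)
  have "((1 - F) \<cdot> \<psi>) \<bullet> (F \<cdot> (1 - F) \<cdot> \<psi>) = \<psi> \<bullet> (((1 - F) * F * (1 - F)) \<cdot> \<psi>)"
    using F by (simp add: act_mult pos_sym)
  also have "\<dots> \<le> \<psi> \<bullet> ((F - F * F) \<cdot> \<psi>)"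
  proof -
    have "(F - F * F) - (1 - F) * F * (1 - F) = F * (1 - F) * F" by (simp add: algebra_simps)
    then have "pos ((F - F * F) - (1 - F) * F * (1 - F))" using F pos_compress by simp
    from posD[OF this, of \<psi>] show ?thesis
      by (simp add: act_diff[of "F - F * F"] inner_diff_right del: minus_mult_left)
  qed
  also have "\<dots> \<le> (k * \<eta>)\<^sup>2"
    using assms k sn_le_iff[OF eff_square[OF assms(1)] k] unfolding proj_def by blast
  finally show ?thesis using F k by (subst sn_le_iff) auto
qed

lemma proj_sn_self:
  assumes "eff F" "proj k F"
  shows "sn (1 - F) (F \<cdot> \<psi>) \<le> k * \<eta>"
  using proj_sn_compl[OF eff_compl[OF assms(1)] proj_compl[OF assms(2)]] by simp

text \<open>Since \<open>R\<close> lies below \<open>F\<close>, its seminorm of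
  \<open>(1 - F) \<cdot> \<psi>\<close> is at most that of \<open>F\<close>, which
  \<open>proj_sn_compl\<close> bounds.\<close>

lemma sub_absorb:
  assumes "eff F" "eff R" "pos (F - R)" "proj k F"
  shows "ap k (R * F) R"
proof -
  have "norm (R \<cdot> (1 - F) \<cdot> \<psi>) \<le> sn R ((1 - F) \<cdot> \<psi>)" using assms norm_le_sn by blast
  also have "\<dots> \<le> sn F ((1 - F) \<cdot> \<psi>)" using assms sn_mono effD by blast
  also have "\<dots> \<le> k * \<eta>" using assms proj_sn_compl by blast
  finally have "ap k (R * (1 - F)) 0" by (simp add: ap_def act_mult)
  then show ?thesis by (auto intro: ap_sym simp: ap_cong_diff algebra_simps)
qed

lemma sub_orth:
  assumes "eff F" "eff R" "pos (1 - F - R)" "proj k F"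
  shows "ap k (R * F) 0"
proof -
  have "norm (R \<cdot> F \<cdot> \<psi>) \<le> sn R (F \<cdot> \<psi>)" using assms norm_le_sn by blast
  also have "\<dots> \<le> sn (1 - F) (F \<cdot> \<psi>)" using assms sn_mono effD by blast
  also have "\<dots> \<le> k * \<eta>" using assms proj_sn_self by blast
  finally show ?thesis by (simp add: ap_def act_mult)
qed

text \<open>Two coarse-grainings \<open>H\<close> and \<open>K\<close> of one measurement, with \<open>g\<close> the effect of the common
  outcomes.\<close>

definition meet :: "'r \<Rightarrow> 'r \<Rightarrow> 'r \<Rightarrow> bool" where
  "meet g H K \<longleftrightarrow> pos g \<and> pos (H - g) \<and> pos (K - g) \<and> pos (1 - H - K + g)"

lemma meet_eff:
  assumes "meet g H K"
  shows "eff g" "eff H" "eff K" "eff (H - g)" "eff (K - g)"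
proof -
  have p: "pos g" "pos (H - g)" "pos (K - g)" "pos (1 - H - K + g)"
    using assms by (auto simp: meet_def)
  have h: "pos H" "pos K" using pos_add[OF p(2) p(1)] pos_add[OF p(3) p(1)] by simp_all
  have h': "pos (1 - H)" "pos (1 - K)"
    using pos_add[OF p(4) p(3)] pos_add[OF p(4) p(2)] by (simp_all add: algebra_simps)
  have "1 - g = (1 - H) + (H - g)" "1 - (H - g) = (1 - H) + g" "1 - (K - g) = (1 - K) + g"
    by simp_all
  then have "pos (1 - g)" "pos (1 - (H - g))" "pos (1 - (K - g))"
    using pos_add[OF h'(1) p(2)] pos_add[OF h'(1) p(1)] pos_add[OF h'(2) p(1)] by metis+
  then show "eff g" "eff H" "eff K" "eff (H - g)" "eff (K - g)"
    using p h h' by (auto simp: eff_def)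
qed

lemma meet_commute: "meet g H K \<Longrightarrow> meet g K H"
  by (simp add: meet_def algebra_simps)

text \<open>Split \<open>H\<close> into \<open>g\<close> and \<open>H - g\<close>: the first lies
  below \<open>K\<close> and absorbs it, the second lies below \<open>1 - K\<close> and is
  annihilated. Coarse-grainings of one POVM therefore behave on the state like commuting
  projections.\<close>

lemma meet_prod:
  assumes m: "meet g H K" and "proj k K"
  shows "ap (2 * k) (H * K) g"
proof -
  have "pos (1 - K - (H - g))" using m by (simp add: meet_def algebra_simps)
  then have 1: "ap k ((H - g) * K) 0"
    using sub_orth assms meet_eff[OF m] by blast
  have "pos (K - g)" using m by (simp add: meet_def)
  then have 2: "ap k (g * K) g"
    using sub_absorb assms meet_eff[OF m] by blast
  show ?thesis using ap_add[OF 1 2] by (simp add: algebra_simps)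
qed

end

context bipartite
begin

lemma commute_act: "S \<in> \<A> \<Longrightarrow> T \<in> \<B> \<Longrightarrow> S \<cdot> T \<cdot> v = T \<cdot> S \<cdot> v"
  by (metis act_mult commute)

lemma mir_obtain:
  assumes "mir \<A> m c"
  obtains d where "d \<in> \<A>" "contr d" "norm (c \<cdot> \<psi> - d \<cdot> \<psi>) \<le> m * \<eta>"
  using assms by (auto simp: mir_def ap_def act_diff)

text \<open>Relations between operators of one side, tested on \<open>\<psi>\<close>, form a left ideal; mirroring the
  right factor on the other side makes them a two-sided ideal.\<close>

lemma ap_right:
  assumes "ap k S T" "S \<in> \<B>" "T \<in> \<B>" "contr S" "contr T" "mir \<A> m c"
  shows "ap (k + 2 * m) (S * c) (T * c)"
proof -
  obtain d where d: "d \<in> \<A>" "contr d" "norm (c \<cdot> \<psi> - d \<cdot> \<psi>) \<le> m * \<eta>"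
    using assms mir_obtain by blast
  let ?w = "c \<cdot> \<psi> - d \<cdot> \<psi>"
  have eq: "(S * c - T * c) \<cdot> \<psi> = S \<cdot> ?w - T \<cdot> ?w + d \<cdot> ((S - T) \<cdot> \<psi>)"
    using commute_act[OF d(1)] assms by (simp add: act_simps)
  have "norm (S \<cdot> ?w) \<le> m * \<eta>" "norm (T \<cdot> ?w) \<le> m * \<eta>"
    using assms d contrD order_trans by blast+
  moreover have "norm (d \<cdot> ((S - T) \<cdot> \<psi>)) \<le> k * \<eta>"
    using assms(1) d contrD order_trans unfolding ap_def by blast
  moreover have "norm (S \<cdot> ?w - T \<cdot> ?w + d \<cdot> ((S - T) \<cdot> \<psi>))
      \<le> norm (S \<cdot> ?w) + norm (T \<cdot> ?w) + norm (d \<cdot> ((S - T) \<cdot> \<psi>))"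
    by (meson add_right_mono norm_triangle_ineq norm_triangle_ineq4 order_trans)
  ultimately have "norm ((S * c - T * c) \<cdot> \<psi>) \<le> m * \<eta> + m * \<eta> + k * \<eta>"
    unfolding eq by linarith
  then show ?thesis unfolding ap_def by (simp add: algebra_simps)
qed

text \<open>The mirror image of a product is the product of the mirror images in reverse order:
  \<open>d'\<close> stands on the other side and moves past \<open>c\<close> before \<open>c\<close>
  is replaced.\<close>

lemma mir_mult:
  assumes "mir \<A> m c" "mir \<A> n d" "c \<in> \<B>" "contr c"
  shows "mir \<A> (m + n) (c * d)"
proof -
  obtain c' where c': "c' \<in> \<A>" "contr c'" "ap m c c'"
    using assms(1) by (auto simp: mir_def)
  obtain d' where d': "d' \<in> \<A>" "contr d'" "ap n d d'"
    using assms(2) by (auto simp: mir_def)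
  have "ap n (c * d) (c * d')" using d' assms ap_left by blast
  moreover have "ap m (d' * c) (d' * c')" using c' d' ap_left by blast
  moreover have "c * d' = d' * c" using commute d' assms by metis
  ultimately have "ap (n + m) (c * d) (d' * c')" using ap_trans by metis
  then show ?thesis
    using c' d' A_mult contr_mult by (auto simp: mir_def add.commute)
qed

lemma small_sn:
  assumes "small q r" "q \<in> \<A>" "eff q" "r \<in> \<B>" "eff r"
  shows "sn q (r \<cdot> \<psi>) \<le> \<eta>" "sn r (q \<cdot> \<psi>) \<le> \<eta>"
proof -
  have "(sn q (r \<cdot> \<psi>))\<^sup>2 \<le> \<eta>\<^sup>2"
    using sn_prod[of q r \<psi>] assms effD by (force simp: small_def)
  then show "sn q (r \<cdot> \<psi>) \<le> \<eta>" using eta_nonneg power2_le_imp_le by blast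
  have "(sn r (q \<cdot> \<psi>))\<^sup>2 \<le> \<eta>\<^sup>2"
    using swap.sn_prod[of r q \<psi>] assms effD commute[of q r] by (force simp: small_def)
  then show "sn r (q \<cdot> \<psi>) \<le> \<eta>" using eta_nonneg power2_le_imp_le by blast
qed

lemma small_ap:
  assumes "small q r" "q \<in> \<A>" "eff q" "r \<in> \<B>" "eff r"
  shows "ap 1 (q * r) 0"
  using small_sn(1)[OF assms] norm_le_sn[OF assms(3), of "r \<cdot> \<psi>"]
  by (simp add: ap_def act_mult)

text \<open>The probability of disagreement, \<open>E + F - 2 * E * F\<close> in expectation, is
  exactly the sum of the squared distance on the state and the two defects. All three are
  nonnegative, so one hypothesis bounds each of them.\<close>

lemma matching:
  assumes E: "E \<in> \<A>" "eff E" and F: "F \<in> \<B>" "eff F"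
    and le: "\<psi> \<bullet> ((E * (1 - F)) \<cdot> \<psi>) + \<psi> \<bullet> (((1 - E) * F) \<cdot> \<psi>) \<le> \<eta>\<^sup>2"
  shows "ap 1 E F" "proj 1 E" "proj 1 F"
proof -
  have EF: "\<psi> \<bullet> ((E * F) \<cdot> \<psi>) = (E \<cdot> \<psi>) \<bullet> (F \<cdot> \<psi>)"
    using pos_sym[of E] E effD by (simp add: act_mult)
  have "(norm ((E - F) \<cdot> \<psi>))\<^sup>2 = (norm (E \<cdot> \<psi>))\<^sup>2 + (norm (F \<cdot> \<psi>))\<^sup>2 - 2 * ((E \<cdot> \<psi>) \<bullet> (F \<cdot> \<psi>))"
    by (simp add: act_diff power2_norm_eq_inner inner_diff_left inner_diff_right inner_commute)
  moreover have "(sn (E - E * E) \<psi>)\<^sup>2 = \<psi> \<bullet> (E \<cdot> \<psi>) - (norm (E \<cdot> \<psi>))\<^sup>2"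
    using E by (simp add: sn_sq eff_square act_diff inner_diff_right inner_mult_self effD)
  moreover have "(sn (F - F * F) \<psi>)\<^sup>2 = \<psi> \<bullet> (F \<cdot> \<psi>) - (norm (F \<cdot> \<psi>))\<^sup>2"
    using F by (simp add: sn_sq eff_square act_diff inner_diff_right inner_mult_self effD)
  moreover have "\<psi> \<bullet> (E \<cdot> \<psi>) + \<psi> \<bullet> (F \<cdot> \<psi>) - 2 * (\<psi> \<bullet> ((E * F) \<cdot> \<psi>)) \<le> \<eta>\<^sup>2"
    using le by (simp add: algebra_simps act_diff act_add inner_diff_right)
  ultimately have "(norm ((E - F) \<cdot> \<psi>))\<^sup>2 + (sn (E - E * E) \<psi>)\<^sup>2 + (sn (F - F * F) \<psi>)\<^sup>2 \<le> \<eta>\<^sup>2"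
    using EF by simp
  then have "(norm ((E - F) \<cdot> \<psi>))\<^sup>2 \<le> \<eta>\<^sup>2" "(sn (E - E * E) \<psi>)\<^sup>2 \<le> \<eta>\<^sup>2" "(sn (F - F * F) \<psi>)\<^sup>2 \<le> \<eta>\<^sup>2"
    by (smt (verit) zero_le_power2)+
  then show "ap 1 E F" "proj 1 E" "proj 1 F"
    using eta_nonneg power2_le_imp_le unfolding ap_def proj_def by auto
qed

text \<open>A product of Bob's effects from different questions is turned, in reverse order, into a
  product of Alice's effects \<open>E\<close> and \<open>D\<close>; when these belong to one of her
  questions, the product is a joint effect \<open>g\<close>.\<close>

lemma cross:
  assumes "ap 1 H E" "ap 1 K D" "H \<in> \<B>" "K \<in> \<B>" "E \<in> \<A>" "D \<in> \<A>" "contr H" "contr D"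
    and "ap 2 (D * E) g"
  shows "ap 4 (H * K) g"
proof -
  have "ap 1 (H * K) (H * D)" using assms ap_left by blast
  also have "H * D = D * H" using commute assms by metis
  also have "ap 1 (D * H) (D * E)" using assms ap_left by blast
  also note assms(9)
  finally show ?thesis by simp
qed

lemma proj_mir:
  assumes "E \<in> \<B>" "eff E" "proj k E" "mir \<A> m c"
  shows "sn (E - E * E) (c \<cdot> \<psi>) \<le> (k + m) * \<eta>"
proof -
  obtain d where d: "d \<in> \<A>" "contr d" "norm (c \<cdot> \<psi> - d \<cdot> \<psi>) \<le> m * \<eta>"
    using assms mir_obtain by blast
  have "E - E * E \<in> \<B>" using assms by simp
  then have "sn (E - E * E) (d \<cdot> \<psi>) \<le> sn (E - E * E) \<psi>"
    using d swap.sn_commute assms eff_square by blast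
  then show ?thesis
    using sn_ap[OF defect_eff[OF assms(2)] d(3)] assms(3) by (simp add: proj_def algebra_simps)
qed

text \<open>\<open>meet_prod\<close> gives a bound in norm only, whereas the defect is needed in the
  seminorm. Here the state is split into \<open>(1 - K) \<cdot> \<psi>\<close>,
  \<open>(1 - H) \<cdot> K \<cdot> \<psi>\<close> and \<open>H \<cdot> K \<cdot> \<psi>\<close>. On
  the first two the defect is dominated by \<open>g\<close>, hence by \<open>K\<close> and
  \<open>H\<close>; on the last by \<open>1 - g\<close>, hence by \<open>(1 - H) + (1 - K)\<close>.
  The costs are 1, 2 and 7.\<close>

lemma meet_proj:
  assumes m: "meet g H K" and B: "g \<in> \<B>" "H \<in> \<B>" "K \<in> \<B>"
    and p: "proj 1 H" "proj 1 K" and mir: "mir \<A> 1 H" "mir \<A> 1 K"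
  shows "proj 10 g"
proof -
  define E where "E = g - g * g"
  note e = meet_eff[OF m]
  have pp: "pos g" "pos (H - g)" "pos (K - g)" "pos (1 - H - K + g)"
    using m by (auto simp: meet_def)
  obtain h where h: "h \<in> \<A>" "contr h" "norm (H \<cdot> \<psi> - h \<cdot> \<psi>) \<le> 1 * \<eta>"
    using mir mir_obtain by blast
  obtain k where k: "k \<in> \<A>" "contr k" "norm (K \<cdot> \<psi> - k \<cdot> \<psi>) \<le> 1 * \<eta>"
    using mir mir_obtain by blast
  have EB: "E \<in> \<B>" using B unfolding E_def by simp
  have Ee: "eff E" unfolding E_def using defect_eff e by blast
  have Eg: "pos (g - E)" using pos_compress[of g 1] pp by (simp add: E_def)
  have "1 - g - E = (1 - g) * 1 * (1 - g)" by (simp add: E_def algebra_simps)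
  then have Eg': "pos (1 - g - E)" using e(1) by (metis effD(2) pos_compress pos_one)
  have cH: "contr (1 - H)" "contr (1 - K)" "contr H" "contr K" using e eff_compl by blast+
  have nw: "norm ((1 - H) \<cdot> K \<cdot> \<psi> - (1 - H) \<cdot> k \<cdot> \<psi>) \<le> 1 * \<eta>" "norm (H \<cdot> K \<cdot> \<psi> - H \<cdot> k \<cdot> \<psi>) \<le> 1 * \<eta>"
    "norm (K \<cdot> H \<cdot> \<psi> - K \<cdot> h \<cdot> \<psi>) \<le> 1 * \<eta>"
    using cH h(3) k(3) contrD order_trans by (fold act_diff_right) blast+
  have 1: "sn E ((1 - K) \<cdot> \<psi>) \<le> \<eta>"
  proof -
    have "sn E ((1 - K) \<cdot> \<psi>) \<le> sn g ((1 - K) \<cdot> \<psi>)" using Ee Eg effD sn_mono by blast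
    also have "\<dots> \<le> sn K ((1 - K) \<cdot> \<psi>)" using pp sn_mono by blast
    also have "\<dots> \<le> 1 * \<eta>" using proj_sn_compl e p by blast
    finally show ?thesis by simp
  qed
  have 2: "sn E ((1 - H) \<cdot> K \<cdot> \<psi>) \<le> 2 * \<eta>"
  proof -
    have "sn E (k \<cdot> (1 - H) \<cdot> \<psi>) \<le> sn E ((1 - H) \<cdot> \<psi>)"
      using EB Ee effD k swap.sn_commute by blast
    also have "\<dots> \<le> sn g ((1 - H) \<cdot> \<psi>)" using Ee Eg effD sn_mono by blast
    also have "\<dots> \<le> sn H ((1 - H) \<cdot> \<psi>)" using pp sn_mono by blast
    also have "\<dots> \<le> 1 * \<eta>" using proj_sn_compl e p by blast
    also have "k \<cdot> (1 - H) \<cdot> \<psi> = (1 - H) \<cdot> k \<cdot> \<psi>"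
      using k B by (intro commute_act) simp_all
    finally show ?thesis using sn_ap[OF Ee nw(1)] by simp
  qed
  have 3: "sn (1 - H) (H \<cdot> K \<cdot> \<psi>) \<le> 2 * \<eta>"
  proof -
    have "sn (1 - H) (k \<cdot> H \<cdot> \<psi>) \<le> sn (1 - H) (H \<cdot> \<psi>)"
      using B e effD k by (intro swap.sn_commute) simp_all
    also have "\<dots> \<le> 1 * \<eta>" using proj_sn_self e p by blast
    also have "k \<cdot> H \<cdot> \<psi> = H \<cdot> k \<cdot> \<psi>" using commute_act k B by blast
    finally show ?thesis using sn_ap[OF eff_compl nw(2)] e by fastforce
  qed
  have 4: "sn (1 - K) (K \<cdot> H \<cdot> \<psi>) \<le> 2 * \<eta>"
  proof -
    have "sn (1 - K) (h \<cdot> K \<cdot> \<psi>) \<le> sn (1 - K) (K \<cdot> \<psi>)"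
      using B e effD h by (intro swap.sn_commute) simp_all
    also have "\<dots> \<le> 1 * \<eta>" using proj_sn_self e p by blast
    also have "h \<cdot> K \<cdot> \<psi> = K \<cdot> h \<cdot> \<psi>" using commute_act h B by blast
    finally show ?thesis using sn_ap[OF eff_compl nw(3)] e by fastforce
  qed
  have 5: "sn (1 - K) (H \<cdot> K \<cdot> \<psi>) \<le> 6 * \<eta>"
  proof -
    have "ap (2 + 2) (H * K) (K * H)"
      using ap_trans[OF meet_prod[OF m p(2)] ap_sym[OF meet_prod[OF meet_commute[OF m] p(1)]]] by simp
    then have "norm (H \<cdot> K \<cdot> \<psi> - K \<cdot> H \<cdot> \<psi>) \<le> 4 * \<eta>" by (simp add: ap_def act_simps)
    then show ?thesis using sn_ap[OF eff_compl[OF e(3)]] 4 by fastforce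
  qed
  have 6: "sn E (H \<cdot> K \<cdot> \<psi>) \<le> 7 * \<eta>"
  proof -
    let ?v = "H \<cdot> K \<cdot> \<psi>"
    have "(1 - H) + (1 - K) - (1 - g) = 1 - H - K + g" by simp
    then have "0 \<le> ?v \<bullet> (((1 - H) + (1 - K) - (1 - g)) \<cdot> ?v)" using pp posD by metis
    moreover have "0 \<le> ?v \<bullet> ((1 - g - E) \<cdot> ?v)" using Eg' posD by blast
    ultimately have "(sn E ?v)\<^sup>2 \<le> (sn (1 - H) ?v)\<^sup>2 + (sn (1 - K) ?v)\<^sup>2"
      using Ee e effD
      by (simp add: sn_sq act_diff act_add inner_diff_right inner_add_right)
    also have "\<dots> \<le> (2 * \<eta>)\<^sup>2 + (6 * \<eta>)\<^sup>2"
      using 3 5 e effD by (intro add_mono power_mono) auto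
    also have "\<dots> \<le> (7 * \<eta>)\<^sup>2" by (simp add: power_mult_distrib)
    finally show ?thesis using eta_nonneg by (auto intro: power2_le_imp_le)
  qed
  have "\<psi> = (1 - K) \<cdot> \<psi> + ((1 - H) \<cdot> K \<cdot> \<psi> + H \<cdot> K \<cdot> \<psi>)" by (simp add: act_simps)
  then have "sn E \<psi> \<le> sn E ((1 - K) \<cdot> \<psi>) + sn E ((1 - H) \<cdot> K \<cdot> \<psi> + H \<cdot> K \<cdot> \<psi>)"
    using sn_triangle[OF effD(1)[OF Ee]] by metis
  also have "\<dots> \<le> sn E ((1 - K) \<cdot> \<psi>) + (sn E ((1 - H) \<cdot> K \<cdot> \<psi>) + sn E (H \<cdot> K \<cdot> \<psi>))"
    using sn_triangle[OF effD(1)[OF Ee]] by simp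
  finally show ?thesis using 1 2 6 unfolding proj_def E_def[symmetric] by simp
qed

text \<open>For an answer \<open>q\<close> that matches nothing by itself, projectivity is available
  only on part of the state. The defect of \<open>q\<close> lies below both \<open>q\<close> and
  \<open>1 - q = p + (1 - (q + p))\<close>. On \<open>r \<cdot> \<psi>\<close> the effect
  \<open>q\<close> is small; on \<open>r' \<cdot> \<psi>\<close> the effect \<open>p\<close> is
  small, and the part outside \<open>q + p\<close> is replaced by \<open>w\<close>, on which
  \<open>q\<close> and \<open>p\<close> are both small.\<close>

lemma defect_on_correlated:
  assumes A: "q \<in> \<A>" "p \<in> \<A>" "eff q" "eff p" "eff (q + p)"
    and B: "r \<in> \<B>" "r' \<in> \<B>" "eff r" "eff r'"
    and s: "small q r" "small p r'" "proj c (q + p)"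
    and w: "norm ((1 - (q + p)) \<cdot> \<psi> - w) \<le> t * \<eta>" "sn q w \<le> t' * \<eta>" "sn p w \<le> t' * \<eta>"
    and nn: "0 \<le> t" "0 \<le> t'" "0 \<le> c"
  shows "sn (q - q * q) ((r + r') \<cdot> \<psi>) \<le> (2 + 2 * t + 2 * t' + c) * \<eta>"
proof -
  define E where "E = q - q * q"
  define s where "s = q + p"
  define \<phi> where "\<phi> = r' \<cdot> \<psi>"
  have Ee: "eff E" unfolding E_def using defect_eff A by blast
  have Eq: "pos (q - E)" using pos_compress[of q 1] A effD by (simp add: E_def)
  have "1 - q - E = (1 - q) * 1 * (1 - q)" by (simp add: E_def algebra_simps)
  then have Eq': "pos (1 - q - E)" using A by (metis effD(2) pos_compress pos_one)
  have cr: "contr r'" using B by blast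
  have se: "eff s" "s \<in> \<A>" using A unfolding s_def by simp_all
  have sA: "1 - s \<in> \<A>" using se by simp
  have 1: "sn E (r \<cdot> \<psi>) \<le> \<eta>"
    using small_sn(1)[OF s(1)] A B sn_mono[OF effD(1)[OF Ee] Eq, of "r \<cdot> \<psi>"] by linarith
  have f: "norm ((1 - s) \<cdot> \<phi> - r' \<cdot> w) \<le> t * \<eta>"
  proof -
    have "(1 - s) \<cdot> \<phi> - r' \<cdot> w = r' \<cdot> ((1 - s) \<cdot> \<psi> - w)"
      unfolding \<phi>_def using commute_act[OF sA B(2)] by (simp add: act_diff_right)
    then show ?thesis using cr w(1) contrD order_trans unfolding s_def by metis
  qed
  have qw: "sn q (r' \<cdot> w) \<le> t' * \<eta>" "sn p (r' \<cdot> w) \<le> t' * \<eta>"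
    using sn_commute A B w cr effD order_trans by meson+
  have E1s: "sn E ((1 - s) \<cdot> \<phi>) \<le> (t + t') * \<eta>"
    using sn_ap[OF Ee f] sn_mono[OF effD(1)[OF Ee] Eq, of "r' \<cdot> w"] qw(1) by (simp add: algebra_simps)
  have p1s: "sn p ((1 - s) \<cdot> \<phi>) \<le> (t + t') * \<eta>"
    using sn_ap[OF A(4) f] qw(2) by (simp add: algebra_simps)
  have ps: "sn p (s \<cdot> \<phi>) \<le> (1 + t + t') * \<eta>"
  proof -
    have "s \<cdot> \<phi> = \<phi> + (-1) *\<^sub>R ((1 - s) \<cdot> \<phi>)" by (simp add: act_simps)
    then have "sn p (s \<cdot> \<phi>) \<le> sn p \<phi> + sn p ((-1) *\<^sub>R ((1 - s) \<cdot> \<phi>))"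
      using sn_triangle[OF effD(1)[OF A(4)]] by metis
    moreover have "sn p ((-1) *\<^sub>R ((1 - s) \<cdot> \<phi>)) = sn p ((1 - s) \<cdot> \<phi>)"
      by (simp add: sn_def act_minus_right)
    moreover have "sn p \<phi> \<le> \<eta>" unfolding \<phi>_def using small_sn(1)[OF s(2)] A B by blast
    ultimately show ?thesis using p1s by (simp add: algebra_simps)
  qed
  have ss: "sn (1 - s) (s \<cdot> \<phi>) \<le> c * \<eta>"
  proof -
    have "sn (1 - s) (r' \<cdot> s \<cdot> \<psi>) \<le> sn (1 - s) (s \<cdot> \<psi>)"
      using sn_commute sA se effD B cr by blast
    also have "\<dots> \<le> c * \<eta>" using proj_sn_self se s(3) s_def by blast
    finally show ?thesis unfolding \<phi>_def using commute_act se B by metis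
  qed
  have Es: "sn E (s \<cdot> \<phi>) \<le> (1 + t + t' + c) * \<eta>"
  proof -
    let ?v = "s \<cdot> \<phi>"
    have "0 \<le> ?v \<bullet> ((1 - q - E) \<cdot> ?v)" using Eq' posD by blast
    moreover have "1 - q = p + (1 - s)" by (simp add: s_def)
    ultimately have "(sn E ?v)\<^sup>2 \<le> (sn p ?v)\<^sup>2 + (sn (1 - s) ?v)\<^sup>2"
      using Ee A se effD
      by (simp add: sn_sq act_diff act_add inner_diff_right inner_add_right)
    also have "\<dots> \<le> (sn p ?v + sn (1 - s) ?v)\<^sup>2"
      using A se effD by (simp add: power2_sum)
    finally have "sn E ?v \<le> sn p ?v + sn (1 - s) ?v"
      using A se effD by (intro power2_le_imp_le[OF _ add_nonneg_nonneg]) auto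
    then show ?thesis using ps ss by (simp add: algebra_simps)
  qed
  have "(r + r') \<cdot> \<psi> = r \<cdot> \<psi> + (s \<cdot> \<phi> + (1 - s) \<cdot> \<phi>)" by (simp add: act_simps \<phi>_def)
  then have "sn E ((r + r') \<cdot> \<psi>) \<le> sn E (r \<cdot> \<psi>) + (sn E (s \<cdot> \<phi>) + sn E ((1 - s) \<cdot> \<phi>))"
    using sn_triangle[OF effD(1)[OF Ee], of "r \<cdot> \<psi>" "s \<cdot> \<phi> + (1 - s) \<cdot> \<phi>"]
      sn_triangle[OF effD(1)[OF Ee], of "s \<cdot> \<phi>" "(1 - s) \<cdot> \<phi>"] by simp
  then show ?thesis
    using 1 Es E1s unfolding E_def[symmetric] by (simp add: algebra_simps)
qed

end

section \<open>The relations imposed by the game\<close>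

text \<open>Entry \<open>! x ! y ! a\<close> lists the answers of Bob that win against Alice's answer \<open>a\<close>.\<close>

definition winning_answers :: "nat set list list list" where
  "winning_answers =
    [[[{0, 1}, {0, 1}, {2, 3}, {2, 3}, {4}],
      [{2, 3, 4}, {0, 1}, {0, 1}, {2, 3, 4}, {2, 3}],
      [{0, 4}, {1, 2, 3}, {0, 4}, {1, 2, 3}, {2, 3}]],
     [[{4}, {0, 2}, {0, 2}, {1, 3}, {1, 3}],
      [{2, 3}, {1, 4}, {0, 2, 3}, {0, 2, 3}, {1, 4}],
      [{2, 3}, {2, 3, 4}, {0, 1}, {2, 3, 4}, {0, 1}]],
     [[{1, 2}, {1, 2}, {0, 4}, {0, 4}, {3}],
      [{1, 2, 3}, {0, 4}, {0, 1, 2, 4}, {0, 1, 3, 4}, {0, 1, 2, 3, 4}],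
      [{0, 2, 3}, {1, 4}, {0, 1, 3, 4}, {0, 1, 2, 4}, {0, 1, 2, 3, 4}]],
     [[{0, 3}, {0, 3}, {2, 4}, {2, 4}, {1}],
      [{0, 4}, {1, 2, 3}, {0, 1, 2, 4}, {0, 1, 3, 4}, {0, 1, 2, 3, 4}],
      [{0, 2, 3}, {1, 4}, {0, 1, 2, 4}, {0, 1, 3, 4}, {0, 1, 2, 3, 4}]]]"

abbreviation loses :: "nat \<Rightarrow> nat \<Rightarrow> nat \<Rightarrow> nat \<Rightarrow> bool" where
  "loses x y a b \<equiv> b \<notin> winning_answers ! x ! y ! a"

definition answers :: "nat set" where
  "answers = {0, 1, 2, 3, 4}"

lemma finite_answers [simp]: "finite answers"
  by (simp add: answers_def)

lemma finite_answers_subset: "I \<subseteq> answers \<Longrightarrow> finite I"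
  using finite_subset finite_answers by blast

context op_state
begin

definition povm :: "(nat \<Rightarrow> 'r) \<Rightarrow> bool" where
  "povm P \<longleftrightarrow> (\<forall>a\<in>answers. pos (P a)) \<and> sum P answers = 1"

lemma povm_pos: "povm P \<Longrightarrow> I \<subseteq> answers \<Longrightarrow> pos (sum P I)"
  unfolding povm_def by (intro pos_sum) auto

lemma povm_compl: "povm P \<Longrightarrow> I \<subseteq> answers \<Longrightarrow> 1 - sum P I = sum P (answers - I)"
  by (simp add: povm_def sum_diff)

lemma povm_eff: "povm P \<Longrightarrow> I \<subseteq> answers \<Longrightarrow> eff (sum P I)"
  unfolding eff_def by (simp add: povm_pos povm_compl)

lemma povm_meet:
  assumes "povm P" "I \<subseteq> answers" "J \<subseteq> answers" "K = I \<inter> J"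
  shows "meet (sum P K) (sum P I) (sum P J)"
proof -
  have fin: "finite I" "finite J" using assms finite_answers_subset by blast+
  have "sum P I - sum P K = sum P (I - J)" "sum P J - sum P K = sum P (J - I)"
    using fin assms(4) by (auto simp: sum_diff[symmetric] intro!: arg_cong[where f = "sum P"])
  moreover have "1 - sum P I - sum P J + sum P K = sum P (answers - (I \<union> J))"
    using povm_compl[of P "I \<union> J"] assms fin sum_Un[of I J P] by (simp add: algebra_simps)
  moreover have "I - J \<subseteq> answers" "J - I \<subseteq> answers" "answers - (I \<union> J) \<subseteq> answers" "K \<subseteq> answers"
    using assms by auto
  ultimately show ?thesis
    unfolding meet_def using povm_pos[OF assms(1)] by metis
qed

end

text \<open>The vectors of the game enter only through the table behind \<open>loses\<close>, with
  one bound for each question pair.\<close>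

locale game = bipartite act \<psi> \<eta> \<A> \<B>
  for act :: "'r::real_algebra_1 \<Rightarrow> 'v::real_inner \<Rightarrow> 'v" (infixr "\<cdot>" 76)
    and \<psi> \<eta> \<A> \<B> +
  fixes M N :: "nat \<Rightarrow> nat \<Rightarrow> 'r"
  assumes M_mem: "x < 4 \<Longrightarrow> a \<in> answers \<Longrightarrow> M x a \<in> \<A>"
    and N_mem: "y < 3 \<Longrightarrow> b \<in> answers \<Longrightarrow> N y b \<in> \<B>"
    and M_povm: "x < 4 \<Longrightarrow> povm (M x)"
    and N_povm: "y < 3 \<Longrightarrow> povm (N y)"
    and loss: "x < 4 \<Longrightarrow> y < 3 \<Longrightarrow>
      (\<Sum>a\<in>answers. \<Sum>b\<in>answers. if loses x y a b then \<psi> \<bullet> ((M x a * N y b) \<cdot> \<psi>) else 0) \<le> \<eta>\<^sup>2"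
begin

abbreviation E :: "nat \<Rightarrow> nat set \<Rightarrow> 'r" where "E x I \<equiv> sum (M x) I"
abbreviation F :: "nat \<Rightarrow> nat set \<Rightarrow> 'r" where "F y J \<equiv> sum (N y) J"

lemma E_mem: "x < 4 \<Longrightarrow> I \<subseteq> answers \<Longrightarrow> E x I \<in> \<A>"
  by (intro A_sum M_mem) auto

lemma F_mem: "y < 3 \<Longrightarrow> J \<subseteq> answers \<Longrightarrow> F y J \<in> \<B>"
  by (intro swap.A_sum N_mem) auto

lemma E_eff: "x < 4 \<Longrightarrow> I \<subseteq> answers \<Longrightarrow> eff (E x I)"
  using M_povm povm_eff by blast

lemma F_eff: "y < 3 \<Longrightarrow> J \<subseteq> answers \<Longrightarrow> eff (F y J)"
  using N_povm povm_eff by blast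

lemma loss_set:
  assumes xy: "x < 4" "y < 3" and R: "R \<subseteq> answers \<times> answers" "\<forall>(a, b)\<in>R. loses x y a b"
  shows "(\<Sum>(a, b)\<in>R. \<psi> \<bullet> ((M x a * N y b) \<cdot> \<psi>)) \<le> \<eta>\<^sup>2"
proof -
  let ?p = "\<lambda>a b. \<psi> \<bullet> ((M x a * N y b) \<cdot> \<psi>)"
  have nn: "0 \<le> ?p a b" if "a \<in> answers" "b \<in> answers" for a b
    using that xy M_mem N_mem M_povm N_povm prod_nonneg unfolding povm_def by blast
  have "(\<Sum>(a, b)\<in>R. ?p a b) = (\<Sum>(a, b)\<in>R. if loses x y a b then ?p a b else 0)"
    using R by (intro sum.cong) auto
  also have "\<dots> \<le> (\<Sum>(a, b)\<in>answers \<times> answers. if loses x y a b then ?p a b else 0)"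
    using R nn by (intro sum_mono2) auto
  also have "\<dots> \<le> \<eta>\<^sup>2"
    using loss[OF xy] by (simp only: sum.cartesian_product[symmetric])
  finally show ?thesis .
qed

lemma expect_prod:
  "\<psi> \<bullet> ((E x I * F y J) \<cdot> \<psi>) = (\<Sum>(a, b)\<in>I \<times> J. \<psi> \<bullet> ((M x a * N y b) \<cdot> \<psi>))"
  by (simp only: sum_product act_sum inner_sum_right flip: sum.cartesian_product)

lemma losing_small:
  assumes "x < 4" "y < 3" "I \<subseteq> answers" "J \<subseteq> answers" "\<forall>a\<in>I. \<forall>b\<in>J. loses x y a b"
  shows "small (E x I) (F y J)"
  unfolding small_def expect_prod using assms by (intro loss_set) auto

text \<open>If every disagreement between \<open>I\<close> and \<open>J\<close> loses, the two
  disjoint rectangles of disagreeing answer pairs together carry at most the losing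
  probability.\<close>

lemma matched:
  assumes "x < 4" "y < 3" "I \<subseteq> answers" "J \<subseteq> answers"
    and l: "\<forall>a\<in>I. \<forall>b\<in>answers - J. loses x y a b" "\<forall>a\<in>answers - I. \<forall>b\<in>J. loses x y a b"
  shows "ap 1 (E x I) (F y J)" "proj 1 (E x I)" "proj 1 (F y J)"
proof -
  have fin: "finite I" "finite J" using assms finite_answers_subset by blast+
  have d: "I \<times> (answers - J) \<inter> (answers - I) \<times> J = {}" by auto
  have "\<psi> \<bullet> ((E x I * (1 - F y J)) \<cdot> \<psi>) + \<psi> \<bullet> (((1 - E x I) * F y J) \<cdot> \<psi>)
      = (\<Sum>(a, b)\<in>I \<times> (answers - J) \<union> (answers - I) \<times> J. \<psi> \<bullet> ((M x a * N y b) \<cdot> \<psi>))"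
    unfolding povm_compl[OF M_povm[OF assms(1)] assms(3)] povm_compl[OF N_povm[OF assms(2)] assms(4)]
      expect_prod using fin by (intro sum.union_disjoint[symmetric] d) simp_all
  also have "\<dots> \<le> \<eta>\<^sup>2"
    using assms by (intro loss_set) auto
  finally have le: "\<psi> \<bullet> ((E x I * (1 - F y J)) \<cdot> \<psi>) + \<psi> \<bullet> (((1 - E x I) * F y J) \<cdot> \<psi>) \<le> \<eta>\<^sup>2" .
  note m = matching[OF E_mem[OF assms(1,3)] E_eff[OF assms(1,3)] F_mem[OF assms(2,4)] F_eff[OF assms(2,4)] le]
  show "ap 1 (E x I) (F y J)" "proj 1 (E x I)" "proj 1 (F y J)" using m by simp_all
qed

section \<open>Unions of answers that determine each other\<close>

lemmas table = winning_answers_def answers_def insert_Diff_if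

text \<open>In this and the following matches the digits are Alice's and Bob's question. Each holds
  because the vectors listed for the two answer sets span the same subspace, here that of e0 and e1;
  in \<open>match_01\<close> it is that of e0 + e1 and e2 - e3.\<close>

lemma match_00: "ap 1 (E 0 {0, 1}) (F 0 {0, 1})" "proj 1 (E 0 {0, 1})" "proj 1 (F 0 {0, 1})"
  using matched[of 0 0 "{0, 1}" "{0, 1}"] by (simp_all add: table)

lemma match_00': "ap 1 (E 0 {2, 3}) (F 0 {2, 3})" "proj 1 (E 0 {2, 3})" "proj 1 (F 0 {2, 3})"
  using matched[of 0 0 "{2, 3}" "{2, 3}"] by (simp_all add: table)

lemma match_00'': "ap 1 (E 0 {4}) (F 0 {4})" "proj 1 (E 0 {4})" "proj 1 (F 0 {4})"
  using matched[of 0 0 "{4}" "{4}"] by (simp_all add: table)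

lemma match_10: "ap 1 (E 1 {0}) (F 0 {4})" "proj 1 (E 1 {0})" "proj 1 (F 0 {4})"
  using matched[of 1 0 "{0}" "{4}"] by (simp_all add: table)

lemma match_10': "ap 1 (E 1 {1, 2}) (F 0 {0, 2})" "proj 1 (E 1 {1, 2})" "proj 1 (F 0 {0, 2})"
  using matched[of 1 0 "{1, 2}" "{0, 2}"] by (simp_all add: table)

lemma match_10'': "ap 1 (E 1 {3, 4}) (F 0 {1, 3})" "proj 1 (E 1 {3, 4})" "proj 1 (F 0 {1, 3})"
  using matched[of 1 0 "{3, 4}" "{1, 3}"] by (simp_all add: table)

lemma match_20: "ap 1 (E 2 {0, 1}) (F 0 {1, 2})" "proj 1 (E 2 {0, 1})" "proj 1 (F 0 {1, 2})"
  using matched[of 2 0 "{0, 1}" "{1, 2}"] by (simp_all add: table)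

lemma match_20': "ap 1 (E 2 {2, 3}) (F 0 {0, 4})" "proj 1 (E 2 {2, 3})" "proj 1 (F 0 {0, 4})"
  using matched[of 2 0 "{2, 3}" "{0, 4}"] by (simp_all add: table)

lemma match_20'': "ap 1 (E 2 {4}) (F 0 {3})" "proj 1 (E 2 {4})" "proj 1 (F 0 {3})"
  using matched[of 2 0 "{4}" "{3}"] by (simp_all add: table)

lemma match_30: "ap 1 (E 3 {0, 1}) (F 0 {0, 3})" "proj 1 (E 3 {0, 1})" "proj 1 (F 0 {0, 3})"
  using matched[of 3 0 "{0, 1}" "{0, 3}"] by (simp_all add: table)

lemma match_30': "ap 1 (E 3 {2, 3}) (F 0 {2, 4})" "proj 1 (E 3 {2, 3})" "proj 1 (F 0 {2, 4})"
  using matched[of 3 0 "{2, 3}" "{2, 4}"] by (simp_all add: table)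

lemma match_30'': "ap 1 (E 3 {4}) (F 0 {1})" "proj 1 (E 3 {4})" "proj 1 (F 0 {1})"
  using matched[of 3 0 "{4}" "{1}"] by (simp_all add: table)

lemma match_01: "ap 1 (E 0 {1, 2}) (F 1 {0, 1})" "proj 1 (E 0 {1, 2})" "proj 1 (F 1 {0, 1})"
  using matched[of 0 1 "{1, 2}" "{0, 1}"] by (simp_all add: table)

lemma match_11: "ap 1 (E 1 {0, 2, 3}) (F 1 {0, 2, 3})" "proj 1 (E 1 {0, 2, 3})" "proj 1 (F 1 {0, 2, 3})"
  using matched[of 1 1 "{0, 2, 3}" "{0, 2, 3}"] by (simp_all add: table)

lemma match_02: "ap 1 (E 0 {1, 3, 4}) (F 2 {1, 2, 3})" "proj 1 (E 0 {1, 3, 4})" "proj 1 (F 2 {1, 2, 3})"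
  using matched[of 0 2 "{1, 3, 4}" "{1, 2, 3}"] by (simp_all add: table)

lemma match_12: "ap 1 (E 1 {2, 4}) (F 2 {0, 1})" "proj 1 (E 1 {2, 4})" "proj 1 (F 2 {0, 1})"
  using matched[of 1 2 "{2, 4}" "{0, 1}"] by (simp_all add: table)

end

section \<open>Calculating with words in Bob's operators\<close>

context bipartite
begin

text \<open>An operator with \<open>bc\<close> may be multiplied to a relation from the left at no
  cost; one with \<open>ok m\<close> also from the right, at cost \<open>2 * m\<close>, which is how
  \<open>step\<close> uses them.\<close>

definition bc :: "'r \<Rightarrow> bool" where "bc T \<longleftrightarrow> T \<in> \<B> \<and> contr T"

definition ok :: "real \<Rightarrow> 'r \<Rightarrow> bool" where "ok m T \<longleftrightarrow> bc T \<and> mir \<A> m T"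

lemma contr_zero [simp]: "contr 0" by (simp add: contr_def)

lemma bc_zero [simp]: "bc 0" and bc_one [simp]: "bc 1"
  by (simp_all add: bc_def)

lemma bc_mult [simp]: "bc S \<Longrightarrow> bc T \<Longrightarrow> bc (S * T)"
  by (auto simp: bc_def)

lemma bc_minus [simp]: "bc S \<Longrightarrow> bc (- S)"
  by (auto simp: bc_def)

lemma bc_contr [simp]: "bc S \<Longrightarrow> contr S" by (simp add: bc_def)

lemma bc_scale: "bc S \<Longrightarrow> \<bar>c\<bar> \<le> 1 \<Longrightarrow> bc (c *\<^sub>R S)"
  unfolding bc_def contr_def by (simp add: act_scale) (meson abs_ge_zero mult_left_le_one_le norm_ge_zero order_trans)

lemma bc_eff: "T \<in> \<B> \<Longrightarrow> eff T \<Longrightarrow> bc T" by (auto simp: bc_def)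

lemma bc_reflection: "T \<in> \<B> \<Longrightarrow> eff T \<Longrightarrow> bc (2 * T - 1)"
  using contr_reflection by (simp add: bc_def)

lemma ok_bc [simp]: "ok m T \<Longrightarrow> bc T" by (simp add: ok_def)

lemma ok_mir: "ok m T \<Longrightarrow> mir \<A> m T" by (simp add: ok_def)

lemma ok_one: "ok 0 1"
  by (auto simp: ok_def intro: mirI A_one)

lemma ok_mult: "ok m S \<Longrightarrow> ok n T \<Longrightarrow> ok (m + n) (S * T)"
  using mir_mult by (auto simp: ok_def bc_def)

lemma ok_mono: "ok m S \<Longrightarrow> m \<le> n \<Longrightarrow> ok n S"
  using mir_mono by (auto simp: ok_def)

lemma two_scaleR: "2 * (T :: 'r) = 2 *\<^sub>R T"
  by (simp add: scaleR_conv_of_real)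

lemma ap_double: "ap k X Y \<Longrightarrow> ap (2 * k) (2 * X - Z) (2 * Y - Z)"
  using ap_scale[of k X Y 2] unfolding two_scaleR by (simp add: ap_def)

lemma ok_reflection:
  assumes "T \<in> \<B>" "eff T" "S \<in> \<A>" "eff S" "ap m S T"
  shows "ok (2 * m) (2 * T - 1)"
proof -
  have "ap (2 * m) (2 * T - 1) (2 * S - 1)" using ap_double ap_sym assms by blast
  then show ?thesis
    using assms bc_reflection contr_reflection by (auto simp: ok_def intro!: mirI[of "2 * S - 1"])
qed

lemma step:
  assumes "ap k S T" "bc S" "bc T" "contr L" "ok m R" "k + 2 * m \<le> l"
  shows "ap l (L * (S * R)) (L * (T * R))"
  using assms by (intro ap_left ap_mono[OF ap_right]) (auto simp: ok_def bc_def)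

lemma square_reflection:
  assumes "eff T" "proj 1 T"
  shows "ap 4 ((2 * T - 1) * (2 * T - 1)) 1"
proof -
  have "norm ((T - T * T) \<cdot> \<psi>) \<le> 1 * \<eta>"
    using norm_le_sn[OF defect_eff[OF assms(1)], of \<psi>] assms(2) unfolding proj_def by linarith
  then have "ap (\<bar>-4\<bar> * 1) ((-4) *\<^sub>R (T - T * T)) ((-4) *\<^sub>R 0)"
    by (intro ap_scale) (simp add: ap_def)
  moreover have "(-4) *\<^sub>R (T - T * T) - (-4) *\<^sub>R 0 = (2 * T - 1) * (2 * T - 1) - 1"
    unfolding two_scaleR by (simp add: algebra_simps) (simp flip: scaleR_add_left)
  ultimately show ?thesis by (simp add: ap_cong_diff)
qed

lemma ap_halve: "ap k X (- X) \<Longrightarrow> ap (k / 2) X 0"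
proof -
  assume "ap k X (- X)"
  then have "norm (2 *\<^sub>R (X \<cdot> \<psi>)) \<le> k * \<eta>" by (simp add: ap_def act_add act_minus scaleR_2)
  then show ?thesis by (simp add: ap_def)
qed

text \<open>Inserting \<open>b' * b'\<close> and exchanging \<open>b\<close>, \<open>b'\<close> for \<open>c\<close>, \<open>c'\<close> by the three hypotheses turns \<open>q * b * q\<close>
  into its negative.\<close>

lemma magic_square:
  assumes ok: "ok 2 q" "ok 2 b" "ok 2 b'" "ok 2 c" "ok 2 c'"
    and sq: "ap 4 (b' * b') 1" "ap 4 (c' * c') 1"
    and h1: "ap k1 (b' * b * q) (\<sigma> *\<^sub>R (c' * c * q))"
    and h2: "ap k2 (c * q) (\<tau> *\<^sub>R (b * q))"
    and h3: "ap k3 (q * b') (\<tau>' *\<^sub>R (q * c'))"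
    and sgn: "\<sigma> * \<tau> * \<tau>' = -1" "\<bar>\<sigma>\<bar> = 1" "\<bar>\<tau>\<bar> = 1" "\<bar>\<tau>'\<bar> = 1"
  shows "ap ((k1 + k2 + k3 + 36) / 2) (q * b * q) 0"
proof -
  have bq: "ok 4 (b * q)" using ok_mult[OF ok(2,1)] by simp
  have cbq: "ok 6 (c' * (b * q))" using ok_mult[OF ok(5) bq] by simp
  have s1: "ap 12 (q * b * q) (q * b' * b' * b * q)"
    using ap_sym[OF step[OF sq(1) _ _ _ bq, of q 12]] ok by (simp add: mult.assoc)
  have s2: "ap k1 (q * b' * b' * b * q) (\<sigma> *\<^sub>R (q * b' * c' * c * q))"
    using ap_left[OF h1, of "q * b'"] ok by (simp add: mult.assoc contr_mult)
  have s3: "ap k2 (\<sigma> *\<^sub>R (q * b' * c' * c * q)) ((\<sigma> * \<tau>) *\<^sub>R (q * b' * c' * b * q))"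
    using ap_scale[OF ap_left[OF h2, of "q * b' * c'"], of \<sigma>] ok sgn
    by (simp add: mult.assoc contr_mult)
  have s4: "ap (k3 + 12) ((\<sigma> * \<tau>) *\<^sub>R (q * b' * c' * b * q)) (- (q * c' * c' * b * q))"
  proof -
    have "ap (k3 + 12) (1 * (q * b' * (c' * (b * q)))) (1 * (\<tau>' *\<^sub>R (q * c') * (c' * (b * q))))"
      using ok sgn by (intro step[OF h3 _ _ _ cbq]) (auto intro: bc_scale)
    from ap_scale[OF this, of "\<sigma> * \<tau>"] show ?thesis
      using sgn by (simp add: mult.assoc abs_mult)
  qed
  have s5: "ap 12 (- (q * c' * c' * b * q)) (- (q * b * q))"
    using ap_neg[OF step[OF sq(2) _ _ _ bq, of q 12]] ok by (simp add: mult.assoc)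
  have "ap (12 + k1 + k2 + (k3 + 12) + 12) (q * b * q) (- (q * b * q))"
    using ap_trans[OF ap_trans[OF ap_trans[OF ap_trans[OF s1 s2] s3] s4] s5] by simp
  from ap_halve[OF this] show ?thesis by (simp add: algebra_simps)
qed

text \<open>On the sum of two blocks, which it preserves, \<open>b\<close> is a 2 by 2 block matrix
  with vanishing diagonal; so it maps each block into the other.\<close>

lemma block_swap:
  assumes ok: "ok 2 p" "ok 2 q" "ok 2 b"
    and abs: "ap 8 ((p + q) * p) p" "ap 8 (q * (p + q)) q" and bc: "bc (p + q)"
    and com: "ap 16 ((p + q) * b) (b * (p + q))"
    and z: "ap 91 (p * b * p) 0" "ap 91 (q * b * q) 0"
  shows "ap 240 (q * b) (b * p)" "ap 130 (b * p) (q * b * p)"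
proof -
  have 1: "ap 8 (b * p) (b * (p + q) * p)"
    using ap_sym[OF ap_left[OF abs(1), of b]] ok by (simp add: mult.assoc)
  have 2: "ap 20 (b * (p + q) * p) ((p + q) * b * p)"
    using ap_sym[OF step[OF com _ _ _ ok(1), of 1 20]] ok bc by (simp add: mult.assoc)
  have 3: "ap 91 ((p + q) * b * p) (q * b * p)"
    using z(1) by (simp add: ap_def algebra_simps)
  have 4: "ap 119 (b * p) (q * b * p)"
    using ap_trans[OF ap_trans[OF 1 2] 3] by simp
  have 5: "ap 12 (q * b) (q * (p + q) * b)"
    using ap_sym[OF step[OF abs(2) _ _ _ ok(3), of 1 12]] ok bc by (simp add: mult.assoc)
  have 6: "ap 16 (q * (p + q) * b) (q * b * (p + q))"
    using ap_left[OF com, of q] ok by (simp add: mult.assoc)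
  have 7: "ap 91 (q * b * (p + q)) (q * b * p)"
    using z(2) by (simp add: ap_def algebra_simps)
  show "ap 240 (q * b) (b * p)"
    using ap_trans[OF ap_trans[OF 5 ap_trans[OF 6 7]] ap_sym[OF 4]] ap_mono by simp
  show "ap 130 (b * p) (q * b * p)" using 4 ap_mono by simp
qed

end

section \<open>The four coordinate blocks and the magic square\<close>

context game
begin

declare sum.insert [simp del]

definition Q :: "nat \<Rightarrow> 'r" where "Q i = N 0 i"
text \<open>In the ideal strategy \<open>B1\<close> sends e0, e2 to e1, -e3 and \<open>B2\<close>
  sends e0, e1 to e2, -e3, while \<open>C1\<close> and \<open>C2\<close> are the same exchanges
  without the minus signs. On e4 the reflections \<open>B1\<close>, \<open>C2\<close> are -1 and
  \<open>B2\<close>, \<open>C1\<close> are +1.\<close>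

definition "F1 = F 1 {0, 1}"
definition "F2 = F 1 {0, 2, 3}"
definition "F3 = F 2 {1, 2, 3}"
definition "F4 = F 2 {0, 1}"
definition "B1 = 2 * F1 - 1"
definition "B2 = 2 * F2 - 1"
definition "C1 = 2 * F3 - 1"
definition "C2 = 2 * F4 - 1"

lemma F_pair: "i \<noteq> j \<Longrightarrow> F 0 {i, j} = Q i + Q j"
  by (simp add: Q_def sum.insert)

lemma F_single: "F 0 {i} = Q i"
  by (simp add: Q_def sum.insert)

lemmas F_defs = F1_def F2_def F3_def F4_def

lemma F14_mem: "F1 \<in> \<B>" "F2 \<in> \<B>" "F3 \<in> \<B>" "F4 \<in> \<B>"
  unfolding F_defs by (simp_all add: F_mem answers_def)

lemma F14_eff: "eff F1" "eff F2" "eff F3" "eff F4"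
  unfolding F_defs by (simp_all add: F_eff answers_def)

lemma Q_mem: "i \<in> answers \<Longrightarrow> Q i \<in> \<B>"
  using F_mem[of 0 "{i}"] by (simp add: F_single)

lemma Q_eff: "i \<in> answers \<Longrightarrow> eff (Q i)"
  using F_eff[of 0 "{i}"] by (simp add: F_single)

lemma Q_bc: "i \<in> answers \<Longrightarrow> bc (Q i)"
  using bc_eff Q_mem Q_eff by blast

lemma ok_matched:
  assumes "x < 4" "I \<subseteq> answers" "y < 3" "J \<subseteq> answers" "ap 1 (E x I) (F y J)"
  shows "ok 1 (F y J)" "ok 2 (2 * F y J - 1)"
proof -
  show "ok 1 (F y J)"
    using E_mem[OF assms(1,2)] E_eff[OF assms(1,2)] F_mem[OF assms(3,4)] F_eff[OF assms(3,4)]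
      ap_sym[OF assms(5)] by (auto simp: ok_def intro: mirI bc_eff)
  show "ok 2 (2 * F y J - 1)"
    using ok_reflection[OF F_mem[OF assms(3,4)] F_eff[OF assms(3,4)] E_mem[OF assms(1,2)]
        E_eff[OF assms(1,2)] assms(5)] by simp
qed

lemma ok_B: "ok 2 B1" "ok 2 B2" "ok 2 C1" "ok 2 C2"
  unfolding B1_def B2_def C1_def C2_def F_defs
  by (rule ok_matched(2)[OF _ _ _ _ match_01(1)] ok_matched(2)[OF _ _ _ _ match_11(1)]
      ok_matched(2)[OF _ _ _ _ match_02(1)] ok_matched(2)[OF _ _ _ _ match_12(1)]; simp add: answers_def)+

lemma ok_F: "ok 1 F1" "ok 1 F2" "ok 1 F3" "ok 1 F4"
  unfolding F_defs
  by (rule ok_matched(1)[OF _ _ _ _ match_01(1)] ok_matched(1)[OF _ _ _ _ match_11(1)]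
      ok_matched(1)[OF _ _ _ _ match_02(1)] ok_matched(1)[OF _ _ _ _ match_12(1)]; simp add: answers_def)+

lemma ok_diff:
  assumes "T \<in> \<B>" "eff T" "eff S'" "eff T'" "S' \<in> \<A>" "T' \<in> \<A>" "ap 2 T (S' - T')"
  shows "ok 2 T"
  using assms contr_diff by (auto simp: ok_def bc_eff intro!: mirI[of "S' - T'"])

text \<open>Alice's rows contain e1, e3 and e4 but neither e0 nor e2. So \<open>Q 0\<close> and
  \<open>Q 2\<close> are mirrored by differences of two of her effects, contractive by
  \<open>contr_diff\<close>, which makes the common cost 2.\<close>

lemma ok_Q: "i \<in> answers \<Longrightarrow> ok 2 (Q i)"
proof -
  have 1: "ok 2 (Q 1)" and 3: "ok 2 (Q 3)" and 4: "ok 2 (Q 4)"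
    using ok_mono[OF ok_matched(1)[OF _ _ _ _ match_30''(1)], of 2]
      ok_mono[OF ok_matched(1)[OF _ _ _ _ match_20''(1)], of 2]
      ok_mono[OF ok_matched(1)[OF _ _ _ _ match_00''(1)], of 2]
    by (simp_all add: answers_def F_single)
  have "ap 2 (Q 0) (E 0 {0, 1} - E 3 {4})"
    using ap_sym[OF ap_diff[OF match_00(1) match_30''(1)]] by (simp add: F_pair F_single)
  from ok_diff[OF _ _ _ _ _ _ this] have 0: "ok 2 (Q 0)"
    by (simp add: Q_mem Q_eff E_mem E_eff answers_def)
  have "ap 2 (Q 2) (E 0 {2, 3} - E 2 {4})"
    using ap_sym[OF ap_diff[OF match_00'(1) match_20''(1)]] by (simp add: F_pair F_single)
  from ok_diff[OF _ _ _ _ _ _ this] have 2: "ok 2 (Q 2)"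
    by (simp add: Q_mem Q_eff E_mem E_eff answers_def)
  show "i \<in> answers \<Longrightarrow> ok 2 (Q i)" using 0 1 2 3 4 by (auto simp: answers_def)
qed

lemma F_prod:
  assumes "y < 3" "proj 1 (F y J)" "I \<subseteq> answers" "J \<subseteq> answers"
  shows "ap 2 (F y I * F y J) (F y (I \<inter> J))"
  using meet_prod[OF povm_meet[OF N_povm[OF assms(1)] assms(3,4) refl] assms(2)] by simp

text \<open>\<open>Q 1\<close>, \<open>Q 3\<close> and \<open>Q 4\<close> are projective by a match
  of their own; 0 and 2 occur only in matched pairs. For these \<open>j\<close> the product with a
  pair \<open>{j, l}\<close> is reduced by the product with \<open>Q l\<close>, where
  \<open>l\<close> must differ from \<open>i\<close>; hence the case distinctions.\<close>

lemma Q_orth: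
  assumes i: "i \<in> answers" and j: "j \<in> answers" and "i \<noteq> j"
  shows "ap 4 (Q i * Q j) 0"
proof -
  have single: "ap 2 (Q i * Q l) 0" if "l \<in> {1, 3, 4}" "i \<noteq> l" for l
  proof -
    have "proj 1 (F 0 {l})" using that match_00'' match_20'' match_30'' by auto
    moreover have "{i} \<inter> {l} = {}" "l \<in> answers" using that by (auto simp: answers_def)
    ultimately show ?thesis using F_prod[of 0 "{l}" "{i}"] i by (simp add: F_single)
  qed
  have pair: "ap 4 (Q i * Q j) 0" if "l \<in> {1, 3, 4}" "i \<noteq> l" "j \<noteq> l" "l \<in> answers" "proj 1 (F 0 {j, l})" for l
  proof -
    have "ap 2 (Q i * (Q j + Q l)) 0"
      using F_prod[OF _ that(5), of "{i}"] i j that \<open>i \<noteq> j\<close> by (simp add: F_single F_pair)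
    from ap_diff[OF this single[OF that(1,2)]] show ?thesis by (simp add: algebra_simps)
  qed
  consider "j \<in> {1, 3, 4}" | "j = 0" | "j = 2" using j by (auto simp: answers_def)
  then show ?thesis
  proof cases
    case 1
    then show ?thesis using single[of j] assms ap_mono by force
  next
    case 2
    show ?thesis
    proof (cases "i = 1")
      case True
      then show ?thesis using pair[of 3] 2 match_30 by (simp add: answers_def)
    next
      case False
      then show ?thesis using pair[of 1] 2 match_00 by (simp add: answers_def)
    qed
  next
    case 3
    show ?thesis
    proof (cases "i = 3")
      case True
      then show ?thesis using pair[of 4] 3 match_30' by (simp add: answers_def)
    next
      case False
      then show ?thesis using pair[of 3] 3 match_00' by (simp add: answers_def)
    qed
  qed
qed

lemma Q_idem:
  assumes "i \<in> answers"
  shows "ap 4 (Q i * Q i) (Q i)"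
proof -
  have single: "ap 2 (Q i * Q l) (if i = l then Q i else 0)" if "l \<in> {1, 3, 4}" for l
  proof -
    have "proj 1 (F 0 {l})" using that match_00'' match_20'' match_30'' by auto
    moreover have "{i} \<inter> {l} = (if i = l then {i} else {})" "l \<in> answers"
      using that by (auto simp: answers_def)
    ultimately show ?thesis using F_prod[of 0 "{l}" "{i}"] assms by (simp add: F_single split: if_splits)
  qed
  consider "i \<in> {1, 3, 4}" | "i = 0" | "i = 2" using assms by (auto simp: answers_def)
  then show ?thesis
  proof cases
    case 1
    then show ?thesis using ap_mono[OF single[of i], of 4] by simp
  next
    case 2
    have "ap 2 (Q i * (Q 0 + Q 1)) (Q i)"
      using F_prod[OF _ match_00(3), of "{0}"] 2 by (simp add: Q_def sum.insert answers_def)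
    from ap_diff[OF this single[of 1]] 2 show ?thesis by (simp add: algebra_simps)
  next
    case 3
    have "ap 2 (Q i * (Q 2 + Q 3)) (Q i)"
      using F_prod[OF _ match_00'(3), of "{2}"] 3 by (simp add: Q_def sum.insert answers_def)
    from ap_diff[OF this single[of 3]] 3 show ?thesis by (simp add: algebra_simps)
  qed
qed

lemma Q_absorb:
  assumes "i \<in> answers" "j \<in> answers" "i \<noteq> j"
  shows "ap 8 ((Q i + Q j) * Q i) (Q i)" "ap 8 (Q i * (Q i + Q j)) (Q i)"
    "ap 8 ((Q j + Q i) * Q i) (Q i)" "ap 8 (Q i * (Q j + Q i)) (Q i)"
  using ap_add[OF Q_idem[OF assms(1)] Q_orth[OF assms(2,1)]]
    ap_add[OF Q_idem[OF assms(1)] Q_orth[OF assms(1,2)]] assms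
  by (simp_all add: algebra_simps)

lemma F14_proj: "proj 1 F1" "proj 1 F2" "proj 1 F3" "proj 1 F4"
  unfolding F_defs by (rule match_01(3) match_11(3) match_02(3) match_12(3))+

lemma B_square: "ap 4 (B1 * B1) 1" "ap 4 (B2 * B2) 1" "ap 4 (C1 * C1) 1" "ap 4 (C2 * C2) 1"
  unfolding B1_def B2_def C1_def C2_def by (rule square_reflection F14_eff F14_proj)+

lemma E_prod:
  assumes "x < 4" "proj 1 (E x J)" "I \<subseteq> answers" "J \<subseteq> answers"
  shows "ap 2 (E x I * E x J) (E x (I \<inter> J))"
  using meet_prod[OF povm_meet[OF M_povm[OF assms(1)] assms(3,4) refl] assms(2)] by simp

lemma F_cross:
  assumes x: "x < 4" "I \<subseteq> answers" "J \<subseteq> answers" and y: "y < 3" "K \<subseteq> answers" and z: "z < 3" "L \<subseteq> answers"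
    and m: "ap 1 (E x I) (F y K)" "ap 1 (E x J) (F z L)" "proj 1 (E x I)" "I \<inter> J = S"
  shows "ap 4 (F y K * F z L) (E x S)"
proof -
  have "ap 2 (E x J * E x I) (E x S)"
    using E_prod[OF x(1) m(3) x(3,2)] m(4) by (simp add: Int_commute)
  then show ?thesis
    using x y z m F_eff E_eff
    by (intro cross[OF ap_sym[OF m(1)] ap_sym[OF m(2)]]) (auto intro!: F_mem E_mem eff_contr)
qed

text \<open>Question 0 of Alice is the mediator. Equal results for both orders give commutation. On
  the pair 0, 1 both \<open>F1\<close> and \<open>F3\<close> lead to her answer 1, but on the pair
  2, 3 to the complementary answers 2 and 3: this is the origin of the sign
  \<open>tau1\<close>.\<close>

lemma cross_01:
  "ap 4 (F 0 {0, 1} * F1) (E 0 {1})" "ap 4 (F1 * F 0 {0, 1}) (E 0 {1})"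
  "ap 4 (F 0 {0, 1} * F3) (E 0 {1})" "ap 4 (F3 * F 0 {0, 1}) (E 0 {1})"
  "ap 4 (F 0 {2, 3} * F1) (E 0 {2})" "ap 4 (F1 * F 0 {2, 3}) (E 0 {2})"
  "ap 4 (F 0 {2, 3} * F3) (E 0 {3})" "ap 4 (F3 * F 0 {2, 3}) (E 0 {3})"
  "ap 4 (F 0 {4} * F1) 0" "ap 4 (F1 * F 0 {4}) 0"
  unfolding F_defs
  by (rule F_cross[OF _ _ _ _ _ _ _ match_00(1) match_01(1) match_00(2)]
      F_cross[OF _ _ _ _ _ _ _ match_01(1) match_00(1) match_01(2)]
      F_cross[OF _ _ _ _ _ _ _ match_00(1) match_02(1) match_00(2)]
      F_cross[OF _ _ _ _ _ _ _ match_02(1) match_00(1) match_02(2)]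
      F_cross[OF _ _ _ _ _ _ _ match_00'(1) match_01(1) match_00'(2)]
      F_cross[OF _ _ _ _ _ _ _ match_01(1) match_00'(1) match_01(2)]
      F_cross[OF _ _ _ _ _ _ _ match_00'(1) match_02(1) match_00'(2)]
      F_cross[OF _ _ _ _ _ _ _ match_02(1) match_00'(1) match_02(2)]
      F_cross[OF _ _ _ _ _ _ _ match_00''(1) match_01(1) match_00''(2), of "{}", unfolded sum.empty]
      F_cross[OF _ _ _ _ _ _ _ match_01(1) match_00''(1) match_01(2), of "{}", unfolded sum.empty];
      simp add: answers_def)+

lemma cross_02:
  "ap 4 (F 0 {0, 2} * F2) (E 1 {2})" "ap 4 (F2 * F 0 {0, 2}) (E 1 {2})"
  "ap 4 (F 0 {0, 2} * F4) (E 1 {2})" "ap 4 (F4 * F 0 {0, 2}) (E 1 {2})"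
  "ap 4 (F 0 {1, 3} * F2) (E 1 {3})" "ap 4 (F2 * F 0 {1, 3}) (E 1 {3})"
  "ap 4 (F 0 {1, 3} * F4) (E 1 {4})" "ap 4 (F4 * F 0 {1, 3}) (E 1 {4})"
  "ap 4 (F 0 {4} * F2) (E 1 {0})"
  unfolding F_defs
  by (rule F_cross[OF _ _ _ _ _ _ _ match_10'(1) match_11(1) match_10'(2)]
      F_cross[OF _ _ _ _ _ _ _ match_11(1) match_10'(1) match_11(2)]
      F_cross[OF _ _ _ _ _ _ _ match_10'(1) match_12(1) match_10'(2)]
      F_cross[OF _ _ _ _ _ _ _ match_12(1) match_10'(1) match_12(2)]
      F_cross[OF _ _ _ _ _ _ _ match_10''(1) match_11(1) match_10''(2)]
      F_cross[OF _ _ _ _ _ _ _ match_11(1) match_10''(1) match_11(2)]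
      F_cross[OF _ _ _ _ _ _ _ match_10''(1) match_12(1) match_10''(2)]
      F_cross[OF _ _ _ _ _ _ _ match_12(1) match_10''(1) match_12(2)]
      F_cross[OF _ _ _ _ _ _ _ match_10(1) match_11(1) match_10(2)];
      simp add: answers_def)+

end

context bipartite
begin

lemma reflection_cong_right: "ap k (H * K) (H * K') \<Longrightarrow> ap (2 * k) (H * (2 * K - 1)) (H * (2 * K' - 1))"
  using ap_double[of k "H * K" "H * K'" H] unfolding two_scaleR by (simp add: algebra_simps)

lemma reflection_cong_left: "ap k (K * H) (K' * H) \<Longrightarrow> ap (2 * k) ((2 * K - 1) * H) ((2 * K' - 1) * H)"
  using ap_double[of k "K * H" "K' * H" H] unfolding two_scaleR by (simp add: algebra_simps)

lemma reflection_comm: "ap k (H * K) (K * H) \<Longrightarrow> ap (2 * k) (H * (2 * K - 1)) ((2 * K - 1) * H)"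
  using ap_double[of k "H * K" "K * H" H] unfolding two_scaleR by (simp add: algebra_simps)

lemma reflection_neg_right:
  assumes "ap k (H * K + H * K') H"
  shows "ap (2 * k) (H * (2 * K - 1)) (- (H * (2 * K' - 1)))"
proof -
  have "2 *\<^sub>R (H * K + H * K') - 2 *\<^sub>R H = H * (2 * K - 1) - - (H * (2 * K' - 1))"
    unfolding two_scaleR by (simp add: algebra_simps scaleR_2)
  then show ?thesis using ap_scale[OF assms, of 2] by (simp add: ap_cong_diff)
qed

lemma reflection_neg_left:
  assumes "ap k (K * H + K' * H) H"
  shows "ap (2 * k) ((2 * K - 1) * H) (- ((2 * K' - 1) * H))"
proof -
  have "2 *\<^sub>R (K * H + K' * H) - 2 *\<^sub>R H = (2 * K - 1) * H - - ((2 * K' - 1) * H)"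
    unfolding two_scaleR by (simp add: algebra_simps scaleR_2)
  then show ?thesis using ap_scale[OF assms, of 2] by (simp add: ap_cong_diff)
qed

text \<open>Restricts a sign relation from the matched pair of blocks \<open>H\<close> to a single
  block \<open>q\<close>: \<open>H\<close> is inserted next to \<open>q\<close>, the relation is
  applied, and \<open>H\<close> is absorbed again.\<close>

lemma block_right:
  assumes q: "ok 2 q" "ap 8 (H * q) q" and bc: "bc H" "bc b" "bc c"
    and h: "ap 18 (c * H) (s *\<^sub>R (b * H))" and s: "\<bar>s\<bar> = 1"
  shows "ap 40 (c * q) (s *\<^sub>R (b * q))"
proof -
  have 1: "ap 8 (c * q) (c * H * q)"
    using ap_sym[OF ap_left[OF q(2), of c]] bc by (simp add: mult.assoc)
  have 2: "ap 22 (c * H * q) (s *\<^sub>R (b * H * q))"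
    using step[OF h _ _ _ q(1), of 1 22] bc s by (simp add: mult.assoc bc_scale)
  have 3: "ap 8 (s *\<^sub>R (b * H * q)) (s *\<^sub>R (b * q))"
    using ap_scale[OF ap_left[OF q(2), of b], of s] bc s by (simp add: mult.assoc)
  show ?thesis using ap_trans[OF ap_trans[OF 1 2] 3] by (rule ap_mono) simp
qed

lemma block_left:
  assumes q: "bc q" "ap 8 (q * H) q" and bc: "bc H" "ok 2 b" "ok 2 c"
    and h: "ap 18 (H * b) (s *\<^sub>R (H * c))" and s: "\<bar>s\<bar> = 1"
  shows "ap 42 (q * b) (s *\<^sub>R (q * c))"
proof -
  have 1: "ap 12 (q * b) (q * H * b)"
    using ap_sym[OF step[OF q(2) _ _ _ bc(2), of 1 12]] q bc by (simp add: mult.assoc)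
  have 2: "ap 18 (q * H * b) (s *\<^sub>R (q * H * c))"
    using ap_left[OF h, of q] q bc by (simp add: mult.assoc)
  have 3: "ap 12 (s *\<^sub>R (q * H * c)) (s *\<^sub>R (q * c))"
    using ap_scale[OF step[OF q(2) _ _ _ bc(3), of 1 12], of s] q bc s by (simp add: mult.assoc)
  show ?thesis using ap_trans[OF ap_trans[OF 1 2] 3] by (rule ap_mono) simp
qed

text \<open>The two sides differ exactly by twice the losing products \<open>e * f\<close> and
  \<open>e' * (1 - f)\<close>.\<close>

lemma two_outcome_correlation:
  assumes e: "e \<in> \<A>" "eff e" "e' \<in> \<A>" "eff e'" and f: "f \<in> \<B>" "eff f"
    and s: "small e f" "small e' (1 - f)"
  shows "ap 4 ((e + e') * (f - (1 - f))) (e' - e)"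
proof -
  have 1: "ap 1 (e * f) 0" "ap 1 (e' * (1 - f)) 0"
    using small_ap s e f eff_compl by simp_all
  have "ap (2 + 2) (2 *\<^sub>R (e * f) - 2 *\<^sub>R (e' * (1 - f))) (2 *\<^sub>R 0 - 2 *\<^sub>R 0)"
    using ap_diff[OF ap_scale[OF 1(1), of 2] ap_scale[OF 1(2), of 2]] by simp
  moreover have "2 *\<^sub>R (e * f) - 2 *\<^sub>R (e' * (1 - f)) = (e + e') * (f - (1 - f)) - (e' - e)"
    by (simp add: algebra_simps scaleR_2)
  ultimately show ?thesis by (simp add: ap_def)
qed

end

context game
begin

declare One_nat_def [simp del]

lemma bc_B [simp]: "bc B1" "bc B2" "bc C1" "bc C2"
  using ok_B ok_bc by blast+

lemma bc_pair: "i \<noteq> j \<Longrightarrow> i \<in> answers \<Longrightarrow> j \<in> answers \<Longrightarrow> bc (Q i + Q j)"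
  using bc_eff[of "F 0 {i, j}"] F_mem[of 0 "{i, j}"] F_eff[of 0 "{i, j}"] by (simp add: F_pair)

lemma ap_join:
  assumes "ap k X (E x I)" "ap l Y (E x J)" "ap 1 (E x K) T" "I \<inter> J = {}" "K = I \<union> J" "finite K"
  shows "ap (k + l + 1) (X + Y) T"
proof -
  have "E x I + E x J = E x K" using assms by (simp add: sum.union_disjoint)
  then show ?thesis using ap_trans[OF ap_add[OF assms(1,2)]] assms(3) by metis
qed

lemma block_01:
  "ap 16 ((Q 0 + Q 1) * B1) (B1 * (Q 0 + Q 1))"
  "ap 16 ((Q 0 + Q 1) * B1) ((Q 0 + Q 1) * C1)"
  "ap 16 (C1 * (Q 0 + Q 1)) (B1 * (Q 0 + Q 1))"
  using reflection_comm[OF ap_trans[OF cross_01(1) ap_sym[OF cross_01(2)]]]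
    reflection_cong_right[OF ap_trans[OF cross_01(1) ap_sym[OF cross_01(3)]]]
    reflection_cong_left[OF ap_trans[OF cross_01(4) ap_sym[OF cross_01(2)]]]
  unfolding B1_def C1_def by (simp_all add: F_pair)

lemma block_23:
  "ap 16 ((Q 2 + Q 3) * B1) (B1 * (Q 2 + Q 3))"
  "ap 18 ((Q 2 + Q 3) * B1) (- ((Q 2 + Q 3) * C1))"
  "ap 18 (C1 * (Q 2 + Q 3)) (- (B1 * (Q 2 + Q 3)))"
  using reflection_comm[OF ap_trans[OF cross_01(5) ap_sym[OF cross_01(6)]]]
    reflection_neg_right[OF ap_join[OF cross_01(5) cross_01(7) match_00'(1)]]
    reflection_neg_left[OF ap_join[OF cross_01(8) cross_01(6) match_00'(1)]]
  unfolding B1_def C1_def by (simp_all add: F_pair insert_commute)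

lemma block_02:
  "ap 16 ((Q 0 + Q 2) * B2) (B2 * (Q 0 + Q 2))"
  "ap 16 ((Q 0 + Q 2) * B2) ((Q 0 + Q 2) * C2)"
  "ap 16 (C2 * (Q 0 + Q 2)) (B2 * (Q 0 + Q 2))"
  using reflection_comm[OF ap_trans[OF cross_02(1) ap_sym[OF cross_02(2)]]]
    reflection_cong_right[OF ap_trans[OF cross_02(1) ap_sym[OF cross_02(3)]]]
    reflection_cong_left[OF ap_trans[OF cross_02(4) ap_sym[OF cross_02(2)]]]
  unfolding B2_def C2_def by (simp_all add: F_pair)

lemma block_13:
  "ap 16 ((Q 1 + Q 3) * B2) (B2 * (Q 1 + Q 3))"
  "ap 18 ((Q 1 + Q 3) * B2) (- ((Q 1 + Q 3) * C2))"
  "ap 18 (C2 * (Q 1 + Q 3)) (- (B2 * (Q 1 + Q 3)))"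
  using reflection_comm[OF ap_trans[OF cross_02(5) ap_sym[OF cross_02(6)]]]
    reflection_neg_right[OF ap_join[OF cross_02(5) cross_02(7) match_10''(1)]]
    reflection_neg_left[OF ap_join[OF cross_02(8) cross_02(6) match_10''(1)]]
  unfolding B2_def C2_def by (simp_all add: F_pair insert_commute)

text \<open>The signs by which \<open>C1\<close>, \<open>C2\<close> and \<open>C1 * C2\<close> differ from \<open>B1\<close>, \<open>B2\<close> and \<open>B1 * B2\<close> on block \<open>i\<close>; their
  product is \<open>-1\<close> on each of the blocks \<open>0, \<dots>, 3\<close>.\<close>

definition tau1 :: "nat \<Rightarrow> real" where "tau1 i = (if i \<in> {0, 1} then 1 else -1)"
definition tau2 :: "nat \<Rightarrow> real" where "tau2 i = (if i \<in> {0, 2} then 1 else -1)"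
definition tau3 :: "nat \<Rightarrow> real" where "tau3 i = (if i \<in> {1, 2} then 1 else -1)"

lemma tau1_right: "i \<in> {0, 1, 2, 3} \<Longrightarrow> ap 40 (C1 * Q i) (tau1 i *\<^sub>R (B1 * Q i))"
  and tau1_left: "i \<in> {0, 1, 2, 3} \<Longrightarrow> ap 42 (Q i * B1) (tau1 i *\<^sub>R (Q i * C1))"
proof -
  have "ap 40 (C1 * Q i) (1 *\<^sub>R (B1 * Q i)) \<and> ap 42 (Q i * B1) (1 *\<^sub>R (Q i * C1))" if i: "i \<in> {0, 1}" for i
    using i ap_mono[OF block_01(2), of 18] ap_mono[OF block_01(3), of 18]
    by (intro conjI block_right[of _ "Q 0 + Q 1"] block_left[of _ "Q 0 + Q 1"])
       (auto simp: ok_Q ok_B Q_bc Q_absorb answers_def bc_pair)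
  moreover have "ap 40 (C1 * Q i) ((-1) *\<^sub>R (B1 * Q i)) \<and> ap 42 (Q i * B1) ((-1) *\<^sub>R (Q i * C1))" if i: "i \<in> {2, 3}" for i
    using i block_23
    by (intro conjI block_right[of _ "Q 2 + Q 3"] block_left[of _ "Q 2 + Q 3"])
       (auto simp: ok_Q ok_B Q_bc Q_absorb answers_def bc_pair)
  ultimately show "i \<in> {0, 1, 2, 3} \<Longrightarrow> ap 40 (C1 * Q i) (tau1 i *\<^sub>R (B1 * Q i))"
    "i \<in> {0, 1, 2, 3} \<Longrightarrow> ap 42 (Q i * B1) (tau1 i *\<^sub>R (Q i * C1))"
    by (auto simp: tau1_def)
qed

lemma tau2_right: "i \<in> {0, 1, 2, 3} \<Longrightarrow> ap 40 (C2 * Q i) (tau2 i *\<^sub>R (B2 * Q i))"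
  and tau2_left: "i \<in> {0, 1, 2, 3} \<Longrightarrow> ap 42 (Q i * B2) (tau2 i *\<^sub>R (Q i * C2))"
proof -
  have "ap 40 (C2 * Q i) (1 *\<^sub>R (B2 * Q i)) \<and> ap 42 (Q i * B2) (1 *\<^sub>R (Q i * C2))" if i: "i \<in> {0, 2}" for i
    using i ap_mono[OF block_02(2), of 18] ap_mono[OF block_02(3), of 18]
    by (intro conjI block_right[of _ "Q 0 + Q 2"] block_left[of _ "Q 0 + Q 2"])
       (auto simp: ok_Q ok_B Q_bc Q_absorb answers_def bc_pair)
  moreover have "ap 40 (C2 * Q i) ((-1) *\<^sub>R (B2 * Q i)) \<and> ap 42 (Q i * B2) ((-1) *\<^sub>R (Q i * C2))" if i: "i \<in> {1, 3}" for i
    using i block_13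
    by (intro conjI block_right[of _ "Q 1 + Q 3"] block_left[of _ "Q 1 + Q 3"])
       (auto simp: ok_Q ok_B Q_bc Q_absorb answers_def bc_pair)
  ultimately show "i \<in> {0, 1, 2, 3} \<Longrightarrow> ap 40 (C2 * Q i) (tau2 i *\<^sub>R (B2 * Q i))"
    "i \<in> {0, 1, 2, 3} \<Longrightarrow> ap 42 (Q i * B2) (tau2 i *\<^sub>R (Q i * C2))"
    by (auto simp: tau2_def)
qed

text \<open>The product of the two reflections of one question, as an observable of that question:
  in question 1 they have equal signs exactly on answers 0 (both +1) and 4 (both -1), in question 2
  on 1 and 4. The unexpanded form fits \<open>two_outcome_correlation\<close>.\<close>

definition "P1 = F 1 {0, 4} - (1 - F 1 {0, 4})"
definition "P2 = F 2 {1, 4} - (1 - F 2 {1, 4})"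

lemma bc_P: "bc P1" "bc P2"
  unfolding P1_def P2_def
  by (simp_all add: bc_def contr_diff F_eff F_mem eff_compl answers_def)

lemma joint_reflection:
  assumes "ap (2 * 1) (H * K) g"
  shows "ap 8 ((2 * H - 1) * (2 * K - 1)) ((1 - H - K + 2 * g) - (1 - (1 - H - K + 2 * g)))"
proof -
  have "4 *\<^sub>R (H * K) - 4 *\<^sub>R g
      = (2 * H - 1) * (2 * K - 1) - ((1 - H - K + 2 * g) - (1 - (1 - H - K + 2 * g)))"
    unfolding two_scaleR by ((simp add: algebra_simps)?, (simp flip: scaleR_add_left)?, (simp add: scaleR_2 add.assoc)?)
  then show ?thesis using ap_scale[OF assms, of 4] by (simp add: ap_cong_diff)
qed

lemma joint_1: "ap 8 (B1 * B2) P1" "ap 8 (B2 * B1) P1"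
proof -
  have m: "meet (F 1 {0}) F1 F2"
    unfolding F_defs by (rule povm_meet[OF N_povm]) (simp_all add: answers_def)
  have *: "1 - F1 - F2 + 2 * F 1 {0} = F 1 {0, 4}"
    using N_povm[of 1] unfolding povm_def F_defs by (simp add: answers_def sum.insert algebra_simps mult_2)
  show "ap 8 (B1 * B2) P1"
    using joint_reflection[OF meet_prod[OF m F14_proj(2)]] unfolding * B1_def B2_def P1_def .
  have *: "1 - F2 - F1 + 2 * F 1 {0} = F 1 {0, 4}" using * by (simp add: algebra_simps)
  show "ap 8 (B2 * B1) P1"
    using joint_reflection[OF meet_prod[OF meet_commute[OF m] F14_proj(1)]]
    unfolding * B1_def B2_def P1_def .
qed

lemma joint_2: "ap 8 (C1 * C2) P2" "ap 8 (C2 * C1) P2"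
proof -
  have m: "meet (F 2 {1}) F3 F4"
    unfolding F_defs by (rule povm_meet[OF N_povm]) (simp_all add: answers_def)
  have *: "1 - F3 - F4 + 2 * F 2 {1} = F 2 {1, 4}"
    using N_povm[of 2] unfolding povm_def F_defs by (simp add: answers_def sum.insert algebra_simps mult_2)
  show "ap 8 (C1 * C2) P2"
    using joint_reflection[OF meet_prod[OF m F14_proj(4)]] unfolding * C1_def C2_def P2_def .
  have *: "1 - F4 - F3 + 2 * F 2 {1} = F 2 {1, 4}" using * by (simp add: algebra_simps)
  show "ap 8 (C2 * C1) P2"
    using joint_reflection[OF meet_prod[OF meet_commute[OF m] F14_proj(3)]]
    unfolding * C1_def C2_def P2_def .
qed

text \<open>Alice's questions 2 and 3 measure e1 - e2, e1 + e2 and e0 - e3, e0 + e3, and these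
  answers fix Bob's parity. Since the right-hand side is an operator of Alice, it can compare the
  parities of Bob's two questions.\<close>

lemma parity_correlation:
  assumes x: "x < 4" "a \<in> answers" "b \<in> answers" "a \<noteq> b" and y: "y < 3" "J \<subseteq> answers"
    and m: "ap 1 (E x {a, b}) R" "R \<in> \<B>"
    and l: "\<forall>j\<in>J. loses x y a j" "\<forall>j\<in>answers - J. loses x y b j"
  shows "ap 5 ((F y J - (1 - F y J)) * R) (M x b - M x a)"
proof -
  let ?P = "F y J - (1 - F y J)"
  have e: "E x {a} = M x a" "E x {b} = M x b" "E x {a, b} = M x a + M x b"
    using x by (simp_all add: sum.insert)
  have mem: "M x a \<in> \<A>" "M x b \<in> \<A>" "eff (M x a)" "eff (M x b)"
    using x E_mem[of x "{a}"] E_mem[of x "{b}"] E_eff[of x "{a}"] E_eff[of x "{b}"] unfolding e by simp_all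
  have P: "?P \<in> \<B>" using F_mem y by simp
  have "ap 1 (?P * R) (?P * E x {a, b})"
    using ap_left[OF ap_sym[OF m(1)]] contr_diff F_eff eff_compl y by simp
  also have "?P * E x {a, b} = E x {a, b} * ?P"
    using commute[OF _ P, of "E x {a, b}"] E_mem x by simp
  also have "E x {a, b} * ?P = (M x a + M x b) * ?P" by (simp add: e)
  also have "ap 4 \<dots> (M x b - M x a)"
  proof (rule two_outcome_correlation[OF mem(1,3,2,4) F_mem F_eff])
    show "small (M x a) (F y J)" "small (M x b) (1 - F y J)"
      using losing_small[OF x(1) y(1), of "{a}" J] losing_small[OF x(1) y(1), of "{b}" "answers - J"] x y l
      by (simp_all add: e povm_compl[OF N_povm])
  qed (use y in auto)
  finally show ?thesis by simp
qed

lemma parity_12: "ap 10 (P1 * (Q 1 + Q 2)) (P2 * (Q 1 + Q 2))"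
proof -
  have "ap 5 (P1 * F 0 {1, 2}) (M 2 1 - M 2 0)" "ap 5 (P2 * F 0 {1, 2}) (M 2 1 - M 2 0)"
    unfolding P1_def P2_def
    by (rule parity_correlation[OF _ _ _ _ _ _ match_20(1)]; simp add: table F_mem)+
  from ap_trans[OF this(1) ap_sym[OF this(2)]] show ?thesis by (simp add: F_pair)
qed

lemma parity_03: "ap 10 (P1 * (Q 0 + Q 3)) (- (P2 * (Q 0 + Q 3)))"
proof -
  \<comment> \<open>For \<open>P1\<close> Alice's two answers are taken in the opposite order. The
    resulting sign, absent on blocks 1 and 2, is what makes the product of the three signs
    \<open>-1\<close> on every block.\<close>
  have m: "ap 1 (E 3 {1, 0}) (F 0 {0, 3})" using match_30(1) by (simp add: insert_commute)
  have "ap 5 (P1 * F 0 {0, 3}) (M 3 0 - M 3 1)"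
    unfolding P1_def
    by (rule parity_correlation[OF _ _ _ _ _ _ m]; simp add: table F_mem)
  moreover have "ap 5 (P2 * F 0 {0, 3}) (M 3 1 - M 3 0)"
    unfolding P2_def
    by (rule parity_correlation[OF _ _ _ _ _ _ match_30(1)]; simp add: table F_mem)
  ultimately show ?thesis
    using ap_trans[OF _ ap_sym[OF ap_neg], of 5 "P1 * F 0 {0, 3}" _ 5 "P2 * F 0 {0, 3}"]
    by (force simp: F_pair)
qed

lemma tau3_right:
  assumes "i \<in> {0, 1, 2, 3}"
  shows "ap 64 (B2 * B1 * Q i) (tau3 i *\<^sub>R (C2 * C1 * Q i))"
    "ap 64 (B1 * B2 * Q i) (tau3 i *\<^sub>R (C1 * C2 * Q i))"
proof -
  have "ap 40 (P1 * Q i) (1 *\<^sub>R (P2 * Q i))" if i: "i \<in> {1, 2}" for i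
    using i ap_mono[OF parity_12, of 18]
    by (intro block_right[of _ "Q 1 + Q 2"])
       (auto simp: ok_Q bc_P Q_absorb answers_def bc_pair)
  moreover have "ap 40 (P1 * Q i) ((-1) *\<^sub>R (P2 * Q i))" if i: "i \<in> {0, 3}" for i
    using i ap_mono[OF parity_03, of 18]
    by (intro block_right[of _ "Q 0 + Q 3"])
       (auto simp: ok_Q bc_P Q_absorb answers_def bc_pair)
  ultimately have P: "ap 40 (P1 * Q i) (tau3 i *\<^sub>R (P2 * Q i))"
    using assms by (auto simp: tau3_def)
  have q: "ok 2 (Q i)" using assms ok_Q by (auto simp: answers_def)
  have t: "\<bar>tau3 i\<bar> = 1" by (simp add: tau3_def)
  have L: "ap 12 (S * Q i) (P1 * Q i)" if "ap 8 S P1" "bc S" for S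
    using step[OF that(1) _ _ _ q, of 1 12] that bc_P by simp
  have R: "ap 12 (tau3 i *\<^sub>R (P2 * Q i)) (tau3 i *\<^sub>R (S * Q i))" if "ap 8 S P2" "bc S" for S
    using ap_scale[OF ap_sym[OF step[OF that(1) _ _ _ q, of 1 12]], of "tau3 i"] that bc_P t by simp
  show "ap 64 (B2 * B1 * Q i) (tau3 i *\<^sub>R (C2 * C1 * Q i))"
    by (rule ap_mono[OF ap_trans[OF ap_trans[OF L[OF joint_1(2)] P] R[OF joint_2(2)]]]) simp_all
  show "ap 64 (B1 * B2 * Q i) (tau3 i *\<^sub>R (C1 * C2 * Q i))"
    by (rule ap_mono[OF ap_trans[OF ap_trans[OF L[OF joint_1(1)] P] R[OF joint_2(1)]]]) simp_all
qed

text \<open>The magic square applies with \<open>B1\<close> and \<open>B2\<close> in either role; 91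
  is half of 64 + 40 + 42 + 36.\<close>

lemma diagonal_zero:
  assumes "i \<in> {0, 1, 2, 3}"
  shows "ap 91 (Q i * B1 * Q i) 0" "ap 91 (Q i * B2 * Q i) 0"
proof -
  have q: "ok 2 (Q i)" using assms ok_Q by (auto simp: answers_def)
  have s: "tau3 i * tau1 i * tau2 i = -1" "tau3 i * tau2 i * tau1 i = -1"
    "\<bar>tau1 i\<bar> = 1" "\<bar>tau2 i\<bar> = 1" "\<bar>tau3 i\<bar> = 1"
    using assms by (auto simp: tau1_def tau2_def tau3_def)
  show "ap 91 (Q i * B1 * Q i) 0"
    using magic_square[OF q ok_B(1,2,3,4) B_square(2,4) tau3_right(1)[OF assms] tau1_right[OF assms]
        tau2_left[OF assms] s(1) s(5,3,4)] by simp
  show "ap 91 (Q i * B2 * Q i) 0"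
    using magic_square[OF q ok_B(2,1,4,3) B_square(1,3) tau3_right(2)[OF assms] tau2_right[OF assms]
        tau1_left[OF assms] s(2) s(5,4,3)] by simp
qed

lemma swaps:
  "ap 240 (Q 1 * B1) (B1 * Q 0)" "ap 130 (B1 * Q 0) (Q 1 * B1 * Q 0)"
  "ap 240 (Q 3 * B1) (B1 * Q 2)" "ap 240 (Q 2 * B1) (B1 * Q 3)"
  "ap 240 (Q 2 * B2) (B2 * Q 0)" "ap 130 (B2 * Q 0) (Q 2 * B2 * Q 0)"
  "ap 240 (Q 0 * B2) (B2 * Q 2)" "ap 240 (Q 0 * B1) (B1 * Q 1)"
proof -
  note c = add.commute[of "Q 1" "Q 0"] add.commute[of "Q 3" "Q 2"] add.commute[of "Q 2" "Q 0"]
  note m = ok_Q Q_absorb diagonal_zero bc_pair ok_B answers_def c block_01 block_23 block_02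
  show "ap 240 (Q 1 * B1) (B1 * Q 0)" "ap 130 (B1 * Q 0) (Q 1 * B1 * Q 0)"
    "ap 240 (Q 3 * B1) (B1 * Q 2)" "ap 240 (Q 2 * B1) (B1 * Q 3)"
    "ap 240 (Q 2 * B2) (B2 * Q 0)" "ap 130 (B2 * Q 0) (Q 2 * B2 * Q 0)"
    "ap 240 (Q 0 * B2) (B2 * Q 2)" "ap 240 (Q 0 * B1) (B1 * Q 1)"
    by (rule block_swap; (simp add: m)?)+
qed

end

section \<open>Linking the fifth block to the others\<close>

context bipartite
begin

text \<open>In both cases the two sides differ by twice the losing products \<open>e * r\<close> and
  \<open>e' * r'\<close>, subtracted or added. Thus a difference on one side may be traded for a
  difference on the other.\<close>

lemma anticorrelated_exchange:
  assumes A: "e \<in> \<A>" "eff e" "e' \<in> \<A>" "eff e'" and B: "r \<in> \<B>" "eff r" "r' \<in> \<B>" "eff r'"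
    and s: "small e r" "small e' r'"
  shows "ap 4 ((e - e') * (r + r')) (- ((e + e') * (r - r')))"
    "ap 4 ((e - e') * (r - r')) (- ((e + e') * (r + r')))"
proof -
  have 1: "ap 1 (e * r) 0" "ap 1 (e' * r') 0" using small_ap s A B by simp_all
  have "ap (2 + 2) (2 *\<^sub>R (e * r) - 2 *\<^sub>R (e' * r')) (2 *\<^sub>R 0 - 2 *\<^sub>R 0)"
    using ap_diff[OF ap_scale[OF 1(1), of 2] ap_scale[OF 1(2), of 2]] by simp
  moreover have "2 *\<^sub>R (e * r) - 2 *\<^sub>R (e' * r') = (e - e') * (r + r') - - ((e + e') * (r - r'))"
    by (simp add: algebra_simps scaleR_2)
  ultimately show "ap 4 ((e - e') * (r + r')) (- ((e + e') * (r - r')))" by (simp add: ap_def)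
  have "ap (2 + 2) (2 *\<^sub>R (e * r) + 2 *\<^sub>R (e' * r')) (2 *\<^sub>R 0 + 2 *\<^sub>R 0)"
    using ap_add[OF ap_scale[OF 1(1), of 2] ap_scale[OF 1(2), of 2]] by simp
  moreover have "2 *\<^sub>R (e * r) + 2 *\<^sub>R (e' * r') = (e - e') * (r - r') - - ((e + e') * (r + r'))"
    by (simp add: algebra_simps scaleR_2)
  ultimately show "ap 4 ((e - e') * (r - r')) (- ((e + e') * (r + r')))" by (simp add: ap_def)
qed

end

context game
begin

text \<open>\<open>G1\<close> and \<open>G2\<close> project onto the spans of \<open>h\<close>, \<open>e4\<close> and of \<open>k\<close>, \<open>e4\<close>. On them \<open>R1\<close> and \<open>R2\<close> exchange the two
  directions, as \<open>X\<close> and \<open>Y\<close> exchange \<open>e0\<close> and \<open>e2\<close> with \<open>e4\<close>.\<close>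

definition "G1 = F 1 {2, 3}"
definition "G2 = F 2 {2, 3}"
definition "R1 = N 1 2 - N 1 3"
definition "R2 = N 2 2 - N 2 3"
definition "X = M 2 3 - M 2 2"
definition "Y = M 3 3 - M 3 2"
definition "S0 = E 2 {2, 3}"
definition "S2 = E 3 {2, 3}"
definition "U0 = E 0 {0, 1} - E 3 {4}"
definition "U2 = E 0 {2, 3} - E 2 {4}"
definition "U4 = M 0 4"

lemma E_single: "E x {a} = M x a" and N_single: "F y {b} = N y b"
  by (simp_all add: sum.insert)

lemma M_eff: "x < 4 \<Longrightarrow> a \<in> answers \<Longrightarrow> eff (M x a)"
  and N_eff: "y < 3 \<Longrightarrow> b \<in> answers \<Longrightarrow> eff (N y b)"
  using E_eff[of x "{a}"] F_eff[of y "{b}"] by (simp_all add: E_single N_single)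

lemma Q_simps [simp]:
  "ok 2 (Q 0)" "ok 2 (Q 1)" "ok 2 (Q 2)" "ok 2 (Q 3)" "ok 2 (Q 4)"
  "bc (Q 0)" "bc (Q 1)" "bc (Q 2)" "bc (Q 3)" "bc (Q 4)"
  "0 \<in> answers" "1 \<in> answers" "2 \<in> answers" "3 \<in> answers" "4 \<in> answers"
  by (simp_all add: ok_Q Q_bc answers_def)

lemma bc_G [simp]: "bc G1" "bc G2" "bc R1" "bc R2"
  using bc_eff F_mem F_eff N_mem contr_diff N_eff
  by (simp_all add: G1_def G2_def R1_def R2_def bc_def eff_contr)

lemma A_elems [simp]: "X \<in> \<A>" "Y \<in> \<A>" "S0 \<in> \<A>" "S2 \<in> \<A>" "U0 \<in> \<A>" "U2 \<in> \<A>" "U4 \<in> \<A>"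
  by (simp_all add: X_def Y_def S0_def S2_def U0_def U2_def U4_def M_mem E_mem)

lemma A_contr [simp]: "contr X" "contr Y" "contr S0" "contr S2" "contr U0" "contr U2" "contr U4"
  by (simp_all add: X_def Y_def S0_def S2_def U0_def U2_def U4_def M_eff E_eff contr_diff eff_contr)

lemma S_U_Q: "ap 1 S0 (Q 0 + Q 4)" "ap 1 S2 (Q 2 + Q 4)" "ap 2 U0 (Q 0)" "ap 2 U2 (Q 2)" "ap 1 U4 (Q 4)"
  using match_20'(1) match_30'(1) ap_diff[OF match_00(1) match_30''(1)] ap_diff[OF match_00'(1) match_20''(1)]
    match_00''(1)
  by (simp_all add: S0_def S2_def U0_def U2_def U4_def F_pair F_single E_single)

lemma G1_meet: "ap 2 ((1 - F1) * F2) G1" and G2_meet: "ap 2 (F3 * (1 - F4)) G2"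
proof -
  have m: "meet G1 (F 1 {2, 3, 4}) F2" "meet G2 F3 (F 2 {2, 3, 4})"
    unfolding G1_def G2_def F_defs by (rule povm_meet[OF N_povm]; simp add: answers_def)+
  have c: "1 - F1 = F 1 {2, 3, 4}" "1 - F4 = F 2 {2, 3, 4}"
    unfolding F_defs by (simp_all add: povm_compl[OF N_povm] table)
  show "ap 2 ((1 - F1) * F2) G1"
    using meet_prod[OF m(1) F14_proj(2)] by (simp add: c)
  show "ap 2 (F3 * (1 - F4)) G2"
    using meet_prod[OF m(2)] proj_compl[OF F14_proj(4)] by (fastforce simp: c)
qed

lemma bc_F [simp]: "bc F1" "bc F2" "bc F3" "bc F4"
  using ok_F ok_bc by blast+

lemma bc_compl_F [simp]: "bc (1 - F1)" "bc (1 - F4)"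
  using F14_mem F14_eff eff_compl by (simp_all add: bc_def eff_contr)

lemma ok_compl_F4: "ok 1 (1 - F4)"
proof -
  have "ap 1 (1 - F4) (1 - E 1 {2, 4})"
    using ap_diff[OF ap_refl[of 0 1] ap_sym[OF match_12(1)]] by (simp add: F4_def)
  then show ?thesis
    unfolding ok_def using E_mem[of 1 "{2, 4}"] E_eff[of 1 "{2, 4}"]
    by (auto intro!: mirI[of "1 - E 1 {2, 4}"] eff_contr eff_compl)
qed

text \<open>\<open>G1\<close> and \<open>G2\<close> are joint effects and have no match of their
  own, so they are replaced by products of matched effects, each of which \<open>Q 4\<close> either
  annihilates or absorbs.\<close>

lemma Q4_G: "ap 13 (Q 4 * G1) (Q 4)" "ap 13 (Q 4 * G2) (Q 4)"
proof -
  have z: "ap 4 (Q 4 * F1) 0" using cross_01(9) by (simp add: F_single)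
  have 1: "ap 5 (Q 4 * F2) (Q 4)"
    using ap_trans[OF cross_02(9) match_10(1)] by (simp add: F_single)
  have "ap 6 (Q 4 * F1 * F2) 0" using step[OF z _ _ _ ok_F(2), of 1 6] by simp
  from ap_diff[OF 1 this] have 2: "ap 11 (Q 4 * ((1 - F1) * F2)) (Q 4)" by (simp add: algebra_simps)
  show "ap 13 (Q 4 * G1) (Q 4)"
    using ap_trans[OF ap_sym[OF ap_left[OF G1_meet, of "Q 4"]] 2] by simp
  have "ap 4 (F 0 {4} * F3) (E 0 {4})"
    unfolding F_defs by (rule F_cross[OF _ _ _ _ _ _ _ match_00''(1) match_02(1) match_00''(2)]; simp add: answers_def)
  then have 3: "ap 5 (Q 4 * F3) (Q 4)"
    using ap_trans[OF _ match_00''(1)] by (fastforce simp: F_single)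
  have 4: "ap 4 (F 0 {4} * F4) (E 1 {})"
    unfolding F_defs by (rule F_cross[OF _ _ _ _ _ _ _ match_10(1) match_12(1) match_10(2)]; simp add: answers_def)
  have "ap 7 (Q 4 * F3 * (1 - F4)) (Q 4 * (1 - F4))"
    using step[OF 3 _ _ _ ok_compl_F4, of 1 7] by simp
  moreover have "ap 4 (Q 4 * (1 - F4)) (Q 4)"
    using ap_diff[OF ap_refl[of 0 "Q 4"] 4] by (simp add: F_single right_diff_distrib)
  ultimately have 5: "ap 11 (Q 4 * (F3 * (1 - F4))) (Q 4)"
    using ap_trans[of 7 _ _ 4] by (simp add: mult.assoc)
  show "ap 13 (Q 4 * G2) (Q 4)"
    using ap_trans[OF ap_sym[OF ap_left[OF G2_meet, of "Q 4"]] 5] by simp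
qed

text \<open>In this order one losing pair is enough: Bob's answers 0, 1 and 4 lose against Alice's
  answer e4.\<close>

lemma G_Q4: "ap 2 (G1 * Q 4) (Q 4)" "ap 2 (G2 * Q 4) (Q 4)"
proof -
  have *: "ap 2 (F y {2, 3} * Q 4) (Q 4)" if y: "y \<in> {1, 2}" for y
  proof -
    have y3: "y < 3" using y by auto
    have "small (E 0 {4}) (F y {0, 1, 4})"
      using y by (intro losing_small) (auto simp: table)
    then have "ap 1 (E 0 {4} * F y {0, 1, 4}) 0"
      using y3 by (intro small_ap E_mem E_eff F_mem F_eff) (auto simp: answers_def)
    moreover have c: "F y {0, 1, 4} = 1 - F y {2, 3}"
      using povm_compl[OF N_povm[OF y3], of "{2, 3}"] by (simp add: table)
    moreover have "E 0 {4} * F y {0, 1, 4} = F y {0, 1, 4} * U4"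
      using commute[OF A_elems(7), of "F y {0, 1, 4}"] F_mem y3 by (simp add: U4_def E_single)
    ultimately have "ap 1 ((1 - F y {2, 3}) * U4) 0" by simp
    moreover have "ap 1 ((1 - F y {2, 3}) * Q 4) ((1 - F y {2, 3}) * U4)"
      using y3 by (intro ap_left[OF ap_sym[OF S_U_Q(5)]] eff_contr eff_compl F_eff) auto
    ultimately have "ap 2 ((1 - F y {2, 3}) * Q 4) 0"
      using ap_trans[of 1 _ _ 1] by fastforce
    then have "ap 2 (Q 4 - F y {2, 3} * Q 4) 0" by (simp add: left_diff_distrib)
    then show ?thesis using ap_sym by (simp add: ap_def)
  qed
  show "ap 2 (G1 * Q 4) (Q 4)" "ap 2 (G2 * Q 4) (Q 4)"
    using *[of 1] *[of 2] by (simp_all add: G1_def G2_def)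
qed

text \<open>Collects what the combinations of Alice's pair of blocks, 0 and 4 or 2 and 4, with Bob's
  plane, \<open>G1\<close> or \<open>G2\<close>, have in common; they differ only in the sign of
  \<open>Z\<close>.\<close>

definition exch :: "'r \<Rightarrow> 'r \<Rightarrow> 'r \<Rightarrow> 'r \<Rightarrow> nat \<Rightarrow> bool" where
  "exch Z S G R i \<longleftrightarrow> Z \<in> \<A> \<and> contr Z \<and> S \<in> \<A> \<and> contr S \<and> bc G \<and> bc R \<and> i \<in> {0, 2}
     \<and> ap 4 (Z * G) (- (S * R)) \<and> ap 4 (Z * R) (- (S * G)) \<and> ap 1 S (Q i + Q 4) \<and> ap 2 (Z * S) Z
     \<and> ap 13 (Q 4 * G) (Q 4) \<and> ap 2 (G * Q 4) (Q 4)"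

text \<open>One sign is exceptional: h has coefficient -1/2 at both e0 and e2, whereas k has +1/2 at
  e0 and -1/2 at e2. The contradictions below rest on this odd sign.\<close>

lemma exch_intros: "exch X S0 G1 R1 0" "exch (- X) S0 G2 R2 0" "exch Y S2 G1 R1 2" "exch Y S2 G2 R2 2"
proof -
  have absorb: "ap 2 ((M x 3 - M x 2) * E x {2, 3}) (M x 3 - M x 2)"
    if x: "x < 4" "proj 1 (E x {2, 3})" for x
  proof -
    have "ap 1 (M x a * E x {2, 3}) (M x a)" if "a \<in> {2, 3}" for a
    proof -
      have a: "a \<in> answers" using that by auto
      have "E x {2, 3} - M x a = E x ({2, 3} - {a})"
        using that by (auto simp: sum.insert insert_Diff_if)
      then have "pos (E x {2, 3} - M x a)"
        using x(1) M_povm povm_pos[of "M x" "{2, 3} - {a}"] by (simp add: insert_Diff_if)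
      then show ?thesis using sub_absorb E_eff M_eff x a by simp
    qed
    from ap_diff[OF this[of 3] this[of 2]] show ?thesis by (simp add: left_diff_distrib)
  qed
  have sm: "small (M x a) (N y b)" if "x < 4" "y < 3" "a \<in> answers" "b \<in> answers" "loses x y a b" for x y a b
    using losing_small[of x y "{a}" "{b}"] that by (simp add: E_single N_single)
  have ex: "ap 4 ((M x a - M x a') * (N y 2 + N y 3)) (- ((M x a + M x a') * (N y 2 - N y 3)))"
    "ap 4 ((M x a - M x a') * (N y 2 - N y 3)) (- ((M x a + M x a') * (N y 2 + N y 3)))"
    if "x < 4" "y < 3" "a \<in> answers" "a' \<in> answers" "loses x y a 2" "loses x y a' 3" for x y a a'
    using anticorrelated_exchange[OF _ _ _ _ _ _ _ _ sm sm, of x a x a' y 2 y 3] that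
    by (simp_all add: M_mem N_mem M_eff N_eff)
  note d = exch_def X_def Y_def S0_def S2_def G1_def G2_def R1_def R2_def
  note u = S_U_Q(1,2) Q4_G G_Q4 absorb[of 2] absorb[of 3] match_20'(2) match_30'(2)
  have sums: "E x {2, 3} = M x 3 + M x 2" "E x {2, 3} = M x 2 + M x 3" "F y {2, 3} = N y 2 + N y 3" for x y
    by (simp_all add: sum.insert add.commute)
  have "ap 4 (X * G1) (- (S0 * R1))" "ap 4 (X * R1) (- (S0 * G1))"
    using ex[of 2 1 3 2] unfolding d sums(1,3) by (simp_all add: table)
  then show "exch X S0 G1 R1 0"
    using u by (simp add: exch_def) (simp add: X_def S0_def)
  have "ap 4 (Y * G1) (- (S2 * R1))" "ap 4 (Y * R1) (- (S2 * G1))"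
    using ex[of 3 1 3 2] unfolding d sums(1,3) by (simp_all add: table)
  then show "exch Y S2 G1 R1 2"
    using u by (simp add: exch_def) (simp add: Y_def S2_def)
  have "ap 4 (Y * G2) (- (S2 * R2))" "ap 4 (Y * R2) (- (S2 * G2))"
    using ex[of 3 2 3 2] unfolding d sums(1,3) by (simp_all add: table)
  then show "exch Y S2 G2 R2 2"
    using u by (simp add: exch_def) (simp add: Y_def S2_def)
  have "ap 4 (- X * G2) (- (S0 * R2))" "ap 4 (- X * R2) (- (S0 * G2))"
    using ex[of 2 2 2 3] unfolding d sums(2,3) by (simp_all add: table)
  moreover have "ap 2 (X * S0) X" using u by (simp add: X_def S0_def)
  then have "ap 2 (- (X * S0)) (- X)" by (rule ap_neg)
  ultimately show "exch (- X) S0 G2 R2 0"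
    using u by (simp add: exch_def contr_minus)
qed

lemma mult_swap: "a \<in> \<A> \<Longrightarrow> bc b \<Longrightarrow> a * b = b * a"
  using commute[of a b] by (simp add: bc_def)

text \<open>\<open>G\<close> is inserted behind \<open>Q 4\<close>, \<open>Z * G\<close> is
  exchanged for \<open>- (S * R)\<close>, and \<open>S\<close>, being Alice's, moves to the far
  right, where it becomes \<open>Q i + Q 4\<close>.\<close>

lemma exch_Q4:
  assumes "exch Z S G R i"
  shows "ap 18 (Z * Q 4) (- (Q 4 * R * (Q i + Q 4)))"
    "ap 27 (U4 * Z * Q 4) (- (Q 4 * R * Q 4))"
proof -
  note e = assms[unfolded exch_def]
  have i: "i \<in> answers" "i \<noteq> 4" using e by (auto simp: answers_def)
  have b: "bc (Q i + Q 4)" using bc_pair i by simp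
  have 1: "ap 13 (Z * Q 4) (Z * (Q 4 * G))" using e by (intro ap_left[OF ap_sym]) auto
  have c1: "Z * (Q 4 * G) = Q 4 * (Z * G)" using mult_swap[of Z "Q 4"] e by (metis Q_simps(10) mult.assoc)
  have 2: "ap 4 (Q 4 * (Z * G)) (Q 4 * - (S * R))" using e by (intro ap_left) auto
  have c2: "Q 4 * - (S * R) = - (Q 4 * R) * S"
    using mult_swap[of S "R"] e by (simp add: mult.assoc)
  have 3: "ap 1 (- (Q 4 * R) * S) (- (Q 4 * R) * (Q i + Q 4))" using e by (intro ap_left) auto
  show 4: "ap 18 (Z * Q 4) (- (Q 4 * R * (Q i + Q 4)))"
    using ap_trans[OF ap_trans[OF 1[unfolded c1] 2[unfolded c2]] 3] by simp
  have 5: "ap 18 (U4 * Z * Q 4) (- (U4 * (Q 4 * R * (Q i + Q 4))))"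
    using ap_left[OF 4, of U4] by (simp add: mult.assoc)
  have c3: "U4 * (Q 4 * R * (Q i + Q 4)) = Q 4 * R * (Q i + Q 4) * U4"
    using mult_swap[of U4] b e by simp
  have 6: "ap 1 (- (Q 4 * R * (Q i + Q 4) * U4)) (- (Q 4 * R * (Q i + Q 4) * Q 4))"
    using ap_neg[OF ap_left[OF S_U_Q(5), of "Q 4 * R * (Q i + Q 4)"]] b e by simp
  have 7: "ap 8 (- (Q 4 * R * ((Q i + Q 4) * Q 4))) (- (Q 4 * R * Q 4))"
    using ap_neg[OF ap_left[OF Q_absorb(3)[of 4 i], of "Q 4 * R"]] i e by simp
  show "ap 27 (U4 * Z * Q 4) (- (Q 4 * R * Q 4))"
    using ap_trans[OF ap_trans[OF 5[unfolded c3] 6] 7[folded mult.assoc]] by simp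
qed

text \<open>The four combinations form a loop: \<open>X\<close>, \<open>R1\<close>,
  \<open>Y\<close>, \<open>R2\<close> and back to \<open>X\<close>. The exceptional sign makes
  \<open>U4 * X * Q 4\<close> its own negative; the cost 4 * 27 is halved and 27 is added to return
  to \<open>R1\<close>.\<close>

lemma Q4_R_Q4: "ap 81 (Q 4 * R1 * Q 4) 0"
proof -
  note a = exch_Q4(2)[OF exch_intros(1)] and b = exch_Q4(2)[OF exch_intros(3)]
  note c = exch_Q4(2)[OF exch_intros(4)] and d = exch_Q4(2)[OF exch_intros(2)]
  have "ap 108 (U4 * X * Q 4) (- (U4 * X * Q 4))"
    using ap_trans[OF ap_trans[OF ap_trans[OF a ap_sym[OF b]] c] ap_sym[OF d]] by simp
  then have "ap 54 (U4 * X * Q 4) 0" using ap_halve by fastforce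
  then show ?thesis using ap_neg[OF ap_trans[OF ap_sym[OF a], of 54 0]] by simp
qed

lemma X_Q4: "ap 99 (X * Q 4) (- (Q 4 * R1 * Q 0))"
proof -
  have "ap 81 (- (Q 4 * R1 * (Q 0 + Q 4))) (- (Q 4 * R1 * Q 0))"
    using Q4_R_Q4 ap_neg[of 81 "Q 4 * R1 * (Q 0 + Q 4)" "Q 4 * R1 * Q 0"]
    by (simp add: ap_def algebra_simps)
  then show ?thesis using ap_trans[OF exch_Q4(1)[OF exch_intros(1)]] by fastforce
qed

text \<open>\<open>Z\<close> has its support on blocks \<open>i\<close> and 4. The part with block 4
  disappears because \<open>G\<close> fixes \<open>Q 4\<close>, which is orthogonal to
  \<open>Q j\<close>; the rest is the exchange of \<open>Z * G\<close> for
  \<open>- (S * R)\<close>.\<close>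

lemma exch_block:
  assumes e: "exch Z S G R i" and P: "P \<in> \<A>" "contr P" "ap 2 P (Q i)" and j: "j \<in> answers" "j \<noteq> 4"
  shows "ap 24 (P * Z * (Q j * G * Q i)) (- (Q j * R * Q i))"
proof -
  note e = e[unfolded exch_def]
  have i: "i \<in> answers" "i \<noteq> 4" using e by (auto simp: answers_def)
  have b: "bc (Q i + Q 4)" "bc (Q j)" "bc (Q i)" using bc_pair i j Q_bc by auto
  have PZ: "P * Z \<in> \<A>" "contr (P * Z)" using P e by auto
  have 1: "ap 3 (P * Z) (P * Z * (Q i + Q 4))"
  proof -
    have "ap 2 (P * Z) (P * (Z * S))" using e P by (intro ap_left[OF ap_sym]) auto
    moreover have "ap 1 (P * Z * S) (P * Z * (Q i + Q 4))" using e PZ by (intro ap_left) auto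
    ultimately show ?thesis using ap_trans[of 2 _ _ 1] by (simp add: mult.assoc)
  qed
  have c1: "Q j * G * (P * Z * W) = P * Z * (Q j * G * W)" for W
    using mult_swap[OF PZ(1), of "Q j * G"] b e by (simp add: mult.assoc[symmetric])
  have 2: "ap 3 (P * Z * (Q j * G)) (P * Z * (Q j * G * Q i) + P * Z * (Q j * G * Q 4))"
    using ap_left[OF 1, of "Q j * G"] c1[of 1] c1[of "Q i + Q 4"] b e by (simp add: distrib_left)
  have 3: "ap 6 (P * Z * (Q j * G * Q 4)) 0"
  proof -
    have "ap 2 (P * Z * Q j * (G * Q 4)) (P * Z * Q j * Q 4)" using e PZ b by (intro ap_left) auto
    moreover have "ap 4 (P * Z * (Q j * Q 4)) (P * Z * 0)" using j PZ Q_orth by (intro ap_left) auto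
    ultimately show ?thesis using ap_trans[of 2 _ _ 4] by (simp add: mult.assoc)
  qed
  have 4: "ap 9 (P * Z * (Q j * G * Q i)) (P * Z * (Q j * G))"
    using ap_sym[OF ap_trans[OF 2 ap_add[OF ap_refl[of 0] 3]]] by simp
  have c2: "P * Z * (Q j * G) = Q j * P * (Z * G)"
    using mult_swap[OF PZ(1) b(2)] mult_swap[OF P(1) b(2)] by (metis mult.assoc)
  have 5: "ap 4 (Q j * P * (Z * G)) (Q j * P * - (S * R))" using e P b by (intro ap_left) auto
  have c3: "Q j * P * - (S * R) = - (Q j * R * P * S)"
    using mult_swap[of S R] mult_swap[OF P(1), of R] e by (simp add: mult.assoc) (metis mult.assoc)
  have 6: "ap 1 (- (Q j * R * P * S)) (- (Q j * R * P * (Q i + Q 4)))"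
    using e P b by (intro ap_neg ap_left) auto
  have c4: "Q j * R * P * (Q i + Q 4) = Q j * R * (Q i + Q 4) * P"
    using mult_swap[OF P(1) b(1)] by (simp add: mult.assoc)
  have 7: "ap 2 (- (Q j * R * (Q i + Q 4) * P)) (- (Q j * R * (Q i + Q 4) * Q i))"
    using e P b by (intro ap_neg ap_left) auto
  have 8: "ap 8 (- (Q j * R * ((Q i + Q 4) * Q i))) (- (Q j * R * Q i))"
    using e i b Q_absorb(1)[of i 4] by (intro ap_neg ap_left) auto
  have 15: "ap 15 (P * Z * (Q j * G)) (- (Q j * R * Q i))"
    using ap_trans[OF ap_trans[OF ap_trans[OF 5[unfolded c3] 6[unfolded c4]] 7] 8[folded mult.assoc]]
    by (simp add: c2)
  show ?thesis using ap_trans[OF 4 15] by simp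
qed

end

context bipartite
begin

lemma ap_scale_cancel: "ap k (c *\<^sub>R S) 0 \<Longrightarrow> c > 0 \<Longrightarrow> ap (k / c) S 0"
  by (simp add: ap_def act_scale field_simps)

end

context game
begin

lemma joint_effect_1:
  assumes "ok 2 q"
  shows "ap 6 (G1 * q) ((1/4) *\<^sub>R (q - B1 * q + B2 * q - B1 * B2 * q))"
proof -
  have "(1 - F1) * F2 * q = (1/4) *\<^sub>R (q - B1 * q + B2 * q - B1 * B2 * q)"
  proof -
    have "q - B1 * q + B2 * q - B1 * B2 * q = 4 *\<^sub>R ((1 - F1) * F2 * q)"
      unfolding B1_def B2_def two_scaleR by (simp add: algebra_simps) (simp flip: scaleR_add_left)
    then show ?thesis by simp
  qed
  then show ?thesis using step[OF ap_sym[OF G1_meet] _ _ _ assms, of 1 6] by simp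
qed

lemma joint_effect_2:
  assumes "ok 2 q"
  shows "ap 6 (G2 * q) ((1/4) *\<^sub>R (q + C1 * q - C2 * q - C1 * C2 * q))"
proof -
  have "F3 * (1 - F4) * q = (1/4) *\<^sub>R (q + C1 * q - C2 * q - C1 * C2 * q)"
  proof -
    have "q + C1 * q - C2 * q - C1 * C2 * q = 4 *\<^sub>R (F3 * (1 - F4) * q)"
      unfolding C1_def C2_def two_scaleR by (simp add: algebra_simps) (simp flip: scaleR_add_left)
    then show ?thesis by simp
  qed
  then show ?thesis using step[OF ap_sym[OF G2_meet] _ _ _ assms, of 1 6] by simp
qed

lemma joint_effect_2':
  assumes i: "i \<in> {0, 1, 2, 3}"
  shows "ap 42 (G2 * Q i) ((1/4) *\<^sub>R (Q i + tau1 i *\<^sub>R (B1 * Q i) - tau2 i *\<^sub>R (B2 * Q i)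
    - tau3 i *\<^sub>R (B1 * B2 * Q i)))"
proof -
  have q: "ok 2 (Q i)" using i ok_Q by (auto simp: answers_def)
  have s: "\<bar>tau3 i\<bar> = 1" "tau3 i * tau3 i = 1" by (auto simp: tau3_def)
  have t3: "ap 64 (C1 * C2 * Q i) (tau3 i *\<^sub>R (B1 * B2 * Q i))"
    using ap_sym[OF ap_scale[OF tau3_right(2)[OF i], of "tau3 i"]] s by simp
  have "ap (0 + 40 + 40 + 64) (Q i + C1 * Q i - C2 * Q i - C1 * C2 * Q i)
    (Q i + tau1 i *\<^sub>R (B1 * Q i) - tau2 i *\<^sub>R (B2 * Q i) - tau3 i *\<^sub>R (B1 * B2 * Q i))"
    by (intro ap_add ap_diff ap_refl tau1_right tau2_right t3 i) simp
  from ap_trans[OF joint_effect_2[OF q] ap_scale[OF this, of "1/4"]] show ?thesis by simp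
qed

text \<open>On block 0 the signs make the three reflection terms of \<open>G2\<close> the negatives
  of those of \<open>G1\<close>, and only twice 1/4 remains. This is the source of the relative
  weight 1/2 in the target state.\<close>

lemma G_sum_Q0: "ap 48 (G1 * Q 0 + G2 * Q 0) ((1/2) *\<^sub>R Q 0)"
proof -
  have "ap 42 (G2 * Q 0) ((1/4) *\<^sub>R (Q 0 + B1 * Q 0 - B2 * Q 0 + B1 * B2 * Q 0))"
    using joint_effect_2'[of 0] by (simp add: tau1_def tau2_def tau3_def)
  from ap_add[OF joint_effect_1[of "Q 0"] this]
  have "ap 48 (G1 * Q 0 + G2 * Q 0) ((1/4) *\<^sub>R (Q 0 - B1 * Q 0 + B2 * Q 0 - B1 * B2 * Q 0)
    + (1/4) *\<^sub>R (Q 0 + B1 * Q 0 - B2 * Q 0 + B1 * B2 * Q 0))" by simp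
  moreover have "(1/4) *\<^sub>R (Q 0 - B1 * Q 0 + B2 * Q 0 - B1 * B2 * Q 0)
    + (1/4) *\<^sub>R (Q 0 + B1 * Q 0 - B2 * Q 0 + B1 * B2 * Q 0) = (1/2) *\<^sub>R Q 0"
    by (simp add: algebra_simps flip: scaleR_add_left)
  ultimately show ?thesis by simp
qed

lemma G_diff_Q2: "ap 48 (G1 * Q 2 - G2 * Q 2) ((1/2) *\<^sub>R (B2 * Q 2))"
proof -
  have "ap 42 (G2 * Q 2) ((1/4) *\<^sub>R (Q 2 - B1 * Q 2 - B2 * Q 2 - B1 * B2 * Q 2))"
    using joint_effect_2'[of 2] by (simp add: tau1_def tau2_def tau3_def)
  from ap_diff[OF joint_effect_1[of "Q 2"] this]
  have "ap 48 (G1 * Q 2 - G2 * Q 2) ((1/4) *\<^sub>R (Q 2 - B1 * Q 2 + B2 * Q 2 - B1 * B2 * Q 2)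
    - (1/4) *\<^sub>R (Q 2 - B1 * Q 2 - B2 * Q 2 - B1 * B2 * Q 2))" by simp
  moreover have "(1/4) *\<^sub>R (Q 2 - B1 * Q 2 + B2 * Q 2 - B1 * B2 * Q 2)
    - (1/4) *\<^sub>R (Q 2 - B1 * Q 2 - B2 * Q 2 - B1 * B2 * Q 2) = (1/2) *\<^sub>R (B2 * Q 2)"
    by (simp add: algebra_simps flip: scaleR_add_left)
  ultimately show ?thesis by simp
qed

lemma G_20: "ap 50 (Q 2 * G1 * Q 0) (- (Q 2 * G2 * Q 0))"
proof -
  have "ap 48 (Q 2 * (G1 * Q 0 + G2 * Q 0)) (Q 2 * ((1/2) *\<^sub>R Q 0))"
    by (intro ap_left G_sum_Q0) simp
  moreover have "ap 2 (Q 2 * ((1/2) *\<^sub>R Q 0)) 0"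
    using ap_scale[OF Q_orth[of 2 0], of "1/2"] by simp
  ultimately show ?thesis
    using ap_trans[of 48 _ _ 2] by (fastforce simp: ap_def algebra_simps)
qed

lemma G_22: "ap 94 (Q 2 * G1 * Q 2) (Q 2 * G2 * Q 2)"
proof -
  have "ap 48 (Q 2 * (G1 * Q 2 - G2 * Q 2)) (Q 2 * ((1/2) *\<^sub>R (B2 * Q 2)))"
    by (intro ap_left G_diff_Q2) simp
  moreover have "ap 46 (Q 2 * ((1/2) *\<^sub>R (B2 * Q 2))) 0"
    using ap_mono[OF ap_scale[OF diagonal_zero(2)[of 2], of "1/2"], of 46] by (simp add: mult.assoc)
  ultimately show ?thesis
    using ap_trans[of 48 _ _ 46] by (fastforce simp: ap_def algebra_simps)
qed

text \<open>Of the four terms of \<open>G1\<close> only \<open>B2\<close> leads from block 0 to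
  block 2: \<open>B1\<close> leads to block 1, and \<open>B1 * B2\<close> is reduced to the
  vanishing diagonal part of \<open>B1\<close> on block 2.\<close>

lemma G1_20: "ap 186 (Q 2 * G1 * Q 0) ((1/4) *\<^sub>R (B2 * Q 0))"
proof -
  have 1: "ap 4 (Q 2 * Q 0) 0" by (intro Q_orth) simp_all
  have 2: "ap 248 (Q 2 * B1 * Q 0) 0"
  proof -
    have "ap 240 (Q 2 * (B1 * Q 0)) (Q 2 * (Q 1 * B1))" by (intro ap_left ap_sym[OF swaps(1)]) simp
    moreover have "ap 8 (Q 2 * Q 1 * B1) 0"
      using step[OF Q_orth[of 2 1] _ _ _ ok_B(1), of 1 8] by simp
    ultimately show ?thesis using ap_trans[of 240 _ _ 8] by (simp add: mult.assoc)
  qed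
  have 3: "ap 130 (Q 2 * B2 * Q 0) (B2 * Q 0)" using swaps(6) ap_sym by blast
  have 4: "ap 335 (Q 2 * B1 * B2 * Q 0) 0"
  proof -
    have "ap 240 (Q 2 * B1 * (B2 * Q 0)) (Q 2 * B1 * (Q 2 * B2))" by (intro ap_left ap_sym[OF swaps(5)]) simp
    moreover have "ap 95 (Q 2 * B1 * Q 2 * B2) 0"
      using step[OF diagonal_zero(1)[of 2] _ _ _ ok_B(2), of 1 95] by simp
    ultimately show ?thesis using ap_trans[of 240 _ _ 95] by (simp add: mult.assoc)
  qed
  have "ap (4 + 248 + 130 + 335) (Q 2 * Q 0 - Q 2 * B1 * Q 0 + Q 2 * B2 * Q 0 - Q 2 * B1 * B2 * Q 0)
    (0 - 0 + B2 * Q 0 - 0)"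
    by (intro ap_add ap_diff 1 2 3 4)
  from ap_scale[OF this, of "1/4"]
  have "ap 180 (Q 2 * ((1/4) *\<^sub>R (Q 0 - B1 * Q 0 + B2 * Q 0 - B1 * B2 * Q 0))) ((1/4) *\<^sub>R (B2 * Q 0))"
    using ap_mono[of "717/4" _ _ 180] by (simp add: algebra_simps)
  moreover have "ap 6 (Q 2 * (G1 * Q 0)) (Q 2 * ((1/4) *\<^sub>R (Q 0 - B1 * Q 0 + B2 * Q 0 - B1 * B2 * Q 0)))"
    by (intro ap_left joint_effect_1) simp_all
  ultimately show ?thesis using ap_trans[of 6 _ _ 180] by (simp add: mult.assoc)
qed

text \<open>Answers 2 and 3 lie inside \<open>F2\<close>, where \<open>B2\<close> is +1, but outside
  \<open>F4\<close>, where \<open>C2\<close> is -1. On block 2, where \<open>C2\<close> agrees with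
  \<open>B2\<close>, this is an opposite sign.\<close>

lemma R_absorb: "ap 4 R1 (R1 * B2)" "ap 4 R2 (- (R2 * C2))"
proof -
  have 1: "ap 1 (N 1 b * F2) (N 1 b)" if "b \<in> {2, 3}" for b
  proof -
    have "meet (F 1 {b}) (F 1 {b}) F2"
      using that unfolding F2_def by (intro povm_meet[OF N_povm]) (auto simp: answers_def)
    then have "pos (F2 - N 1 b)" by (simp add: meet_def N_single)
    then show ?thesis using that F14_eff F14_proj N_eff by (intro sub_absorb) auto
  qed
  have "ap 2 (R1 * F2) R1"
    using ap_diff[OF 1[of 2] 1[of 3]] by (simp add: R1_def algebra_simps)
  from ap_sym[OF ap_double[OF this, of R1]] have "ap 4 (2 * R1 - R1) (R1 * B2)"
    by (simp add: B2_def algebra_simps two_scaleR)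
  moreover have "2 * R1 - R1 = R1" by (simp add: mult_2)
  ultimately show "ap 4 R1 (R1 * B2)" by simp
  have 2: "ap 1 (N 2 b * F4) 0" if "b \<in> {2, 3}" for b
  proof -
    have "meet (F 2 ({b} \<inter> {2, 3, 4})) (F 2 {b}) (F 2 {2, 3, 4})"
      using that by (intro povm_meet[OF N_povm]) (auto simp: answers_def)
    moreover have "{b} \<inter> {2, 3, 4} = {b}" using that by auto
    moreover have "1 - F4 = F 2 {2, 3, 4}"
      unfolding F4_def by (simp add: povm_compl[OF N_povm] table)
    ultimately have "pos (1 - F4 - N 2 b)" by (simp add: meet_def N_single)
    then show ?thesis using that F14_eff F14_proj N_eff by (intro sub_orth) auto
  qed
  have "ap 2 (R2 * F4) 0"
    using ap_diff[OF 2[of 2] 2[of 3]] by (simp add: R2_def algebra_simps)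
  from ap_double[OF this, of R2] have "ap 4 (R2 * C2) (- R2)"
    by (simp add: C2_def algebra_simps two_scaleR)
  from ap_sym[OF ap_neg[OF this]] show "ap 4 R2 (- (R2 * C2))" by simp
qed

text \<open>The operator \<open>X\<close> has no diagonal part on block \<open>0\<close>: by \<open>X\<close> and \<open>Y\<close>, the operators
  \<open>R1\<close> and \<open>R2\<close> agree from block \<open>0\<close> and from block \<open>2\<close> to block \<open>2\<close>, but \<open>B2\<close>, which exchanges the
  two blocks, is absorbed by \<open>R1\<close> and \<open>R2\<close> with opposite signs.\<close>

lemma U0_X_Q0: "ap 3432 (U0 * X * Q 0) 0"
proof -
  have e1: "ap 24 (U0 * X * (Q 2 * G1 * Q 0)) (- (Q 2 * R1 * Q 0))"
    by (rule exch_block[OF exch_intros(1) _ _ S_U_Q(3)]) simp_all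
  have e2: "ap 24 (- (U0 * X * (Q 2 * G2 * Q 0))) (- (Q 2 * R2 * Q 0))"
    using exch_block[OF exch_intros(2) _ _ S_U_Q(3), of 2] by simp
  have e3: "ap 24 (U2 * Y * (Q 2 * G1 * Q 2)) (- (Q 2 * R1 * Q 2))"
    by (rule exch_block[OF exch_intros(3) _ _ S_U_Q(4)]) simp_all
  have e4: "ap 24 (U2 * Y * (Q 2 * G2 * Q 2)) (- (Q 2 * R2 * Q 2))"
    by (rule exch_block[OF exch_intros(4) _ _ S_U_Q(4)]) simp_all
  have m1: "ap 50 (U0 * X * (Q 2 * G1 * Q 0)) (- (U0 * X * (Q 2 * G2 * Q 0)))"
    using ap_left[OF G_20, of "U0 * X"] by (simp add: contr_mult)
  have m2: "ap 94 (U2 * Y * (Q 2 * G1 * Q 2)) (U2 * Y * (Q 2 * G2 * Q 2))"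
    using ap_left[OF G_22, of "U2 * Y"] by (simp add: contr_mult)
  have r20: "ap 98 (Q 2 * R1 * Q 0) (Q 2 * R2 * Q 0)"
    using ap_neg[OF ap_trans[OF ap_trans[OF ap_sym[OF e1] m1] e2]] by simp
  have r22: "ap 142 (Q 2 * R1 * Q 2) (Q 2 * R2 * Q 2)"
    using ap_neg[OF ap_trans[OF ap_trans[OF ap_sym[OF e3] m2] e4]] by simp
  have s1: "ap 248 (Q 2 * R1 * Q 2) (Q 2 * R1 * Q 0 * B2)"
  proof -
    have "ap 8 (Q 2 * (R1 * Q 2)) (Q 2 * (R1 * B2 * Q 2))"
      using step[OF R_absorb(1) _ _ _ Q_simps(3), of "Q 2" 8] by simp
    moreover have "ap 240 (Q 2 * R1 * (B2 * Q 2)) (Q 2 * R1 * (Q 0 * B2))"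
      by (intro ap_left ap_sym[OF swaps(7)]) simp
    ultimately show ?thesis using ap_trans[of 8 _ _ 240] by (simp add: mult.assoc)
  qed
  have s2: "ap 288 (Q 2 * R2 * Q 2) (- (Q 2 * R2 * Q 0 * B2))"
  proof -
    have "ap 8 (Q 2 * (R2 * Q 2)) (Q 2 * (- (R2 * C2) * Q 2))"
      using step[OF R_absorb(2) _ _ _ Q_simps(3), of "Q 2" 8] by simp
    moreover have "ap 40 (- (Q 2 * R2) * (C2 * Q 2)) (- (Q 2 * R2) * (B2 * Q 2))"
      using tau2_right[of 2] by (intro ap_left) (simp_all add: tau2_def contr_minus contr_mult)
    moreover have "ap 240 (- (Q 2 * R2) * (B2 * Q 2)) (- (Q 2 * R2) * (Q 0 * B2))"
      by (intro ap_left ap_sym[OF swaps(7)]) (simp add: contr_minus contr_mult)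
    ultimately show ?thesis
      using ap_trans[OF ap_trans[of 8 _ _ 40], of _ _ _ 240] by (simp add: mult.assoc)
  qed
  have s3: "ap 102 (Q 2 * R1 * Q 0 * B2) (Q 2 * R2 * Q 0 * B2)"
    using step[OF r20 _ _ _ ok_B(2), of 1 102] by simp
  \<comment> \<open>The loop from block 2 to block 0 by \<open>B2\<close>, across from
    \<open>R1\<close> to \<open>R2\<close>, back by \<open>B2\<close> and across again; the signs of
    \<open>R_absorb\<close> leave a minus.\<close>
  have "ap 780 (Q 2 * R1 * Q 2) (- (Q 2 * R1 * Q 2))"
    using ap_trans[OF ap_trans[OF ap_trans[OF s1 s3] ap_sym[OF ap_neg[OF s2], unfolded minus_minus]] ap_sym[OF ap_neg[OF r22]]] by simp
  from ap_halve[OF this] have "ap 390 (Q 2 * R1 * Q 2) 0" by simp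
  then have "ap 638 (Q 2 * R1 * Q 0 * B2) 0" using ap_trans[OF ap_sym[OF s1]] by fastforce
  then have a: "ap 642 (Q 2 * R1 * Q 0 * B2 * B2) 0"
    using step[OF _ _ _ _ ok_B(2), of 638 "Q 2 * R1 * Q 0 * B2" 0 1 642] by simp
  have "ap 4 (Q 2 * R1 * Q 0 * (B2 * B2)) (Q 2 * R1 * Q 0 * 1)" by (intro ap_left B_square) simp
  then have "ap 646 (Q 2 * R1 * Q 0) 0"
    using ap_trans[OF ap_sym a[unfolded mult.assoc]] by (fastforce simp: mult.assoc)
  from ap_trans[OF e1 ap_neg[OF this]] have "ap 670 (U0 * X * (Q 2 * G1 * Q 0)) 0" by simp
  moreover have "ap 186 (U0 * X * (Q 2 * G1 * Q 0)) (U0 * X * ((1/4) *\<^sub>R (B2 * Q 0)))"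
    by (intro ap_left G1_20) (simp add: contr_mult)
  ultimately have "ap 856 ((1/4) *\<^sub>R (U0 * X * (B2 * Q 0))) 0"
    using ap_trans[OF ap_sym, of 186 _ _ 670] by simp
  from ap_scale_cancel[OF this] have "ap 3424 (U0 * X * (B2 * Q 0)) 0" by simp
  \<comment> \<open>A second \<open>B2\<close> from the left moves past Alice's
    \<open>U0 * X\<close> and cancels the first one on \<open>Q 0\<close>.\<close>
  then have "ap 3424 (B2 * (U0 * X * (B2 * Q 0))) (B2 * 0)" by (intro ap_left) simp_all
  moreover have "B2 * (U0 * X * (B2 * Q 0)) = U0 * X * (B2 * B2 * Q 0)"
    using mult_swap[of "U0 * X" B2] by simp (metis mult.assoc)
  moreover have "ap 8 (U0 * X * (B2 * B2 * Q 0)) (U0 * X * (1 * Q 0))"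
    using step[OF B_square(2) _ _ _ Q_simps(1), of "U0 * X" 8] by (simp add: contr_mult)
  ultimately show ?thesis using ap_trans[OF ap_sym, of 8 _ _ 3424] by simp
qed

text \<open>Both products agree with \<open>- (Q 4 * R1 * Q 0)\<close>. For \<open>U0 * X\<close>
  this needs \<open>U0_X_Q0\<close>: of the support of \<open>X\<close>, blocks 0 and 4, only block
  4 contributes.\<close>

lemma X_U4: "ap 3642 (X * U4) (U0 * X)"
proof -
  have 1: "ap 3 (U0 * X) (U0 * X * (Q 0 + Q 4))"
  proof -
    have "ap 2 (U0 * X) (U0 * (X * S0))"
      using exch_intros(1) by (intro ap_left ap_sym[of 2 "X * S0" X]) (simp_all add: exch_def)
    moreover have "ap 1 (U0 * X * S0) (U0 * X * (Q 0 + Q 4))"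
      by (intro ap_left S_U_Q) (simp add: contr_mult)
    ultimately show ?thesis using ap_trans[of 2 _ _ 1] by (simp add: mult.assoc)
  qed
  have 2: "ap 3432 (U0 * X * (Q 0 + Q 4)) (U0 * X * Q 4)"
    using U0_X_Q0 by (simp add: ap_def algebra_simps)
  have 3: "ap 99 (U0 * (X * Q 4)) (U0 * - (Q 4 * R1 * Q 0))" by (intro ap_left X_Q4) simp
  have c: "U0 * - (Q 4 * R1 * Q 0) = - (Q 4 * R1 * Q 0 * U0)"
    using mult_swap[of U0 "Q 4 * R1 * Q 0"] by simp
  have 4: "ap 2 (- (Q 4 * R1 * Q 0 * U0)) (- (Q 4 * R1 * Q 0 * Q 0))"
    by (intro ap_neg ap_left S_U_Q) simp
  have 5: "ap 4 (- (Q 4 * R1 * (Q 0 * Q 0))) (- (Q 4 * R1 * Q 0))"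
    by (intro ap_neg ap_left Q_idem) simp_all
  have 6: "ap 1 (X * Q 4) (X * U4)" by (intro ap_left ap_sym[OF S_U_Q(5)]) simp
  have "ap 3640 (U0 * X) (X * U4)"
    using ap_trans[OF ap_trans[OF ap_trans[OF ap_trans[OF ap_trans[OF ap_trans[OF 1 2] 3[unfolded c, folded mult.assoc]] 4]
            5[folded mult.assoc]] ap_sym[OF X_Q4]] 6] by simp
  then show ?thesis using ap_mono[OF ap_sym, of 3640] by simp
qed

text \<open>The two reflections reduce to \<open>R1 * X * U4\<close>; then \<open>X\<close> carries
  block 4 to block 0, and \<open>X * R1\<close> is exchanged for \<open>- (S0 * G1)\<close>. What
  remains is \<open>- (G1 * Q 0)\<close>, which by \<open>G_sum_Q0\<close> is half of a reflection
  applied to \<open>Q 0\<close>. In this form the factor 1/2 is explicit and the rest nearly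
  preserves norms.\<close>

lemma transfer_4:
  "ap 3730 ((2 * M 2 3 - 1) * U4 * ((2 * N 1 2 - 1) * Q 4)) ((1/2) *\<^sub>R ((2 * G2 - 1) * Q 0))"
proof -
  let ?x = "2 * M 2 3 - 1" and ?r = "2 * N 1 2 - 1"
  have mem: "?x * U4 \<in> \<A>" "X * U4 \<in> \<A>" "bc ?r" "bc (?r * Q 4)"
    using N_mem N_eff bc_reflection by (simp_all add: M_mem)
  have idem: "ap 1 (U4 * U4) U4"
  proof -
    have p: "proj 1 U4" "eff U4" using match_00''(2) M_eff by (simp_all add: E_single U4_def)
    have "norm ((U4 - U4 * U4) \<cdot> \<psi>) \<le> 1 * \<eta>"
      using norm_le_sn[OF defect_eff[OF p(2)], of \<psi>] p(1) unfolding proj_def by linarith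
    then have "ap 1 U4 (U4 * U4)" by (simp add: ap_def)
    then show ?thesis by (rule ap_sym)
  qed
  have sS: "eff S0" unfolding S0_def by (rule E_eff) simp_all
  have x: "ap 10 (?x * U4) (X * U4)"
  proof -
    have 1: "ap 1 ((1 - S0) * U4) ((1 - S0) * Q 4)"
      by (intro ap_left S_U_Q eff_contr eff_compl sS)
    have 2: "ap 1 (Q 4 * (1 - S0)) (Q 4 * (1 - (Q 0 + Q 4)))"
      using ap_left[OF ap_diff[OF ap_refl[of 0 1] S_U_Q(1)], of "Q 4"] by simp
    have 3: "ap 8 (Q 4 * (1 - (Q 0 + Q 4))) 0"
      using ap_add[OF Q_orth[of 4 0] Q_idem[of 4]] ap_diff[OF ap_refl[of 0 "Q 4"]]
      by (fastforce simp: algebra_simps)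
    have c: "(1 - S0) * Q 4 = Q 4 * (1 - S0)" by (rule mult_swap) simp_all
    have "ap 10 ((1 - S0) * U4) 0" using ap_trans[OF ap_trans[OF 1[unfolded c] 2] 3] by simp
    moreover have "X * U4 - ?x * U4 = (1 - S0) * U4"
      by (simp add: X_def S0_def sum.insert two_scaleR algebra_simps) (simp flip: scaleR_2)
    ultimately show ?thesis
      using ap_sym[of 10 "X * U4" "?x * U4"] by (simp add: ap_def)
  qed
  have r: "ap 2 (?r * Q 4) (R1 * Q 4)"
  proof -
    have "R1 * Q 4 - ?r * Q 4 = Q 4 - G1 * Q 4"
      by (simp add: R1_def G1_def sum.insert two_scaleR algebra_simps) (simp flip: scaleR_2)
    then show ?thesis using ap_sym[of 2 "R1 * Q 4" "?r * Q 4"] ap_sym[OF G_Q4(1)] by (simp add: ap_def)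
  qed
  have c1: "?x * U4 * (?r * Q 4) = ?r * Q 4 * (?x * U4)" using mem by (intro mult_swap)
  have 1: "ap 10 (?r * Q 4 * (?x * U4)) (?r * Q 4 * (X * U4))" using mem by (intro ap_left x) simp
  have c2: "?r * Q 4 * (X * U4) = X * U4 * (?r * Q 4)" using mem by (intro mult_swap[symmetric])
  have 2: "ap 2 (X * U4 * (?r * Q 4)) (X * U4 * (R1 * Q 4))" by (intro ap_left r) (simp add: contr_mult)
  have 3: "ap 1 (X * U4 * R1 * Q 4) (X * U4 * R1 * U4)"
    by (intro ap_left ap_sym[OF S_U_Q(5)]) (simp add: contr_mult)
  have c3: "X * U4 * R1 * U4 = R1 * X * (U4 * U4)"
    using mult_swap[of "X * U4" R1] by (simp add: mult.assoc)
  have 4: "ap 1 (R1 * X * (U4 * U4)) (R1 * X * U4)" by (intro ap_left idem) (simp add: contr_mult)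
  have 5: "ap 3642 (R1 * (X * U4)) (R1 * (U0 * X))" by (intro ap_left X_U4) simp
  have c4: "R1 * (U0 * X) = U0 * (X * R1)"
    using mult_swap[of "U0 * X" R1] by (simp add: mult.assoc)
  have 6: "ap 4 (U0 * (X * R1)) (U0 * - (S0 * G1))"
    using exch_intros(1) by (intro ap_left) (simp_all add: exch_def)
  have c5: "U0 * - (S0 * G1) = - (G1 * U0 * S0)"
    using mult_swap[of "U0 * S0" G1] by (simp add: mult.assoc)
  have 7: "ap 1 (- (G1 * U0 * S0)) (- (G1 * U0 * (Q 0 + Q 4)))"
    by (intro ap_neg ap_left S_U_Q) (simp add: contr_mult)
  have bQ: "bc (Q 0 + Q 4)" by (rule bc_pair) simp_all
  have c6: "G1 * U0 * (Q 0 + Q 4) = G1 * (Q 0 + Q 4) * U0"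
    using mult_swap[of U0 "Q 0 + Q 4"] bQ by (simp add: mult.assoc)
  have 8: "ap 2 (- (G1 * (Q 0 + Q 4) * U0)) (- (G1 * (Q 0 + Q 4) * Q 0))"
    using bQ by (intro ap_neg ap_left S_U_Q) (simp add: contr_mult)
  have 9: "ap 8 (- (G1 * ((Q 0 + Q 4) * Q 0))) (- (G1 * Q 0))"
    using Q_absorb(1)[of 0 4] by (intro ap_neg ap_left) simp_all
  have 10: "ap 48 (- (G1 * Q 0)) ((1/2) *\<^sub>R ((2 * G2 - 1) * Q 0))"
  proof -
    have "(1/2) *\<^sub>R ((2 * G2 - 1) * Q 0) = G2 * Q 0 - (1/2) *\<^sub>R Q 0"
      by (simp add: two_scaleR algebra_simps)
    then show ?thesis
      using ap_sym[OF G_sum_Q0] by (simp add: ap_def algebra_simps)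
  qed
  let ?l = "?r * Q 4 * (?x * U4)"
  have a: "ap 12 ?l (X * U4 * R1 * Q 4)"
    using ap_trans[OF 1[unfolded c2] 2] by (simp add: mult.assoc)
  have b: "ap 14 ?l (R1 * (X * U4))"
    using ap_trans[OF ap_trans[OF a 3[unfolded c3]] 4] by (simp add: mult.assoc)
  have c: "ap 3660 ?l (- (G1 * U0 * S0))"
    using ap_trans[OF ap_trans[OF b 5[unfolded c4]] 6[unfolded c5]] by simp
  have d: "ap 3663 ?l (- (G1 * (Q 0 + Q 4) * Q 0))"
    using ap_trans[OF ap_trans[OF c 7[unfolded c6]] 8] by simp
  have "ap 3719 ?l ((1/2) *\<^sub>R ((2 * G2 - 1) * Q 0))"
    using ap_trans[OF ap_trans[OF d 9[folded mult.assoc]] 10] by simp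
  then show ?thesis unfolding c1 by (rule ap_mono) simp
qed

end

section \<open>The extraction operators\<close>

text \<open>The vectors \<open>v i j\<close> are the components of the extracted state,
  \<open>r\<close> the target's coefficients. Both steps complete a square, so the loss is the
  squared distance to the target tensored with \<open>z\<close>, for any \<open>z\<close> of any
  norm.\<close>

lemma fidelity_bound:
  fixes v :: "'i \<Rightarrow> 'i \<Rightarrow> 'v::real_inner"
  assumes I: "finite I" and one: "(\<Sum>i\<in>I. (r i)\<^sup>2) = 1"
  shows "(\<Sum>i\<in>I. \<Sum>j\<in>I. (norm (v i j))\<^sup>2)
      - (\<Sum>i\<in>I. \<Sum>j\<in>I. (norm (v i j - (if i = j then r i *\<^sub>R z else 0)))\<^sup>2)
    \<le> (norm (\<Sum>i\<in>I. r i *\<^sub>R v i i))\<^sup>2"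
proof -
  let ?f = "\<Sum>i\<in>I. r i *\<^sub>R v i i"
  have "(norm (v i j))\<^sup>2 - (norm (v i j - (if i = j then r i *\<^sub>R z else 0)))\<^sup>2
      = (if i = j then 2 * ((r i *\<^sub>R v i i) \<bullet> z) - (r i)\<^sup>2 * (norm z)\<^sup>2 else 0)" for i j
    by (cases "i = j") (simp_all add: power2_norm_eq_inner inner_diff_left inner_diff_right inner_commute
        power2_eq_square[of "r j"] algebra_simps)
  then have "(\<Sum>i\<in>I. \<Sum>j\<in>I. (norm (v i j))\<^sup>2)
      - (\<Sum>i\<in>I. \<Sum>j\<in>I. (norm (v i j - (if i = j then r i *\<^sub>R z else 0)))\<^sup>2)
      = (\<Sum>i\<in>I. 2 * ((r i *\<^sub>R v i i) \<bullet> z) - (r i)\<^sup>2 * (norm z)\<^sup>2)"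
    using I by (simp flip: sum_subtractf)
  also have "\<dots> = 2 * (?f \<bullet> z) - (norm z)\<^sup>2"
    by (simp add: sum_subtractf inner_sum_left one flip: sum_distrib_left sum_distrib_right)
  also have "\<dots> \<le> (norm ?f)\<^sup>2"
    using zero_le_power2[of "norm (?f - z)"]
    by (simp add: power2_norm_eq_inner inner_diff_left inner_diff_right inner_commute)
  finally show ?thesis .
qed

context op_state
begin

text \<open>A product of reflections and effects shrinks the squared norm by the sum, over the factors \<open>E\<close>, of \<open>c\<close> times
  the defect of \<open>E\<close> on the vector produced by the factors \<open>w\<close> to its right.\<close>

definition defect :: "(real \<times> 'r \<times> 'r) list \<Rightarrow> 'v \<Rightarrow> real" where
  "defect L v = (\<Sum>(c, E, w)\<leftarrow>L. c * (sn (E - E * E) (w \<cdot> v))\<^sup>2)"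

lemma effect_norm: "eff E \<Longrightarrow> (norm (E \<cdot> v))\<^sup>2 = v \<bullet> (E \<cdot> v) - (sn (E - E * E) v)\<^sup>2"
  by (simp add: sn_sq eff_square act_diff inner_diff_right inner_mult_self effD)

lemma split_norm:
  assumes "eff E"
  shows "(norm ((1 - E) \<cdot> v))\<^sup>2 + (norm (E \<cdot> v))\<^sup>2 = (norm v)\<^sup>2 - 2 * (sn (E - E * E) v)\<^sup>2"
proof -
  have "(1 - E) - (1 - E) * (1 - E) = E - E * E" by (simp add: algebra_simps)
  then show ?thesis
    using effect_norm[OF assms, of v] effect_norm[OF eff_compl[OF assms], of v]
    by (simp add: act_diff act_one inner_diff_right power2_norm_eq_inner)
qed

end

context bipartite
begin

text \<open>Lets Alice's losses after one of Bob's operators be charged to the original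
  state.\<close>

lemma defect_commute:
  assumes "\<forall>(c, E, w)\<in>set L. 0 \<le> c \<and> E \<in> \<A> \<and> eff E \<and> w \<in> \<A>" "C \<in> \<B>" "contr C"
  shows "defect L (C \<cdot> v) \<le> defect L v"
  unfolding defect_def
proof (rule sum_list_mono, clarsimp)
  fix c E w assume "(c, E, w) \<in> set L"
  with assms(1) have a: "0 \<le> c" "E \<in> \<A>" "eff E" "w \<in> \<A>" by auto
  have "sn (E - E * E) (w \<cdot> C \<cdot> v) = sn (E - E * E) (C \<cdot> w \<cdot> v)"
    using commute_act[OF a(4) assms(2)] by simp
  also have "\<dots> \<le> sn (E - E * E) (w \<cdot> v)"
    using a assms eff_square by (intro sn_commute) simp_all
  finally show "c * (sn (E - E * E) (w \<cdot> C \<cdot> v))\<^sup>2 \<le> c * (sn (E - E * E) (w \<cdot> v))\<^sup>2"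
    using a eff_square by (intro mult_left_mono power_mono) simp_all
qed

lemma defect_Cons:
  assumes "sn (E - E * E) (w \<cdot> \<psi>) \<le> k * \<eta>" "eff E" "0 \<le> c" "defect L \<psi> \<le> m * \<eta>\<^sup>2"
  shows "defect ((c, E, w) # L) \<psi> \<le> (c * k\<^sup>2 + m) * \<eta>\<^sup>2"
proof -
  have "c * (sn (E - E * E) (w \<cdot> \<psi>))\<^sup>2 \<le> c * (k * \<eta>)\<^sup>2"
    using assms eff_square by (intro mult_left_mono power_mono) simp_all
  then show ?thesis
    using assms(4) by (simp add: defect_def algebra_simps power_mult_distrib)
qed

lemma defect_Nil_le: "defect [] \<psi> \<le> 0 * \<eta>\<^sup>2"
  by (simp add: defect_def)

text \<open>The reflected factor \<open>b\<close> on one side and its mirror image \<open>a\<close> on the other bring block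
  \<open>q\<close> of both systems to the reference block.\<close>

lemma transfer:
  assumes A: "a \<in> \<A>" "contr a" "K \<in> \<A>" "contr K" and B: "bc J" "bc b" "ok 2 q" "ok n b'"
    and h: "ap 4 K q" "ap m a b'" "ap 4 (q * q) q"
  shows "ap (8 + m + 2 * n) (a * K * (J * (b * q))) (J * (b * (q * b')))"
proof -
  have mem: "J \<in> \<B>" "b \<in> \<B>" "q \<in> \<B>" "bc q" using B by (auto simp: bc_def ok_def)
  have c1: "a * K * (J * (b * q)) = J * (b * q) * a * K"
    using commute[of "a * K" "J * (b * q)"] A mem by (simp add: mult.assoc)
  have 1: "ap 4 (J * (b * q) * a * K) (J * (b * q) * a * q)"
    using A B mem by (intro ap_left h) (simp add: contr_mult)
  have c2: "J * (b * q) * a * q = J * (b * (q * q)) * a"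
    using commute[of a q] A mem by (simp add: mult.assoc)
  have 2: "ap m (J * (b * (q * q)) * a) (J * (b * (q * q)) * b')"
    using B mem by (intro ap_left h) (simp add: contr_mult)
  have 3: "ap (4 + 2 * n) (J * (b * (q * q)) * b') (J * (b * (q * b')))"
    using step[OF h(3) _ _ _ B(4), of "J * b" "4 + 2 * n"] B mem by (simp add: mult.assoc)
  show ?thesis
    using ap_trans[OF ap_trans[OF 1[unfolded c2] 2] 3] unfolding c1 by (rule ap_mono) simp
qed

end

context game
begin

text \<open>\<open>Kr i\<close> is Alice's version of \<open>Q i\<close>; \<open>a1\<close> and \<open>a2\<close> are hers of \<open>B1\<close> and \<open>B2\<close>. On block \<open>4\<close> the
  reflections \<open>a4\<close> and \<open>r4\<close> agree with \<open>X\<close> and \<open>R1\<close>.\<close>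

definition "p01 = E 0 {0, 1}"
definition "p23 = E 0 {2, 3}"
definition "t13 = E 1 {3, 4}"
definition "e1 = E 0 {1, 2}"
definition "e2 = E 1 {0, 2, 3}"
definition "a1 = 2 * e1 - 1"
definition "a2 = 2 * e2 - 1"
definition "a4 = 2 * M 2 3 - 1"
definition "r4 = 2 * N 1 2 - 1"
definition "J = 2 * G2 - 1"

text \<open>No question of Alice separates all five blocks, so the blocks come from a measurement of
  question 0 followed by one of question 1. Unlike the differences \<open>U0\<close> and
  \<open>U2\<close>, such products have norms that add up, except for defects.\<close>

definition Kr :: "nat \<Rightarrow> 'r" where
  "Kr i = [(1 - t13) * p01, t13 * p01, (1 - t13) * p23, t13 * p23, U4] ! i"

definition WA :: "nat \<Rightarrow> 'r" where
  "WA i = [Kr 0, a1 * Kr 1, a2 * Kr 2, a1 * (a2 * Kr 3), a4 * Kr 4] ! i"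

text \<open>The factor \<open>J\<close> brings blocks 0 to 3 to the vector that
  \<open>transfer_4\<close> produces from block 4; there \<open>J\<close> appears by itself and is
  not inserted.\<close>

definition WB :: "nat \<Rightarrow> 'r" where
  "WB j = [J * Q 0, J * (B1 * Q 1), J * (B2 * Q 2), J * (B1 * (B2 * Q 3)), r4 * Q 4] ! j"

lemma answers_cases: "P 0 \<Longrightarrow> P 1 \<Longrightarrow> P 2 \<Longrightarrow> P 3 \<Longrightarrow> P 4 \<Longrightarrow> i \<in> answers \<Longrightarrow> P i" for i :: nat
  by (auto simp: answers_def)

lemma Kr_simps: "Kr 0 = (1 - t13) * p01" "Kr 1 = t13 * p01" "Kr 2 = (1 - t13) * p23"
    "Kr 3 = t13 * p23" "Kr 4 = U4"
  by (simp_all add: Kr_def)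

lemma W_simps: "WA 0 = Kr 0" "WA 1 = a1 * Kr 1" "WA 2 = a2 * Kr 2" "WA 3 = a1 * (a2 * Kr 3)"
    "WA 4 = a4 * Kr 4" "WB 0 = J * Q 0" "WB 1 = J * (B1 * Q 1)" "WB 2 = J * (B2 * Q 2)"
    "WB 3 = J * (B1 * (B2 * Q 3))" "WB 4 = r4 * Q 4"
  by (simp_all add: WA_def WB_def)

lemma A_ops [simp]: "p01 \<in> \<A>" "p23 \<in> \<A>" "t13 \<in> \<A>" "e1 \<in> \<A>" "e2 \<in> \<A>" "a1 \<in> \<A>" "a2 \<in> \<A>" "a4 \<in> \<A>"
    "M 2 3 \<in> \<A>" "M 2 2 \<in> \<A>"
  by (simp_all add: p01_def p23_def t13_def e1_def e2_def a1_def a2_def a4_def E_mem M_mem)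

lemma A_effs [simp]: "eff p01" "eff p23" "eff t13" "eff e1" "eff e2" "eff U4" "eff (M 2 3)" "eff (M 2 2)"
  by (simp_all add: p01_def p23_def t13_def e1_def e2_def U4_def E_eff M_eff)

lemma B_effs [simp]: "eff G1" "eff G2" "eff F1" "eff F2" "eff (N 1 2)" "eff (N 1 3)"
  by (simp_all add: G1_def G2_def F_eff F14_eff N_eff)

lemma B_mems [simp]: "G1 \<in> \<B>" "G2 \<in> \<B>" "F1 \<in> \<B>" "F2 \<in> \<B>" "N 1 2 \<in> \<B>" "N 1 3 \<in> \<B>"
  by (simp_all add: G1_def G2_def F14_mem F_mem N_mem)

lemma ops_contr [simp]: "contr p01" "contr p23" "contr t13" "contr (1 - t13)" "contr a1" "contr a2" "contr a4"
    "bc J" "bc r4"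
  unfolding a1_def a2_def a4_def J_def r4_def
  by (simp_all add: contr_reflection eff_contr eff_compl bc_reflection)

lemma Kr_mem [simp]: "i \<in> answers \<Longrightarrow> Kr i \<in> \<A>" "i \<in> answers \<Longrightarrow> contr (Kr i)"
  by (rule answers_cases[of "\<lambda>i. Kr i \<in> \<A>"]; simp add: Kr_simps)
     (rule answers_cases[of "\<lambda>i. contr (Kr i)"]; simp add: Kr_simps contr_mult)

lemma WA_mem [simp]: "i \<in> answers \<Longrightarrow> WA i \<in> \<A>"
  by (rule answers_cases[of "\<lambda>i. WA i \<in> \<A>"]; simp add: W_simps)

lemma WB_bc [simp]: "j \<in> answers \<Longrightarrow> bc (WB j)"
  by (rule answers_cases[of "\<lambda>j. bc (WB j)"]; simp add: W_simps)

lemma bc_mem: "bc T \<Longrightarrow> T \<in> \<B>" by (simp add: bc_def)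

lemma Kr_Q: "i \<in> answers \<Longrightarrow> ap 4 (Kr i) (Q i)"
proof -
  have t: "ap 1 t13 (F 0 {1, 3})" unfolding t13_def by (rule match_10'')
  have *: "ap 4 (t13 * p) (F 0 (I \<inter> {1, 3}))" "ap 4 ((1 - t13) * p) (F 0 I - F 0 (I \<inter> {1, 3}))"
    if p: "ap 1 p (F 0 I)" "I \<subseteq> answers" for p I
  proof -
    have c: "t13 * F 0 I = F 0 I * t13" "(1 - t13) * F 0 I = F 0 I * (1 - t13)"
      using commute[of t13 "F 0 I"] F_mem[of 0 I] p by (simp_all add: algebra_simps)
    have cF: "contr (F 0 I)" using eff_contr[OF F_eff] p by simp
    have pr: "ap 2 (F 0 I * F 0 {1, 3}) (F 0 (I \<inter> {1, 3}))"
      using match_10''(3) p by (intro F_prod) (simp_all add: answers_def)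
    have 1: "ap 1 (t13 * p) (F 0 I * t13)" "ap 1 ((1 - t13) * p) (F 0 I * (1 - t13))"
      unfolding c[symmetric] using p by (intro ap_left; simp)+
    have 2: "ap 1 (F 0 I * t13) (F 0 I * F 0 {1, 3})" using t cF by (rule ap_left)
    show 3: "ap 4 (t13 * p) (F 0 (I \<inter> {1, 3}))"
      using ap_trans[OF ap_trans[OF 1(1) 2] pr] by simp
    have "ap 3 (F 0 I - F 0 I * t13) (F 0 I - F 0 (I \<inter> {1, 3}))"
      using ap_diff[OF ap_refl[of 0 "F 0 I"] ap_trans[OF 2 pr]] by simp
    from ap_trans[OF 1(2) this[folded right_diff_distrib[of "F 0 I" 1 t13, simplified]]]
    show "ap 4 ((1 - t13) * p) (F 0 I - F 0 (I \<inter> {1, 3}))" by simp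
  qed
  have 01: "ap 1 p01 (F 0 {0, 1})" and 23: "ap 1 p23 (F 0 {2, 3})"
    unfolding p01_def p23_def by (rule match_00 match_00')+
  have sets: "{0, 1} \<inter> {1, 3} = {1::nat}" "{2, 3} \<inter> {1, 3} = {3::nat}" by auto
  have sub: "{0, 1} \<subseteq> answers" "{2, 3} \<subseteq> answers" by (simp_all add: answers_def)
  have k1: "ap 4 (Kr 1) (Q 1)" "ap 4 (Kr 3) (Q 3)"
    using *(1)[OF 01 sub(1)] *(1)[OF 23 sub(2)] unfolding sets F_single Kr_simps .
  have d: "F 0 {0, 1} - F 0 {1} = Q 0" "F 0 {2, 3} - F 0 {3} = Q 2"
    by (simp_all add: F_pair F_single)
  have k2: "ap 4 (Kr 0) (Q 0)" "ap 4 (Kr 2) (Q 2)"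
    using *(2)[OF 01 sub(1)] *(2)[OF 23 sub(2)] unfolding sets d Kr_simps .
  show "i \<in> answers \<Longrightarrow> ap 4 (Kr i) (Q i)"
    by (rule answers_cases[of "\<lambda>i. ap 4 (Kr i) (Q i)"])
       (use k1 k2 ap_mono[OF S_U_Q(5), of 4] in \<open>simp_all add: Kr_simps(5)\<close>)
qed

lemma mirror_A: "ap 2 a1 B1" "ap 2 a2 B2" "ap 4 (a1 * a2) (B2 * B1)"
proof -
  show 1: "ap 2 a1 B1" and 2: "ap 2 a2 B2"
    unfolding a1_def a2_def B1_def B2_def e1_def e2_def F1_def F2_def
    using ap_double[OF match_01(1), of 1] ap_double[OF match_11(1), of 1] by simp_all
  have "ap 2 (a1 * a2) (a1 * B2)" by (intro ap_left 2) simp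
  also have "a1 * B2 = B2 * a1" by (rule mult_swap) simp_all
  also have "ap 2 (B2 * a1) (B2 * B1)" by (intro ap_left 1) simp
  finally show "ap 4 (a1 * a2) (B2 * B1)" by simp
qed

lemma return_12: "ap 248 (B1 * (Q 1 * B1)) (Q 0)" "ap 248 (B2 * (Q 2 * B2)) (Q 0)"
proof -
  have "ap 240 (B1 * (Q 1 * B1)) (B1 * (B1 * Q 0))" by (intro ap_left swaps) simp
  moreover have "ap 8 (B1 * (B1 * Q 0)) (Q 0)"
    using step[OF B_square(1) _ _ _ Q_simps(1), of 1 8] by (simp add: mult.assoc)
  ultimately show "ap 248 (B1 * (Q 1 * B1)) (Q 0)" using ap_trans[of 240 _ _ 8] by simp
  have "ap 240 (B2 * (Q 2 * B2)) (B2 * (B2 * Q 0))" by (intro ap_left swaps) simp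
  moreover have "ap 8 (B2 * (B2 * Q 0)) (Q 0)"
    using step[OF B_square(2) _ _ _ Q_simps(1), of 1 8] by (simp add: mult.assoc)
  ultimately show "ap 248 (B2 * (Q 2 * B2)) (Q 0)" using ap_trans[of 240 _ _ 8] by simp
qed

lemma return_3: "ap 540 (B1 * B2 * (Q 3 * (B2 * B1))) (Q 0)"
proof -
  have BB: "ap 16 (B2 * B1) (B1 * B2)" using ap_trans[OF joint_1(2) ap_sym[OF joint_1(1)]] by simp
  have okB: "ok 4 (B2 * Q 0)" using ok_mult[OF ok_B(2) Q_simps(1)] by simp
  have 1: "ap 16 (B1 * B2 * Q 3 * (B2 * B1)) (B1 * B2 * Q 3 * (B1 * B2))"
    by (intro ap_left BB) simp
  have 2: "ap 244 (B1 * B2 * (Q 3 * B1 * B2)) (B1 * B2 * (B1 * Q 2 * B2))"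
    using step[OF swaps(3) _ _ _ ok_B(2), of "B1 * B2" 244] by simp
  have 3: "ap 240 (B1 * B2 * B1 * (Q 2 * B2)) (B1 * B2 * B1 * (B2 * Q 0))"
    by (intro ap_left swaps) simp
  have 4: "ap 24 (B1 * (B2 * B1 * (B2 * Q 0))) (B1 * (B1 * B2 * (B2 * Q 0)))"
    using step[OF BB _ _ _ okB, of B1 24] by simp
  have 5: "ap 8 (B1 * B1 * (B2 * B2 * Q 0)) (B1 * B1 * (1 * Q 0))"
    using step[OF B_square(2) _ _ _ Q_simps(1), of "B1 * B1" 8] by simp
  have 6: "ap 8 (B1 * B1 * Q 0) (Q 0)"
    using step[OF B_square(1) _ _ _ Q_simps(1), of 1 8] by simp
  note n = mult.assoc mult_1_left
  show ?thesis
    using ap_trans[OF ap_trans[OF ap_trans[OF ap_trans[OF ap_trans[OF 1[unfolded n] 2[unfolded n]] 3[unfolded n]]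
          4[unfolded n]] 5[unfolded n]] 6[unfolded n]] by (simp add: mult.assoc)
qed

definition coef :: "nat \<Rightarrow> real" where "coef i = (if i = 4 then 1/2 else 1)"

text \<open>Each block is moved to block 0 and ends in \<open>J * Q 0\<close>, which is then
  identified with the product for block 0. The cost is dominated by the 3730 of block 4.\<close>

lemma W_diagonal: "i \<in> answers \<Longrightarrow> ap 3800 (WA i * WB i) (coef i *\<^sub>R (WA 0 * WB 0))"
proof -
  have K: "K \<in> \<A> \<Longrightarrow> J * Q 0 * K = K * (J * Q 0)" for K
    using mult_swap[of K "J * Q 0"] by simp
  have 0: "ap 8 (WA 0 * WB 0) (J * Q 0)"
  proof -
    have "ap 4 (J * Q 0 * Kr 0) (J * Q 0 * Q 0)" by (intro ap_left Kr_Q) simp_all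
    moreover have "ap 4 (J * (Q 0 * Q 0)) (J * Q 0)" by (intro ap_left Q_idem) simp_all
    ultimately show ?thesis
      using ap_trans[of 4 _ _ 4] K[of "Kr 0"] by (simp add: W_simps mult.assoc)
  qed
  have *: "ap (k + 8 + m + 2 * n) (a * Kr i * (J * (b * Q i))) (J * Q 0)"
    if "a \<in> \<A>" "contr a" "bc b" "ok n b'" "ap m a b'" "ap k (b * (Q i * b')) (Q 0)" "i \<in> answers"
    for a b b' i k m n
  proof -
    have 1: "ap (8 + m + 2 * n) (a * Kr i * (J * (b * Q i))) (J * (b * (Q i * b')))"
      using that by (intro transfer Kr_Q Q_idem ok_Q) simp_all
    have 2: "ap k (J * (b * (Q i * b'))) (J * Q 0)" using that by (intro ap_left) simp_all
    show ?thesis by (rule ap_mono[OF ap_trans[OF 1 2]]) simp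
  qed
  have 1: "ap 262 (WA 1 * WB 1) (J * Q 0)"
    using *[OF _ _ _ ok_B(1) mirror_A(1) return_12(1)] by (simp add: W_simps)
  have 2: "ap 262 (WA 2 * WB 2) (J * Q 0)"
    using *[OF _ _ _ ok_B(2) mirror_A(2) return_12(2)] by (simp add: W_simps)
  have okB: "ok 4 (B2 * B1)" using ok_mult[OF ok_B(2,1)] by simp
  have 3: "ap 560 (WA 3 * WB 3) (J * Q 0)"
    using *[OF _ _ _ okB mirror_A(3) return_3] by (simp add: W_simps mult.assoc contr_mult)
  have 4: "ap 3730 (WA 4 * WB 4) ((1/2) *\<^sub>R (J * Q 0))"
    using transfer_4 by (simp add: W_simps Kr_simps a4_def r4_def J_def)
  show "i \<in> answers \<Longrightarrow> ap 3800 (WA i * WB i) (coef i *\<^sub>R (WA 0 * WB 0))"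
  proof (rule answers_cases[of "\<lambda>i. ap 3800 (WA i * WB i) (coef i *\<^sub>R (WA 0 * WB 0))"])
    show "ap 3800 (WA 0 * WB 0) (coef 0 *\<^sub>R (WA 0 * WB 0))" by (simp add: coef_def)
    show "ap 3800 (WA 1 * WB 1) (coef 1 *\<^sub>R (WA 0 * WB 0))"
      using ap_mono[OF ap_trans[OF 1 ap_sym[OF 0]], of 3800] by (simp add: coef_def)
    show "ap 3800 (WA 2 * WB 2) (coef 2 *\<^sub>R (WA 0 * WB 0))"
      using ap_mono[OF ap_trans[OF 2 ap_sym[OF 0]], of 3800] by (simp add: coef_def)
    show "ap 3800 (WA 3 * WB 3) (coef 3 *\<^sub>R (WA 0 * WB 0))"
      using ap_mono[OF ap_trans[OF 3 ap_sym[OF 0]], of 3800] by (simp add: coef_def)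
    show "ap 3800 (WA 4 * WB 4) (coef 4 *\<^sub>R (WA 0 * WB 0))"
      using ap_mono[OF ap_trans[OF 4 ap_scale[OF ap_sym[OF 0], of "1/2"]], of 3800] by (simp add: coef_def)
  qed
qed

lemma WA_form: "i \<in> answers \<Longrightarrow> \<exists>a\<in>\<A>. contr a \<and> WA i = a * Kr i"
proof (rule answers_cases[of "\<lambda>i. \<exists>a\<in>\<A>. contr a \<and> WA i = a * Kr i"])
  show "\<exists>a\<in>\<A>. contr a \<and> WA 0 = a * Kr 0" by (intro bexI[of _ 1]) (simp_all add: W_simps)
  show "\<exists>a\<in>\<A>. contr a \<and> WA 3 = a * Kr 3"
    by (intro bexI[of _ "a1 * a2"]) (simp_all add: W_simps mult.assoc contr_mult)
  show "\<exists>a\<in>\<A>. contr a \<and> WA 1 = a * Kr 1" by (intro bexI[of _ a1]) (simp_all add: W_simps)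
  show "\<exists>a\<in>\<A>. contr a \<and> WA 2 = a * Kr 2" by (intro bexI[of _ a2]) (simp_all add: W_simps)
  show "\<exists>a\<in>\<A>. contr a \<and> WA 4 = a * Kr 4" by (intro bexI[of _ a4]) (simp_all add: W_simps)
qed

lemma WB_form: "j \<in> answers \<Longrightarrow> \<exists>b. bc b \<and> WB j = b * Q j"
proof (rule answers_cases[of "\<lambda>j. \<exists>b. bc b \<and> WB j = b * Q j"])
  show "\<exists>b. bc b \<and> WB 1 = b * Q 1" by (intro exI[of _ "J * B1"]) (simp add: W_simps mult.assoc)
  show "\<exists>b. bc b \<and> WB 2 = b * Q 2" by (intro exI[of _ "J * B2"]) (simp add: W_simps mult.assoc)
  show "\<exists>b. bc b \<and> WB 3 = b * Q 3" by (intro exI[of _ "J * B1 * B2"]) (simp add: W_simps mult.assoc)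
  show "\<exists>b. bc b \<and> WB 0 = b * Q 0" by (intro exI[of _ J]) (simp add: W_simps)
  show "\<exists>b. bc b \<and> WB 4 = b * Q 4" by (intro exI[of _ r4]) (simp add: W_simps)
qed

lemma W_off_diagonal:
  assumes "i \<in> answers" "j \<in> answers" "i \<noteq> j"
  shows "ap 8 (WA i * WB j) 0"
proof -
  obtain a where a: "a \<in> \<A>" "contr a" "WA i = a * Kr i" using WA_form assms by blast
  obtain b where b: "bc b" "WB j = b * Q j" using WB_form assms by blast
  have c: "WA i * WB j = a * (b * Q j) * Kr i"
    using mult_swap[of "Kr i" "b * Q j"] a b assms Q_bc by (simp add: mult.assoc)
  have "ap 4 (a * (b * Q j) * Kr i) (a * (b * Q j) * Q i)"
    using a b assms Q_bc by (intro ap_left Kr_Q) (simp_all add: contr_mult)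
  moreover have "ap 4 (a * b * (Q j * Q i)) (a * b * 0)"
    using a b assms by (intro ap_left Q_orth) (auto intro: contr_mult)
  ultimately show ?thesis
    unfolding c using ap_trans[of 4 _ _ 4] by (simp add: mult.assoc)
qed

text \<open>Here and in \<open>LB\<close> the coefficients record the kind of factor: 1 for an
  effect (\<open>effect_norm\<close>), 2 for a splitting into an effect and its complement
  (\<open>split_norm\<close>), 4 for a reflection (\<open>reflection_norm\<close>).\<close>

definition LA :: "(real \<times> 'r \<times> 'r) list" where
  "LA = [(1, p01, 1), (1, p23, 1), (1, U4, 1), (2, t13, p01), (2, t13, p23), (4, e1, Kr 1),
  (4, e2, Kr 2), (4, e1, a2 * Kr 3), (4, e2, Kr 3), (4, M 2 3, Kr 4)]"

definition LB :: "(real \<times> 'r \<times> 'r) list" where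
  "LB = [(1, Q 0, 1), (1, Q 1, 1), (1, Q 2, 1), (1, Q 3, 1), (1, Q 4, 1), (4, G2, Q 0),
  (4, G2, B1 * Q 1), (4, F1, Q 1), (4, G2, B2 * Q 2), (4, F2, Q 2), (4, G2, B1 * (B2 * Q 3)),
  (4, F1, B2 * Q 3), (4, F2, Q 3), (4, N 1 2, Q 4)]"

lemma defect_nonneg: "\<forall>(c, E, w)\<in>set L. 0 \<le> c \<Longrightarrow> 0 \<le> defect L v"
  unfolding defect_def by (intro sum_list_nonneg) auto

text \<open>An identity for every \<open>v\<close>: nonnegative defects make the operators
  admissible Kraus operators, and small defects on the state make the missing weight small.\<close>

lemma WA_norm: "(\<Sum>i\<in>answers. (norm (WA i \<cdot> v))\<^sup>2) = (norm v)\<^sup>2 - defect LA v"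
proof -
  have "p01 + p23 + U4 = 1"
    using M_povm[of 0] by (simp add: povm_def p01_def p23_def U4_def answers_def sum.insert add.assoc)
  then have "v \<bullet> (p01 \<cdot> v) + v \<bullet> (p23 \<cdot> v) + v \<bullet> (U4 \<cdot> v) = (norm v)\<^sup>2"
    by (metis act_add act_one inner_add_right power2_norm_eq_inner)
  moreover note effect_norm[of p01 v] effect_norm[of p23 v] effect_norm[of U4 v]
    split_norm[of t13 "p01 \<cdot> v"] split_norm[of t13 "p23 \<cdot> v"]
    reflection_norm[of e1 "Kr 1 \<cdot> v"] reflection_norm[of e2 "Kr 2 \<cdot> v"]
    reflection_norm[of e1 "(a2 * Kr 3) \<cdot> v"] reflection_norm[of e2 "Kr 3 \<cdot> v"]
    reflection_norm[of "M 2 3" "Kr 4 \<cdot> v"]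
  ultimately show ?thesis
    unfolding defect_def LA_def
    by (simp add: answers_def sum.insert W_simps act_mult act_one Kr_simps
        flip: a1_def a2_def a4_def)
qed

lemma WB_norm: "(\<Sum>j\<in>answers. (norm (WB j \<cdot> v))\<^sup>2) = (norm v)\<^sup>2 - defect LB v"
proof -
  have "Q 0 + Q 1 + Q 2 + Q 3 + Q 4 = 1"
    using N_povm[of 0] by (simp add: povm_def Q_def answers_def sum.insert add.assoc)
  then have "v \<bullet> (Q 0 \<cdot> v) + v \<bullet> (Q 1 \<cdot> v) + v \<bullet> (Q 2 \<cdot> v) + v \<bullet> (Q 3 \<cdot> v) + v \<bullet> (Q 4 \<cdot> v) = (norm v)\<^sup>2"
    by (metis act_add act_one inner_add_right power2_norm_eq_inner)
  moreover note effect_norm[OF Q_eff[of 0], of v] effect_norm[OF Q_eff[of 1], of v]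
    effect_norm[OF Q_eff[of 2], of v] effect_norm[OF Q_eff[of 3], of v] effect_norm[OF Q_eff[of 4], of v]
    reflection_norm[of G2 "Q 0 \<cdot> v"] reflection_norm[of G2 "(B1 * Q 1) \<cdot> v"]
    reflection_norm[of F1 "Q 1 \<cdot> v"] reflection_norm[of G2 "(B2 * Q 2) \<cdot> v"]
    reflection_norm[of F2 "Q 2 \<cdot> v"] reflection_norm[of G2 "(B1 * (B2 * Q 3)) \<cdot> v"]
    reflection_norm[of F1 "(B2 * Q 3) \<cdot> v"] reflection_norm[of F2 "Q 3 \<cdot> v"]
    reflection_norm[of "N 1 2" "Q 4 \<cdot> v"]
  ultimately show ?thesis
    unfolding defect_def LB_def
    by (simp add: answers_def sum.insert W_simps act_mult act_one
        flip: B1_def B2_def J_def r4_def)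
qed

lemma mir_A: "mir \<B> 0 1" "mir \<B> 1 p01" "mir \<B> 1 p23" "i \<in> answers \<Longrightarrow> mir \<B> 4 (Kr i)" "mir \<B> 2 a2"
  "mir \<B> 6 (a2 * Kr 3)"
proof -
  show 1: "mir \<B> 4 (Kr i)" if "i \<in> answers" for i
    using that Kr_Q Q_bc by (intro mirI[of "Q i"]) (auto simp: bc_def)
  show 2: "mir \<B> 2 a2" using mirror_A(2) bc_B(2) by (intro mirI[of B2]) (auto simp: bc_def simp del: bc_B)
  show "mir \<B> 6 (a2 * Kr 3)" using swap.mir_mult[OF 2 1[of 3]] by simp
  show "mir \<B> 0 1" by (rule mirI[of 1]) simp_all
  show "mir \<B> 1 p01" "mir \<B> 1 p23"
    using match_00(1) match_00'(1)
    by (intro mirI[of "F 0 {0, 1}"] mirI[of "F 0 {2, 3}"] eff_contr F_eff F_mem; simp add: p01_def p23_def)+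
qed

lemma proj_A: "proj 1 p01" "proj 1 p23" "proj 1 U4" "proj 1 t13" "proj 1 e1" "proj 1 e2"
  unfolding p01_def p23_def t13_def e1_def e2_def U4_def
  using match_00(2) match_00'(2) match_00''(2) match_10''(2) match_01(2) match_11(2)
  by (simp_all add: E_single)

lemma small_commute: "q \<in> \<A> \<Longrightarrow> r \<in> \<B> \<Longrightarrow> small q r \<Longrightarrow> small r q"
  using commute[of q r] by (simp add: small_def)

lemma small_single: "x < 4 \<Longrightarrow> y < 3 \<Longrightarrow> a \<in> answers \<Longrightarrow> b \<in> answers \<Longrightarrow> loses x y a b \<Longrightarrow> small (M x a) (N y b)"
  using losing_small[of x y "{a}" "{b}"] by (simp add: E_single N_single)

lemma proj_G1: "proj 10 G1" and proj_G2: "proj 10 G2"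
proof -
  have c: "1 - F1 = F 1 {2, 3, 4}" "1 - F4 = F 2 {2, 3, 4}"
    unfolding F_defs by (simp_all add: povm_compl[OF N_povm] table)
  have m: "meet G1 (1 - F1) F2" "meet G2 F3 (1 - F4)"
    unfolding c unfolding G1_def G2_def F2_def F3_def by (rule povm_meet[OF N_povm]; simp add: answers_def)+
  have "ap 1 (1 - F1) (1 - e1)"
    using ap_diff[OF ap_refl[of 0 1] ap_sym[OF match_01(1)]] by (simp add: F1_def e1_def)
  then have "mir \<A> 1 (1 - F1)" by (intro mirI[of "1 - e1"]) (simp_all add: eff_contr eff_compl)
  then show "proj 10 G1"
    using m(1) F14_proj ok_F[THEN ok_mir] proj_compl by (intro meet_proj[OF m(1)]) simp_all
  show "proj 10 G2"
    using m(2) F14_mem F14_proj ok_F[THEN ok_mir] ok_compl_F4[THEN ok_mir] proj_compl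
    by (intro meet_proj[OF m(2)]) simp_all
qed

text \<open>Blocks 0 and 2 are common outcomes of two matched pairs, so \<open>meet_proj\<close>
  supplies the 10; the other blocks are matched directly.\<close>

lemma proj_Q: "i \<in> answers \<Longrightarrow> proj 10 (Q i)"
proof -
  have mm: "mir \<A> 1 (F 0 {0, 1})" "mir \<A> 1 (F 0 {0, 2})" "mir \<A> 1 (F 0 {2, 3})"
    using ok_matched(1)[OF _ _ _ _ match_00(1)] ok_matched(1)[OF _ _ _ _ match_10'(1)]
      ok_matched(1)[OF _ _ _ _ match_00'(1)] ok_mir by (simp_all add: answers_def)
  have "meet (Q 0) (F 0 {0, 1}) (F 0 {0, 2})" "meet (Q 2) (F 0 {2, 3}) (F 0 {0, 2})"
    unfolding F_single[symmetric] by (rule povm_meet[OF N_povm]; simp add: answers_def)+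
  then have "proj 10 (Q 0)" "proj 10 (Q 2)"
    using mm match_00(3) match_00'(3) match_10'(3) F_mem Q_mem by (auto intro!: meet_proj)
  note q = this
  have "proj 10 (Q 1)" "proj 10 (Q 3)" "proj 10 (Q 4)"
    using match_30''(3) match_20''(3) match_00''(3) proj_mono by (simp_all add: F_single)
  with q show "i \<in> answers \<Longrightarrow> proj 10 (Q i)" using answers_cases[of "\<lambda>i. proj 10 (Q i)" i] by simp
qed

text \<open>The answer e0 + e4 has no match, but only its defect on block 4 matters. It is small on
  \<open>G1 \<cdot> \<psi>\<close> by the correlation with h + e4 and h - e4, hence on
  \<open>Q 4 \<cdot> G1 \<cdot> \<psi>\<close>, hence on block 4: 21 = 7 + 13 + 1.\<close>

lemma defect_M23: "sn (M 2 3 - M 2 3 * M 2 3) (Kr 4 \<cdot> \<psi>) \<le> 21 * \<eta>"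
proof -
  define D where "D = M 2 3 - M 2 3 * M 2 3"
  have D: "eff D" "D \<in> \<A>" unfolding D_def by (rule defect_eff) simp_all
  have S: "M 2 3 + M 2 2 = S0" "N 1 2 + N 1 3 = G1"
    by (simp_all add: S0_def G1_def sum.insert add.commute)
  have eS: "eff S0" unfolding S0_def by (rule E_eff) simp_all
  have w: "norm ((1 - S0) \<cdot> \<psi> - F 0 {1, 2, 3} \<cdot> \<psi>) \<le> 1 * \<eta>"
  proof -
    have "1 - F 0 {0, 4} = F 0 {1, 2, 3}" by (simp add: povm_compl[OF N_povm] table)
    then have "ap 1 (1 - S0) (F 0 {1, 2, 3})"
      using ap_diff[OF ap_refl[of 0 1] match_20'(1)] by (simp add: S0_def)
    then show ?thesis by (simp add: ap_def act_diff)
  qed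
  have l: "small (M 2 a) (F 0 {1, 2, 3})" if "a \<in> {2, 3}" for a
    using losing_small[of 2 0 "{a}" "{1, 2, 3}"] that by (auto simp: table E_single)
  have "sn D ((N 1 2 + N 1 3) \<cdot> \<psi>) \<le> (2 + 2 * 1 + 2 * 1 + 1) * \<eta>"
    unfolding D_def
  proof (rule defect_on_correlated[where p = "M 2 2" and w = "F 0 {1, 2, 3} \<cdot> \<psi>"])
    show "small (M 2 3) (N 1 2)" "small (M 2 2) (N 1 3)"
      by (rule small_single; simp add: table)+
    show "proj 1 (M 2 3 + M 2 2)" using match_20'(2) by (simp add: S S0_def)
    show "norm ((1 - (M 2 3 + M 2 2)) \<cdot> \<psi> - F 0 {1, 2, 3} \<cdot> \<psi>) \<le> 1 * \<eta>" unfolding S by (rule w)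
    show "sn (M 2 3) (F 0 {1, 2, 3} \<cdot> \<psi>) \<le> 1 * \<eta>" "sn (M 2 2) (F 0 {1, 2, 3} \<cdot> \<psi>) \<le> 1 * \<eta>"
      using small_sn(1)[OF l] F_mem F_eff by simp_all
    show "eff (M 2 3 + M 2 2)" unfolding S by (rule eS)
  qed simp_all
  then have g: "sn D (G1 \<cdot> \<psi>) \<le> 7 * \<eta>" by (simp add: S)
  have "sn D (Q 4 \<cdot> G1 \<cdot> \<psi>) \<le> sn D (G1 \<cdot> \<psi>)"
    using D effD Q_simps(10) by (intro sn_commute) (auto simp: bc_def simp del: Q_simps)
  moreover have "norm (Q 4 \<cdot> \<psi> - Q 4 \<cdot> G1 \<cdot> \<psi>) \<le> 13 * \<eta>"
    using ap_sym[OF Q4_G(1)] by (simp add: ap_def act_diff act_mult)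
  moreover have "norm (U4 \<cdot> \<psi> - Q 4 \<cdot> \<psi>) \<le> 1 * \<eta>" using S_U_Q(5) by (simp add: ap_def act_diff)
  ultimately have "sn D (U4 \<cdot> \<psi>) \<le> 21 * \<eta>"
    using g sn_ap[OF D(1), of "U4 \<cdot> \<psi>" "Q 4 \<cdot> \<psi>"] sn_ap[OF D(1), of "Q 4 \<cdot> \<psi>" "Q 4 \<cdot> G1 \<cdot> \<psi>"]
    by fastforce
  then show ?thesis by (simp add: D_def Kr_simps)
qed

lemma defect_N12: "sn (N 1 2 - N 1 2 * N 1 2) (Q 4 \<cdot> \<psi>) \<le> 29 * \<eta>"
proof -
  define D where "D = N 1 2 - N 1 2 * N 1 2"
  have D: "eff D" "D \<in> \<B>" unfolding D_def by (rule defect_eff) simp_all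
  have S: "M 2 3 + M 2 2 = S0" "N 1 2 + N 1 3 = G1"
    by (simp_all add: S0_def G1_def sum.insert add.commute)
  \<comment> \<open>Stands for \<open>(1 - G1) \<cdot> \<psi>\<close>:
    \<open>1 - (1 - F1) * F2 = (1 - F2) + F1 * F2\<close> is carried to Alice's side. There the
    outer \<open>e2\<close> commutes with \<open>N 1 b\<close>, and answers 2 and 3 lose against
    \<open>1 - e2\<close> and \<open>e1\<close>.\<close>
  define w where "w = (1 - e2) \<cdot> \<psi> + e2 \<cdot> e1 \<cdot> \<psi>"
  have f: "ap 1 F1 e1" "ap 1 F2 e2"
    using ap_sym[OF match_01(1)] ap_sym[OF match_11(1)] by (simp_all add: F_defs e1_def e2_def)
  have w1: "norm ((1 - G1) \<cdot> \<psi> - w) \<le> 5 * \<eta>"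
  proof -
    have 1: "ap 2 (1 - G1) (1 - (1 - F1) * F2)"
      using ap_diff[OF ap_refl[of 0 1] ap_sym[OF G1_meet]] by simp
    have 2: "1 - (1 - F1) * F2 = (1 - F2) + F1 * F2" by (simp add: algebra_simps)
    have "ap 1 (F1 * F2) (F1 * e2)" by (intro ap_left f) simp
    also have "F1 * e2 = e2 * F1" by (rule mult_swap[symmetric]) simp_all
    also have "ap 1 (e2 * F1) (e2 * e1)" by (intro ap_left f) (simp add: eff_contr)
    finally have "ap 3 ((1 - F2) + F1 * F2) ((1 - e2) + e2 * e1)"
      using ap_add[OF ap_diff[OF ap_refl[of 0 1] f(2)]] by fastforce
    from ap_trans[OF 1[unfolded 2] this] show ?thesis by (simp add: ap_def w_def act_simps)
  qed
  have l: "sn (N 1 b) w \<le> 2 * \<eta>" if b: "b \<in> {2, 3}" for b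
  proof -
    have bb: "b \<in> answers" "N 1 b \<in> \<B>" "eff (N 1 b)" using b by auto
    have c: "1 - e2 = E 1 {1, 4}" unfolding e2_def by (simp add: povm_compl[OF M_povm] table)
    have "small (1 - e2) (N 1 b)" "small e1 (N 1 b)"
      unfolding c unfolding e1_def
      using losing_small[of 1 1 "{1, 4}" "{b}"] losing_small[of 0 1 "{1, 2}" "{b}"] b
      by (auto simp: table N_single)
    then have s: "sn (N 1 b) ((1 - e2) \<cdot> \<psi>) \<le> \<eta>" "sn (N 1 b) (e1 \<cdot> \<psi>) \<le> \<eta>"
      using small_sn(2)[of "1 - e2" "N 1 b"] small_sn(2)[of e1 "N 1 b"] bb by (simp_all add: eff_compl)
    have "sn (N 1 b) (e2 \<cdot> e1 \<cdot> \<psi>) \<le> sn (N 1 b) (e1 \<cdot> \<psi>)"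
      using bb effD by (intro swap.sn_commute) (simp_all add: eff_contr)
    then show ?thesis
      unfolding w_def using s sn_triangle[OF effD(1)[OF bb(3)], of "(1 - e2) \<cdot> \<psi>" "e2 \<cdot> e1 \<cdot> \<psi>"] by linarith
  qed
  have "sn D ((M 2 3 + M 2 2) \<cdot> \<psi>) \<le> (2 + 2 * 5 + 2 * 2 + 10) * \<eta>"
    unfolding D_def
  proof (rule swap.defect_on_correlated[where p = "N 1 3" and w = w])
    show "small (N 1 2) (M 2 3)" "small (N 1 3) (M 2 2)"
      by (rule small_commute[OF _ _ small_single]; simp add: table)+
    show "proj 10 (N 1 2 + N 1 3)" unfolding S by (rule proj_G1)
    show "norm ((1 - (N 1 2 + N 1 3)) \<cdot> \<psi> - w) \<le> 5 * \<eta>" unfolding S by (rule w1)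
    show "eff (N 1 2 + N 1 3)" unfolding S by simp
  qed (simp_all add: l)
  then have g: "sn D (S0 \<cdot> \<psi>) \<le> 26 * \<eta>" by (simp add: S)
  have "sn D (U4 \<cdot> S0 \<cdot> \<psi>) \<le> sn D (S0 \<cdot> \<psi>)"
    using D effD by (intro swap.sn_commute) simp_all
  moreover have "norm (U4 \<cdot> \<psi> - U4 \<cdot> S0 \<cdot> \<psi>) \<le> 2 * \<eta>"
  proof -
    have c: "1 - F 0 {0, 4} = F 0 {1, 2, 3}" by (simp add: povm_compl[OF N_povm] table)
    have "ap 1 (1 - S0) (F 0 {1, 2, 3})"
      using ap_diff[OF ap_refl[of 0 1] match_20'(1)] by (simp add: S0_def c)
    then have 1: "ap 1 (U4 * (1 - S0)) (U4 * F 0 {1, 2, 3})" by (intro ap_left) simp_all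
    have "small U4 (F 0 {1, 2, 3})"
      using losing_small[of 0 0 "{4}" "{1, 2, 3}"] by (simp add: table E_single U4_def)
    then have 2: "ap 1 (U4 * F 0 {1, 2, 3}) 0" using F_mem F_eff by (intro small_ap) simp_all
    show ?thesis using ap_trans[OF 1 2] by (simp add: ap_def act_simps)
  qed
  moreover have "norm (Q 4 \<cdot> \<psi> - U4 \<cdot> \<psi>) \<le> 1 * \<eta>" using ap_sym[OF S_U_Q(5)] by (simp add: ap_def act_diff)
  ultimately have "sn D (Q 4 \<cdot> \<psi>) \<le> 29 * \<eta>"
    using g sn_ap[OF D(1), of "Q 4 \<cdot> \<psi>" "U4 \<cdot> \<psi>"] sn_ap[OF D(1), of "U4 \<cdot> \<psi>" "U4 \<cdot> S0 \<cdot> \<psi>"]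
    by fastforce
  then show ?thesis by (simp add: D_def)
qed

lemma defect_A: "defect LA \<psi> \<le> 2300 * \<eta>\<^sup>2"
proof -
  note p = swap.proj_mir
  have "defect LA \<psi> \<le> (1 * (1 + 0)\<^sup>2 + (1 * (1 + 0)\<^sup>2 + (1 * (1 + 0)\<^sup>2 + (2 * (1 + 1)\<^sup>2 + (2 * (1 + 1)\<^sup>2 +
    (4 * (1 + 4)\<^sup>2 + (4 * (1 + 4)\<^sup>2 + (4 * (1 + 6)\<^sup>2 + (4 * (1 + 4)\<^sup>2 + (4 * 21\<^sup>2 + 0)))))))))) * \<eta>\<^sup>2"
    unfolding LA_def
    by (intro defect_Cons defect_Nil_le p proj_A mir_A defect_M23) simp_all
  also have "\<dots> \<le> 2300 * \<eta>\<^sup>2" by (intro mult_right_mono) simp_all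
  finally show ?thesis .
qed

lemma defect_B: "defect LB \<psi> \<le> 8000 * \<eta>\<^sup>2"
proof -
  have m: "mir \<A> 0 1" using ok_one ok_mir by blast
  have mQ: "mir \<A> 2 (Q i)" if "i \<in> answers" for i using ok_Q[OF that] ok_mir by blast
  have m': "mir \<A> 4 (B1 * Q 1)" "mir \<A> 4 (B2 * Q 2)" "mir \<A> 4 (B2 * Q 3)" "mir \<A> 6 (B1 * (B2 * Q 3))"
    using ok_mult[OF ok_B(1) Q_simps(2)] ok_mult[OF ok_B(2) Q_simps(3)] ok_mult[OF ok_B(2) Q_simps(4)]
      ok_mult[OF ok_B(1) ok_mult[OF ok_B(2) Q_simps(4)]] ok_mir by simp_all
  have "defect LB \<psi> \<le> (1 * (10 + 0)\<^sup>2 + (1 * (10 + 0)\<^sup>2 + (1 * (10 + 0)\<^sup>2 + (1 * (10 + 0)\<^sup>2 + (1 * (10 + 0)\<^sup>2 +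
    (4 * (10 + 2)\<^sup>2 + (4 * (10 + 4)\<^sup>2 + (4 * (1 + 2)\<^sup>2 + (4 * (10 + 4)\<^sup>2 + (4 * (1 + 2)\<^sup>2 +
    (4 * (10 + 6)\<^sup>2 + (4 * (1 + 4)\<^sup>2 + (4 * (1 + 2)\<^sup>2 + (4 * 29\<^sup>2 + 0)))))))))))))) * \<eta>\<^sup>2"
    unfolding LB_def
    by (intro defect_Cons defect_Nil_le proj_mir proj_Q proj_G2 F14_proj m mQ m' defect_N12)
       (simp_all add: Q_mem Q_eff)
  also have "\<dots> \<le> 8000 * \<eta>\<^sup>2" by (intro mult_right_mono) simp_all
  finally show ?thesis .
qed

theorem extraction:
  assumes coef: "r = (\<lambda>i. if i = 4 then 1 / sqrt 17 else 2 / sqrt 17)"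
  shows "\<exists>W W'. (\<forall>i\<in>answers. W i \<in> \<A> \<and> W' i \<in> \<B>)
    \<and> (\<forall>v. (\<Sum>i\<in>answers. (norm (W i \<cdot> v))\<^sup>2) \<le> (norm v)\<^sup>2)
    \<and> (\<forall>v. (\<Sum>i\<in>answers. (norm (W' i \<cdot> v))\<^sup>2) \<le> (norm v)\<^sup>2)
    \<and> 1 - 10^9 * \<eta>\<^sup>2 \<le> (norm (\<Sum>i\<in>answers. r i *\<^sub>R ((W i * W' i) \<cdot> \<psi>)))\<^sup>2"
proof -
  define v where "v i j = (WA i * WB j) \<cdot> \<psi>" for i j
  \<comment> \<open>Normalized so that \<open>r i *\<^sub>R z\<close> is \<open>v 0 0\<close> for
    the first four blocks and half of it for the fifth.\<close>
  define z where "z = (sqrt 17 / 2) *\<^sub>R v 0 0"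
  have rc: "r i *\<^sub>R z = coef i *\<^sub>R v 0 0" for i
    by (simp add: assms z_def coef_def)
  have one: "(\<Sum>i\<in>answers. (r i)\<^sup>2) = 1"
    by (simp add: answers_def sum.insert assms power_divide)
  have e: "(norm (v i j - (if i = j then r i *\<^sub>R z else 0)))\<^sup>2 \<le> (3800 * \<eta>)\<^sup>2"
    if "i \<in> answers" "j \<in> answers" for i j
  proof (intro power_mono)
    show "norm (v i j - (if i = j then r i *\<^sub>R z else 0)) \<le> 3800 * \<eta>"
    proof (cases "i = j")
      case True
      then show ?thesis
        using W_diagonal[OF that(1)] by (simp add: ap_def v_def rc act_diff act_scale)
    next
      case False
      then show ?thesis
        using ap_mono[OF W_off_diagonal[OF that False], of 3800] by (simp add: ap_def v_def)
    qed
  qed simp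
  have "(\<Sum>i\<in>answers. \<Sum>j\<in>answers. (norm (v i j - (if i = j then r i *\<^sub>R z else 0)))\<^sup>2)
      \<le> (\<Sum>i\<in>answers. \<Sum>j\<in>answers. (3800 * \<eta>)\<^sup>2)"
    by (intro sum_mono e)
  also have "\<dots> = 361000000 * \<eta>\<^sup>2"
    by (simp add: answers_def sum.insert power_mult_distrib)
  finally have err: "(\<Sum>i\<in>answers. \<Sum>j\<in>answers. (norm (v i j - (if i = j then r i *\<^sub>R z else 0)))\<^sup>2)
      \<le> 361000000 * \<eta>\<^sup>2" .
  have LA: "\<forall>(c, E, w)\<in>set LA. 0 \<le> c \<and> E \<in> \<A> \<and> eff E \<and> w \<in> \<A>"
    by (auto simp: LA_def)
  have LB: "\<forall>(c, E, w)\<in>set LB. 0 \<le> c" by (auto simp: LB_def)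
  \<comment> \<open>Bob's loss is paid once, Alice's once for each of his five operators.\<close>
  have "1 - 8000 * \<eta>\<^sup>2 - 5 * (2300 * \<eta>\<^sup>2) \<le> (\<Sum>j\<in>answers. (norm (WB j \<cdot> \<psi>))\<^sup>2) - 5 * defect LA \<psi>"
    using defect_A defect_B by (simp add: WB_norm norm_psi)
  also have "\<dots> = (\<Sum>j\<in>answers. (norm (WB j \<cdot> \<psi>))\<^sup>2 - defect LA \<psi>)"
    by (simp add: sum_subtractf answers_def)
  also have "\<dots> \<le> (\<Sum>j\<in>answers. \<Sum>i\<in>answers. (norm (v i j))\<^sup>2)"
  proof (rule sum_mono)
    fix j assume j: "j \<in> answers"
    have "defect LA (WB j \<cdot> \<psi>) \<le> defect LA \<psi>"
      using WB_bc[OF j] by (intro defect_commute LA) (simp_all add: bc_def)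
    then show "(norm (WB j \<cdot> \<psi>))\<^sup>2 - defect LA \<psi> \<le> (\<Sum>i\<in>answers. (norm (v i j))\<^sup>2)"
      using WA_norm[of "WB j \<cdot> \<psi>"] by (simp add: v_def act_mult)
  qed
  also have "\<dots> = (\<Sum>i\<in>answers. \<Sum>j\<in>answers. (norm (v i j))\<^sup>2)" by (rule sum.swap)
  finally have "1 - 19500 * \<eta>\<^sup>2 \<le> \<dots>" by simp
  with err fidelity_bound[OF finite_answers one, of v z]
  have "1 - 361019500 * \<eta>\<^sup>2 \<le> (norm (\<Sum>i\<in>answers. r i *\<^sub>R v i i))\<^sup>2" by linarith
  moreover have "361019500 * \<eta>\<^sup>2 \<le> 10^9 * \<eta>\<^sup>2" by (intro mult_right_mono) simp_all
  ultimately have "1 - 10^9 * \<eta>\<^sup>2 \<le> (norm (\<Sum>i\<in>answers. r i *\<^sub>R v i i))\<^sup>2" by linarith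
  moreover have "0 \<le> defect LA u" "0 \<le> defect LB u" for u
    using LA LB by (auto intro!: defect_nonneg)
  ultimately show ?thesis
    using WA_norm WB_norm bc_mem
    by (intro exI[of _ WA] exI[of _ WB]) (simp add: v_def)
qed

end

section \<open>Positive matrices and tensor products\<close>

lemma dagger_mult: "dagger (A ** B) = dagger B ** dagger A"
  by (simp add: dagger_def matrix_matrix_mult_def vec_eq_iff mult.commute)

lemma dagger_dagger [simp]: "dagger (dagger A) = A"
  by (simp add: dagger_def vec_eq_iff)

lemma dagger_add: "dagger (A + B) = dagger A + dagger B"
  by (simp add: dagger_def vec_eq_iff)

lemma dagger_diff: "dagger (A - B) = dagger A - dagger B"
  by (simp add: dagger_def vec_eq_iff)

lemma dagger_sum: "dagger (\<Sum>i\<in>I. A i) = (\<Sum>i\<in>I. dagger (A i))"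
  by (induction I rule: infinite_finite_induct) (auto simp: dagger_add, auto simp: dagger_def vec_eq_iff)

lemma dagger_one [simp]: "dagger (mat 1) = mat 1"
  by (auto simp: dagger_def mat_def vec_eq_iff)

lemma cinner_adjoint: "cinner x (A *v y) = cinner (dagger A *v x) y"
proof -
  have "cinner x (A *v y) = (\<Sum>i\<in>UNIV. \<Sum>j\<in>UNIV. cnj (x $ i) * A $ i $ j * y $ j)"
    by (simp add: cinner_def matrix_vector_mult_def sum_distrib_left mult.assoc)
  also have "\<dots> = (\<Sum>j\<in>UNIV. \<Sum>i\<in>UNIV. cnj (x $ i) * A $ i $ j * y $ j)" by (rule sum.swap)
  also have "\<dots> = cinner (dagger A *v x) y"
    by (simp add: cinner_def dagger_def matrix_vector_mult_def sum_distrib_right sum_distrib_left mult_ac)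
  finally show ?thesis .
qed

lemma cinner_add_right: "cinner x (y + z) = cinner x y + cinner x z"
  and cinner_diff_right: "cinner x (y - z) = cinner x y - cinner x z"
  and cinner_add_left: "cinner (x + y) z = cinner x z + cinner y z"
  by (simp_all add: cinner_def algebra_simps sum.distrib sum_subtractf)

lemma cinner_scale_right: "cinner x (c *s y) = c * cinner x y"
  and cinner_scale_left: "cinner (c *s x) y = cnj c * cinner x y"
  by (simp_all add: cinner_def sum_distrib_left algebra_simps)

lemma cinner_commute: "cinner x y = cnj (cinner y x)"
  by (simp add: cinner_def mult.commute)

lemma cinner_axis_left: "cinner (axis i 1) x = x $ i"
proof -
  have "cinner (axis i 1) x = (\<Sum>j\<in>UNIV. if j = i then x $ j else 0)"
    unfolding cinner_def axis_def by (intro sum.cong) auto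
  then show ?thesis by simp
qed

lemma mult_axis: "(A *v axis i 1) $ p = (A $ p $ i :: complex)"
  by (simp add: matrix_vector_mult_def axis_def if_distrib cong: if_cong)

lemma cnj_mult_self: "cnj z * z = of_real ((cmod z)\<^sup>2)"
  by (subst complex_norm_square) (rule mult.commute)

lemma mult_scale_vec: "A *v (c *s x) = c *s (A *v (x :: complex^'n))"
  by (simp add: matrix_vector_mult_def vec_eq_iff sum_distrib_left algebra_simps)

lemma psd_hermitian: "psd A \<Longrightarrow> A $ q $ p = cnj (A $ p $ q)"
  by (auto simp: psd_def dagger_def vec_eq_iff)

lemma psd_form: "psd A \<Longrightarrow> 0 \<le> Re (cinner x (A *v x))"
  by (simp add: psd_def)

lemma psd_pair:
  assumes "psd A"
  shows "0 \<le> Re (cinner x (A *v x)) + 2 * Re (cnj c * (A *v x) $ i) + (cmod c)\<^sup>2 * Re (A $ i $ i)"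
proof -
  have d: "dagger A = A" using assms by (simp add: psd_def)
  have 1: "cinner (axis i 1) (A *v x) = (A *v x) $ i" by (rule cinner_axis_left)
  have "cinner x (A *v axis i 1) = cinner (A *v x) (axis i 1)"
    using cinner_adjoint[of x A] by (simp add: d)
  then have 2: "cinner x (A *v axis i 1) = cnj ((A *v x) $ i)"
    by (simp add: cinner_commute[of "A *v x"] cinner_axis_left)
  have 3: "cinner (axis i 1) (A *v axis i 1) = A $ i $ i" by (simp add: cinner_axis_left mult_axis)
  have "cinner (x + c *s axis i 1) (A *v (x + c *s axis i 1)) =
      cinner x (A *v x) + c * cnj ((A *v x) $ i) + cnj c * (A *v x) $ i + cnj c * c * A $ i $ i"
    by (simp add: matrix_vector_right_distrib mult_scale_vec cinner_add_left cinner_add_right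
        cinner_scale_left cinner_scale_right 1 2 3 algebra_simps)
  then have "Re (cinner (x + c *s axis i 1) (A *v (x + c *s axis i 1))) =
      Re (cinner x (A *v x)) + Re (c * cnj ((A *v x) $ i)) + Re (cnj c * (A *v x) $ i)
      + Re (cnj c * c * A $ i $ i)"
    by (simp only: plus_complex.sel)
  moreover have "Re (c * cnj ((A *v x) $ i)) = Re (cnj c * (A *v x) $ i)" by simp
  moreover have "Re (cnj c * c * A $ i $ i) = (cmod c)\<^sup>2 * Re (A $ i $ i)"
    by (simp only: cnj_mult_self) simp
  ultimately show ?thesis
    using psd_form[OF assms, of "x + c *s axis i 1"] by linarith
qed

lemma psd_diag: "psd A \<Longrightarrow> 0 \<le> Re (A $ i $ i)" "psd A \<Longrightarrow> Im (A $ i $ i) = 0"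
  using psd_form[of A "axis i 1"] psd_hermitian[of A i i]
  by (auto simp: cinner_axis_left mult_axis complex_eq_iff)

lemma psd_row_zero:
  assumes "psd A" "A $ i $ i = 0"
  shows "A $ i $ p = 0"
proof (rule ccontr)
  assume nz: "A $ i $ p \<noteq> 0"
  let ?z = "A $ i $ p" and ?a = "Re (A $ p $ p)"
  \<comment> \<open>Makes the quadratic form equal to \<open>-1\<close>.\<close>
  define t where "t = (?a + 1) / (2 * (cmod ?z)\<^sup>2)"
  have n: "(cmod ?z)\<^sup>2 > 0" using nz by simp
  have "0 \<le> Re (cinner (axis p 1) (A *v axis p 1)) + 2 * Re (cnj (- of_real t * ?z) * (A *v axis p 1) $ i)
      + (cmod (- of_real t * ?z))\<^sup>2 * Re (A $ i $ i)"
    by (rule psd_pair[OF assms(1)])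
  also have "\<dots> = ?a - 2 * t * (cmod ?z)\<^sup>2"
    using arg_cong[OF cnj_mult_self[of ?z], of Re]
    by (simp add: cinner_axis_left mult_axis assms(2) algebra_simps)
  also have "\<dots> = - 1" using n by (simp add: t_def field_simps)
  finally show False by simp
qed

text \<open>One Cholesky step: subtracting the rank-one matrix of the normalized column
  \<open>i\<close> clears row \<open>i\<close>, keeps rows that are already zero, and preserves
  positivity.\<close>

lemma psd_schur:
  assumes "psd A" "A $ i $ i \<noteq> 0"
  defines "v \<equiv> (\<chi> p. A $ p $ i / of_real (sqrt (Re (A $ i $ i))))"
  shows "psd (A - (\<chi> p q. v $ p * cnj (v $ q)))"
    and "(A - (\<chi> p q. v $ p * cnj (v $ q))) $ i $ q = 0"
    and "(\<And>j. A $ j $ q = 0) \<Longrightarrow> (A - (\<chi> p q. v $ p * cnj (v $ q))) $ j $ q = 0"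
    and "A $ j = 0 \<Longrightarrow> (A - (\<chi> p q. v $ p * cnj (v $ q))) $ j = 0"
proof -
  let ?a = "Re (A $ i $ i)" and ?V = "\<chi> p q. v $ p * cnj (v $ q)"
  have aR: "A $ i $ i = of_real ?a" using psd_diag(2)[OF assms(1)] by (simp add: complex_eq_iff)
  have a0: "?a > 0" using psd_diag(1)[OF assms(1), of i] assms(2) aR by (metis of_real_0 order_le_less)
  have sq: "of_real (sqrt ?a) * of_real (sqrt ?a) = A $ i $ i"
    using a0 by (subst aR) (simp flip: of_real_mult)
  have V: "?V $ p $ q = A $ p $ i * A $ i $ q / A $ i $ i" for p q
    using psd_hermitian[OF assms(1), of q i] sq by (simp add: v_def)
  show "(A - ?V) $ i $ q = 0"
    using assms(2) by (simp only: vector_minus_component V) simp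
  show "(\<And>j. A $ j $ q = 0) \<Longrightarrow> (A - ?V) $ j $ q = 0" by (simp only: vector_minus_component V) simp
  show "(A - ?V) $ j = 0" if j: "A $ j = 0"
  proof -
    have "(A - ?V) $ j $ q = 0" for q by (simp only: vector_minus_component V) (simp add: j)
    then show ?thesis by (simp only: vec_eq_iff[of "(A - ?V) $ j"] zero_index) blast
  qed
  show "psd (A - ?V)" unfolding psd_def
  proof (intro conjI allI)
    have "dagger ?V = ?V" by (simp add: dagger_def vec_eq_iff mult.commute)
    then show "dagger (A - ?V) = A - ?V" using assms(1) by (simp add: dagger_diff psd_def)
    fix x
    have Vx: "?V *v x = cinner v x *s v"
      by (simp add: matrix_vector_mult_def cinner_def vec_eq_iff sum_distrib_right sum_distrib_left mult_ac)
    have vx: "cinner v x = (A *v x) $ i / of_real (sqrt ?a)"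
      using psd_hermitian[OF assms(1), of i, symmetric]
      by (simp add: cinner_def v_def matrix_vector_mult_def sum_divide_distrib)
    have "cinner x (?V *v x) = cinner v x * cnj (cinner v x)"
      unfolding Vx cinner_scale_right using cinner_commute[of x v] by simp
    then have "cinner x (?V *v x) = of_real ((cmod (cinner v x))\<^sup>2)"
      by (simp only: complex_norm_square)
    then have 1: "Re (cinner x (?V *v x)) = (cmod ((A *v x) $ i))\<^sup>2 / ?a"
      using a0 by (simp add: vx norm_divide power_divide)
    \<comment> \<open>The minimizer of the quadratic of \<open>psd_pair\<close>; its minimum is the
      form of the Schur complement.\<close>
    define c where "c = - ((A *v x) $ i) / of_real ?a"
    have "0 \<le> Re (cinner x (A *v x)) + 2 * Re (cnj c * (A *v x) $ i) + (cmod c)\<^sup>2 * ?a"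
      by (rule psd_pair[OF assms(1)])
    moreover have "Re (cnj c * (A *v x) $ i) = - ((cmod ((A *v x) $ i))\<^sup>2 / ?a)"
    proof -
      have "cnj c * (A *v x) $ i = - (cnj ((A *v x) $ i) * (A *v x) $ i) / of_real ?a"
        by (simp add: c_def)
      then show ?thesis unfolding cnj_mult_self by simp
    qed
    moreover have "(cmod c)\<^sup>2 * ?a = (cmod ((A *v x) $ i))\<^sup>2 / ?a"
      using a0 by (simp add: c_def norm_divide power_divide power2_eq_square)
    ultimately have "(cmod ((A *v x) $ i))\<^sup>2 / ?a \<le> Re (cinner x (A *v x))" by linarith
    then show "0 \<le> Re (cinner x ((A - ?V) *v x))"
      using 1 by (simp add: matrix_vector_mult_diff_rdistrib cinner_diff_right)
  qed
qed

text \<open>Cholesky elimination, with \<open>S\<close> containing the indices of all rows that may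
  still be nonzero. A zero pivot forces its whole row to vanish.\<close>

lemma psd_sum_rank_one:
  assumes "finite S"
  shows "psd A \<Longrightarrow> (\<forall>i. i \<notin> S \<longrightarrow> A $ i = 0) \<Longrightarrow> \<exists>v. A = (\<chi> p q. \<Sum>i\<in>S. v i $ p * cnj (v i $ q))"
  using assms
proof (induction S arbitrary: A rule: finite_induct)
  case empty
  then have "A = 0" by (simp add: vec_eq_iff)
  then show ?case by (simp add: vec_eq_iff)
next
  case (insert i S)
  show ?case
  proof (cases "A $ i $ i = 0")
    case True
    then have "A $ i = 0" using psd_row_zero[OF insert.prems(1)] by (simp add: vec_eq_iff)
    then have "\<forall>j. j \<notin> S \<longrightarrow> A $ j = 0" using insert.prems(2) by (metis insert_iff)
    then obtain v where v: "A = (\<chi> p q. \<Sum>i\<in>S. v i $ p * cnj (v i $ q))"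
      using insert.IH[OF insert.prems(1)] by blast
    have "A = (\<chi> p q. \<Sum>j\<in>insert i S. (if j = i then 0 else v j) $ p * cnj ((if j = i then 0 else v j) $ q))"
      using insert.hyps by (subst v) (auto simp: vec_eq_iff intro!: sum.cong)
    then show ?thesis by (rule exI[where P = "\<lambda>v. A = (\<chi> p q. \<Sum>i\<in>insert i S. v i $ p * cnj (v i $ q))"])
  next
    case False
    define u where "u = (\<chi> p. A $ p $ i / of_real (sqrt (Re (A $ i $ i))))"
    let ?B = "A - (\<chi> p q. u $ p * cnj (u $ q))"
    note s = psd_schur[OF insert.prems(1) False, folded u_def]
    have "?B $ j = 0" if "j \<notin> S" for j
    proof (cases "j = i")
      case True
      then show ?thesis using s(2) by (simp only: vec_eq_iff zero_index) blast
    next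
      case False
      then show ?thesis using s(4) insert.prems(2) that by blast
    qed
    then obtain v where v: "?B = (\<chi> p q. \<Sum>i\<in>S. v i $ p * cnj (v i $ q))"
      using insert.IH[OF s(1)] by blast
    have A: "A $ p $ q = u $ p * cnj (u $ q) + (\<Sum>j\<in>S. v j $ p * cnj (v j $ q))" for p q
      using arg_cong[OF v, of "\<lambda>M. M $ p $ q"] by (simp add: algebra_simps)
    have c: "(\<Sum>j\<in>S. v j $ p * cnj (v j $ q))
        = (\<Sum>j\<in>S. (if j = i then u else v j) $ p * cnj ((if j = i then u else v j) $ q))" for p q
      using insert.hyps by (intro sum.cong) auto
    have "A = (\<chi> p q. \<Sum>j\<in>insert i S. (if j = i then u else v j) $ p * cnj ((if j = i then u else v j) $ q))"
      using insert.hyps A c by (simp add: vec_eq_iff)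
    then show ?thesis by (rule exI[where P = "\<lambda>v. A = (\<chi> p q. \<Sum>i\<in>insert i S. v i $ p * cnj (v i $ q))"])
  qed
qed

lemma psd_factor:
  fixes A :: "complex^'n^'n"
  assumes "psd A"
  obtains f where "A = dagger f ** f"
proof -
  have "\<exists>v. A = (\<chi> p q. \<Sum>i\<in>(UNIV :: 'n set). v i $ p * cnj (v i $ q))"
    using assms by (intro psd_sum_rank_one) simp_all
  then obtain v where "A = (\<chi> p q. \<Sum>i\<in>(UNIV :: 'n set). v i $ p * cnj (v i $ q))" by (rule exE)
  then have "A = dagger (\<chi> i q. cnj (v i $ q)) ** (\<chi> i q. cnj (v i $ q))"
    by (simp add: dagger_def matrix_matrix_mult_def)
  then show ?thesis by (rule that)
qed

lemma inner_matrix: "(A :: complex^'n^'n) \<bullet> B = Re (trace (dagger A ** B))"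
proof -
  have "A \<bullet> B = (\<Sum>i\<in>UNIV. \<Sum>j\<in>UNIV. Re (cnj (A $ i $ j) * B $ i $ j))"
    by (simp add: inner_vec_def inner_complex_def)
  also have "\<dots> = (\<Sum>j\<in>UNIV. \<Sum>i\<in>UNIV. Re (cnj (A $ i $ j) * B $ i $ j))" by (rule sum.swap)
  also have "\<dots> = Re (trace (dagger A ** B))"
    by (simp add: trace_def dagger_def matrix_matrix_mult_def)
  finally show ?thesis .
qed

lemma norm_matrix: "(norm (A :: complex^'n^'n))\<^sup>2 = Re (trace (dagger A ** A))"
  by (simp add: power2_norm_eq_inner inner_matrix)

lemma inner_dagger_shift: "u \<bullet> (S ** v) = (dagger S ** u) \<bullet> (v :: complex^'n^'n)"
  by (simp add: inner_matrix dagger_mult matrix_mul_assoc)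

lemma hermitian_iff:
  "dagger S = S \<longleftrightarrow> (\<forall>u v :: complex^'n^'n. u \<bullet> (S ** v) = (S ** u) \<bullet> v)"
proof
  assume *: "\<forall>u v :: complex^'n^'n. u \<bullet> (S ** v) = (S ** u) \<bullet> v"
  let ?D = "dagger S - S"
  have "(?D ** mat 1) \<bullet> ?D = 0"
    using *[rule_format, of "mat 1" ?D] inner_dagger_shift[of "mat 1" S ?D]
    by (simp add: inner_diff_left)
  then show "dagger S = S" by simp
qed (simp add: inner_dagger_shift)

text \<open>Puts \<open>x\<close> in one arbitrary column, so that positivity can be tested on matrices, which carry the
  inner product \<open>Re (trace (dagger A ** B))\<close>.\<close>

definition column_matrix :: "complex^'n \<Rightarrow> complex^'n^'n" where
  "column_matrix x = (\<chi> p q. if q = undefined then x $ p else 0)"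

lemma column_matrix_mult: "S ** column_matrix x = column_matrix (S *v x)"
  by (auto simp: column_matrix_def matrix_matrix_mult_def matrix_vector_mult_def vec_eq_iff)

lemma column_matrix_inner: "column_matrix x \<bullet> column_matrix y = Re (cinner x y)" for x y :: "complex^'n"
proof -
  have "column_matrix x $ p $ q \<bullet> column_matrix y $ p $ q
      = (if q = undefined then Re (cnj (x $ p) * y $ p) else 0)" for p q
    by (simp add: column_matrix_def inner_complex_def)
  then have "column_matrix x \<bullet> column_matrix y
      = (\<Sum>p\<in>UNIV. \<Sum>q\<in>(UNIV :: 'n set). if q = undefined then Re (cnj (x $ p) * y $ p) else 0)"
    by (simp only: inner_vec_def)
  then show ?thesis by (simp add: cinner_def)
qed

lemma psd_iff:
  fixes S :: "complex^'n^'n"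
  shows "psd S \<longleftrightarrow> dagger S = S \<and> (\<forall>v :: complex^'n^'n. 0 \<le> v \<bullet> (S ** v))"
proof
  assume "psd S"
  then obtain f where f: "S = dagger f ** f" by (rule psd_factor)
  have "v \<bullet> (S ** v) = (norm (f ** v))\<^sup>2" for v :: "complex^'n^'n"
    using inner_dagger_shift[of v "dagger f" "f ** v"]
    by (simp add: f power2_norm_eq_inner matrix_mul_assoc)
  then show "dagger S = S \<and> (\<forall>v :: complex^'n^'n. 0 \<le> v \<bullet> (S ** v))"
    using \<open>psd S\<close> by (simp add: psd_def)
next
  assume *: "dagger S = S \<and> (\<forall>v :: complex^'n^'n. 0 \<le> v \<bullet> (S ** v))"
  then have "0 \<le> Re (cinner x (S *v x))" for x
    using column_matrix_mult[of S x] column_matrix_inner[of x "S *v x"] by metis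
  with * show "psd S" by (simp add: psd_def)
qed

lemma sum_pairs: "(\<Sum>r\<in>UNIV. f r) = (\<Sum>i\<in>UNIV. \<Sum>j\<in>UNIV. f (i, j))"
  for f :: "'a::finite \<times> 'b::finite \<Rightarrow> 'c::comm_monoid_add"
  by (simp add: sum.cartesian_product flip: UNIV_Times_UNIV)

lemma kron_mult: "kron A B ** kron C D = kron (A ** C) (B ** D)"
proof -
  have "(\<Sum>r\<in>UNIV. A $ fst p $ fst r * B $ snd p $ snd r * (C $ fst r $ fst q * D $ snd r $ snd q))
      = (\<Sum>i\<in>UNIV. A $ fst p $ i * C $ i $ fst q) * (\<Sum>j\<in>UNIV. B $ snd p $ j * D $ j $ snd q)" for p q
    by (simp add: sum_product sum.cartesian_product mult_ac case_prod_beta flip: UNIV_Times_UNIV)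
  then show ?thesis by (simp add: kron_def matrix_matrix_mult_def vec_eq_iff)
qed

lemma kron_dagger: "dagger (kron A B) = kron (dagger A) (dagger B)"
  by (simp add: kron_def dagger_def vec_eq_iff)

lemma kron_one: "kron (mat 1) (mat 1) = mat 1"
  by (auto simp: kron_def mat_def vec_eq_iff prod_eq_iff)

lemma kron_add_left: "kron (A + B) C = kron A C + kron B C"
  and kron_add_right: "kron C' (A' + B') = kron C' A' + kron C' B'"
  by (simp_all add: kron_def vec_eq_iff algebra_simps)

lemma kron_diff_left: "kron (A - B) C = kron A C - kron B C"
  and kron_diff_right: "kron C' (A' - B') = kron C' A' - kron C' B'"
  by (simp_all add: kron_def vec_eq_iff algebra_simps)

lemma kron_scale_left: "kron (c *\<^sub>R A) B = c *\<^sub>R kron A B"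
  and kron_scale_right: "kron A (c *\<^sub>R B) = c *\<^sub>R kron A B"
  by (simp_all add: kron_def vec_eq_iff)

lemma kron_sum_left: "kron (\<Sum>i\<in>I. A i) C = (\<Sum>i\<in>I. kron (A i) C)"
  by (induction I rule: infinite_finite_induct) (auto simp: kron_add_left, auto simp: kron_def vec_eq_iff)

lemma kron_sum_right: "kron C (\<Sum>i\<in>I. A i) = (\<Sum>i\<in>I. kron C (A i))"
  by (induction I rule: infinite_finite_induct) (auto simp: kron_add_right, auto simp: kron_def vec_eq_iff)

lemma kron_inj: "kron A (mat 1) = kron B (mat 1) \<Longrightarrow> A = B" "kron (mat 1) C = kron (mat 1) D \<Longrightarrow> C = D"
proof -
  assume *: "kron A (mat 1) = kron B (mat 1)"
  show "A = B"
    using arg_cong[OF *, of "\<lambda>M. M $ (p, undefined) $ (q, undefined)" for p q]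
    by (simp add: kron_def mat_def vec_eq_iff)
next
  assume *: "kron (mat 1) C = kron (mat 1) D"
  show "C = D"
    using arg_cong[OF *, of "\<lambda>M. M $ (undefined, p) $ (undefined, q)" for p q]
    by (simp add: kron_def mat_def vec_eq_iff)
qed

lemma norm_gram: "v \<bullet> ((dagger f ** f) ** v) = (norm (f ** v))\<^sup>2" for v :: "complex^'n^'n"
  using inner_dagger_shift[of v "dagger f" "f ** v"]
  by (simp add: power2_norm_eq_inner matrix_mul_assoc)

lemma psd_gram: "psd (dagger f ** f)"
  by (simp add: psd_iff norm_gram dagger_mult)

lemma psd_kron:
  assumes "psd A" "psd B"
  shows "psd (kron A B)"
proof -
  obtain f g where "A = dagger f ** f" "B = dagger g ** g" using assms psd_factor by metis
  then have "kron A B = dagger (kron f g) ** kron f g" by (simp add: kron_mult kron_dagger)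
  then show ?thesis by (simp add: psd_gram)
qed

lemma psd_one: "psd (mat 1)"
  using psd_gram[of "mat 1"] by simp

text \<open>Positivity of \<open>A\<close> is tested on vectors concentrated at the single index
  \<open>undefined\<close> of the second factor.\<close>

lemma psd_kron_left_iff: "psd (kron A (mat 1)) \<Longrightarrow> psd A"
proof -
  assume p: "psd (kron A (mat 1 :: complex^'b^'b) :: complex^('a \<times> 'b)^('a \<times> 'b))"
  have "kron (dagger A) (mat 1 :: complex^'b^'b) = kron A (mat 1)"
    using p by (simp add: psd_def kron_dagger)
  then have "dagger A = A" by (rule kron_inj(1))
  moreover have "0 \<le> Re (cinner x (A *v x))" for x
  proof -
    let ?w = "\<chi> r :: 'a \<times> 'b. if snd r = undefined then x $ fst r else 0"
    have k: "(kron A (mat 1 :: complex^'b^'b) *v ?w) $ r = (if snd r = undefined then (A *v x) $ fst r else 0)" for r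
    proof -
      have "(kron A (mat 1 :: complex^'b^'b) *v ?w) $ r
        = (\<Sum>i\<in>UNIV. \<Sum>j\<in>UNIV. if j = snd r then (if j = undefined then A $ fst r $ i * x $ i else 0) else 0)"
        unfolding matrix_vector_mult_def kron_def mat_def
        by (simp only: sum_pairs vec_lambda_beta fst_conv snd_conv) (intro sum.cong refl, auto)
      then show ?thesis by (simp add: matrix_vector_mult_def)
    qed
    have "cinner ?w (kron A (mat 1 :: complex^'b^'b) *v ?w)
      = (\<Sum>r\<in>(UNIV :: ('a \<times> 'b) set). if snd r = undefined then cnj (x $ fst r) * (A *v x) $ fst r else 0)"
      unfolding cinner_def k by (intro sum.cong refl) simp
    also have "\<dots> = (\<Sum>i\<in>UNIV. \<Sum>j\<in>(UNIV :: 'b set). if j = undefined then cnj (x $ i) * (A *v x) $ i else 0)"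
      by (simp add: sum_pairs)
    also have "\<dots> = cinner x (A *v x)" by (simp add: cinner_def)
    finally show ?thesis using psd_form[OF p, of ?w] by simp
  qed
  ultimately show "psd A" by (simp add: psd_def)
qed

section \<open>Purified strategies\<close>

lemma matrix_distrib_left: "A ** (B + C) = A ** B + A ** (C :: complex^'n^'m)"
  and matrix_distrib_right: "(D + E) ** F = D ** F + E ** (F :: complex^'p^'q)"
  and matrix_scale_left: "(r *\<^sub>R D) ** F = r *\<^sub>R (D ** F)"
  and matrix_scale_right: "D ** (r *\<^sub>R F) = r *\<^sub>R (D ** F)"
  by (simp_all add: matrix_matrix_mult_def vec_eq_iff algebra_simps sum.distrib scaleR_sum_right)

text \<open>A separate type because \<open>*\<close> on vectors is componentwise; here it is to be
  the matrix product, as the ring structure of \<open>op_state\<close> requires.\<close>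

typedef 'n op = "UNIV :: (complex^'n^'n) set"
  morphisms mat_of op_of ..

lemma mat_of_op_of [simp]: "mat_of (op_of A) = A" by (simp add: op_of_inverse)
lemma op_of_mat_of [simp]: "op_of (mat_of T) = T" by (simp add: mat_of_inverse)
lemma op_eq_iff: "S = T \<longleftrightarrow> mat_of S = mat_of T" by (simp add: mat_of_inject)

instantiation op :: (finite) real_algebra_1
begin

definition "0 = op_of 0"
definition "1 = op_of (mat 1)"
definition "S + T = op_of (mat_of S + mat_of T)"
definition "S - T = op_of (mat_of S - mat_of T)"
definition "- T = op_of (- mat_of T)"
definition "S * T = op_of (mat_of S ** mat_of T)"
definition "c *\<^sub>R T = op_of (c *\<^sub>R mat_of T)" for c :: real

lemmas op_defs = zero_op_def one_op_def plus_op_def minus_op_def uminus_op_def times_op_def scaleR_op_def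

instance
proof
  have "mat 1 \<noteq> (0 :: complex^'a^'a)" by (simp add: mat_def vec_eq_iff)
  then show "(0 :: 'a op) \<noteq> 1" by (simp add: op_defs op_eq_iff)
qed (simp_all add: op_defs op_eq_iff matrix_mul_assoc matrix_distrib_left
    matrix_distrib_right matrix_scale_left matrix_scale_right scaleR_add_right scaleR_add_left)

end

lemma mat_of_simps [simp]:
  "mat_of 0 = 0" "mat_of 1 = mat 1" "mat_of (S + T) = mat_of S + mat_of T"
  "mat_of (S - T) = mat_of S - mat_of T" "mat_of (- T) = - mat_of T"
  "mat_of (S * T) = mat_of S ** mat_of T" "mat_of (c *\<^sub>R T) = c *\<^sub>R mat_of T"
  by (simp_all add: op_defs)

lemma mat_of_sum: "mat_of (\<Sum>i\<in>I. S i) = (\<Sum>i\<in>I. mat_of (S i))"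
  by (induction I rule: infinite_finite_induct) auto

definition op_act :: "'n op \<Rightarrow> complex^'n^'n \<Rightarrow> complex^'n^'n" where
  "op_act S v = mat_of S ** v"

definition left_ops :: "('a::finite \<times> 'b::finite) op set" where
  "left_ops = range (\<lambda>A. op_of (kron A (mat 1)))"

definition right_ops :: "('a::finite \<times> 'b::finite) op set" where
  "right_ops = range (\<lambda>B. op_of (kron (mat 1) B))"

lemma left_right_commute: "S \<in> left_ops \<Longrightarrow> T \<in> right_ops \<Longrightarrow> S * T = T * S"
  by (auto simp: left_ops_def right_ops_def op_eq_iff kron_mult)

lemma op_state_op:
  fixes R :: "complex^'n^'n"
  assumes "norm R = 1" "0 \<le> \<eta>"
  shows "op_state op_act R \<eta>"
  by unfold_locales
     (simp_all add: op_act_def assms matrix_distrib_left matrix_distrib_right matrix_scale_left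
       matrix_scale_right matrix_mul_assoc)

lemma pos_op_iff:
  fixes R :: "complex^'n^'n" and T :: "'n op" and \<eta> :: real
  assumes "norm R = 1" "0 \<le> \<eta>"
  shows "op_state.pos op_act T \<longleftrightarrow> psd (mat_of T)"
  unfolding op_state.pos_def[OF op_state_op[OF assms]] op_act_def psd_iff hermitian_iff by blast

lemma psd_swap_sides:
  "psd (kron (mat 1 :: complex^'a^'a) B) \<Longrightarrow> psd (kron B (mat 1 :: complex^'a^'a))"
proof -
  assume p: "psd (kron (mat 1 :: complex^'a^'a) B)"
  let ?s = "\<lambda>x. \<chi> r. x $ (snd r, fst r)"
  have k: "kron B (mat 1 :: complex^'a^'a) $ r $ q = kron (mat 1) B $ (snd r, fst r) $ (snd q, fst q)" for r q
    by (simp add: kron_def)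
  have d: "dagger (kron B (mat 1 :: complex^'a^'a)) = kron B (mat 1)"
    using p unfolding psd_def dagger_def vec_eq_iff by (simp add: k)
  have "Re (cinner x (kron B (mat 1 :: complex^'a^'a) *v x)) = Re (cinner (?s x) (kron (mat 1) B *v ?s x))" for x
  proof -
    have "(kron B (mat 1 :: complex^'a^'a) *v x) $ (i, j) = (kron (mat 1) B *v ?s x) $ (j, i)" for i j
      unfolding matrix_vector_mult_def
      by (simp add: k sum_pairs) (rule sum.swap)
    then show ?thesis
      unfolding cinner_def by (simp add: sum_pairs) (rule sum.swap)
  qed
  then show ?thesis using p d by (simp add: psd_def)
qed

lemma bipartite_op:
  fixes R :: "complex^('a::finite \<times> 'b::finite)^('a \<times> 'b)"
  assumes "norm R = 1" "0 \<le> \<eta>"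
  shows "bipartite op_act R \<eta> left_ops right_ops"
proof -
  interpret op_state op_act R \<eta> by (rule op_state_op[OF assms])
  note ops = left_ops_def right_ops_def
  have l: "kron 0 (mat 1) = (0 :: complex^('a \<times> 'b)^('a \<times> 'b))" by (simp add: kron_def vec_eq_iff)
  have gram: "(norm (op_act (op_of f) v))\<^sup>2 = v \<bullet> op_act (op_of (dagger f ** f)) v" for f and v :: "complex^('a \<times> 'b)^('a \<times> 'b)"
    using norm_gram[of v f] by (simp add: op_act_def)
  show ?thesis
  proof
    fix S T :: "('a \<times> 'b) op" and c :: real
    show "1 \<in> (left_ops :: ('a \<times> 'b) op set)" "1 \<in> (right_ops :: ('a \<times> 'b) op set)"
      unfolding ops by (rule range_eqI[of _ _ "mat 1"], simp add: op_eq_iff kron_one)+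
    show "S \<in> left_ops \<Longrightarrow> T \<in> left_ops \<Longrightarrow> S + T \<in> left_ops"
      unfolding ops by (auto simp: op_eq_iff image_iff simp flip: kron_add_left)
    show "S \<in> right_ops \<Longrightarrow> T \<in> right_ops \<Longrightarrow> S + T \<in> right_ops"
      unfolding ops by (auto simp: op_eq_iff image_iff simp flip: kron_add_right)
    show "S \<in> left_ops \<Longrightarrow> T \<in> left_ops \<Longrightarrow> S * T \<in> left_ops"
      unfolding ops by (auto simp: op_eq_iff image_iff kron_mult)
    show "S \<in> right_ops \<Longrightarrow> T \<in> right_ops \<Longrightarrow> S * T \<in> right_ops"
      unfolding ops by (auto simp: op_eq_iff image_iff kron_mult)
    show "S \<in> left_ops \<Longrightarrow> c *\<^sub>R S \<in> left_ops"
      unfolding ops by (auto simp: op_eq_iff image_iff simp flip: kron_scale_left)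
    show "S \<in> right_ops \<Longrightarrow> c *\<^sub>R S \<in> right_ops"
      unfolding ops by (auto simp: op_eq_iff image_iff simp flip: kron_scale_right)
    show "S \<in> left_ops \<Longrightarrow> T \<in> right_ops \<Longrightarrow> S * T = T * S" by (rule left_right_commute)
    show "\<exists>F\<in>left_ops. \<forall>v. (norm (op_act F v))\<^sup>2 = v \<bullet> op_act T v" if T: "T \<in> left_ops" "pos T"
    proof -
      obtain A where A: "T = op_of (kron A (mat 1))" using T(1) unfolding left_ops_def by (elim rangeE)
      then have "psd A" using T(2) pos_op_iff[OF assms] psd_kron_left_iff by force
      then obtain f where "A = dagger f ** f" by (rule psd_factor)
      then have "T = op_of (dagger (kron f (mat 1)) ** kron f (mat 1))"
        by (simp add: A kron_dagger kron_mult)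
      then show ?thesis
        using gram[of "kron f (mat 1)"] by (intro bexI[of _ "op_of (kron f (mat 1))"]) (auto simp: ops)
    qed
    show "\<exists>F\<in>right_ops. \<forall>v. (norm (op_act F v))\<^sup>2 = v \<bullet> op_act T v" if T: "T \<in> right_ops" "pos T"
    proof -
      obtain A where A: "T = op_of (kron (mat 1) A)" using T(1) unfolding right_ops_def by (elim rangeE)
      then have "psd A" using T(2) pos_op_iff[OF assms] psd_kron_left_iff psd_swap_sides by force
      then obtain f where "A = dagger f ** f" by (rule psd_factor)
      then have "T = op_of (dagger (kron (mat 1) f) ** kron (mat 1) f)"
        by (simp add: A kron_dagger kron_mult)
      then show ?thesis
        using gram[of "kron (mat 1) f"] by (intro bexI[of _ "op_of (kron (mat 1) f)"]) (auto simp: ops)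
    qed
  qed
qed

section \<open>From the vectors of the game to losing probabilities\<close>

lemma UNIV_5: "(UNIV :: 5 set) = {0, 1, 2, 3, 4}"
proof -
  have "card {0, 1, 2, 3, 4 :: 5} = card (UNIV :: 5 set)" by simp
  then show ?thesis using card_subset_eq[of "UNIV :: 5 set" "{0, 1, 2, 3, 4}"] by simp
qed

lemma bas_form: "bas i \<bullet> (Dmat *v bas j) = (if i = j then if i = 4 then 1 else 2 else 0)"
proof -
  have "(Dmat *v bas j) $ i = Dmat $ i $ j"
    by (simp add: bas_def matrix_vector_mult_def axis_def if_distrib cong: if_cong)
  then show ?thesis by (simp add: bas_def inner_axis' Dmat_def)
qed

definition vec5 :: "real \<Rightarrow> real \<Rightarrow> real \<Rightarrow> real \<Rightarrow> real \<Rightarrow> real^5" where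
  "vec5 a b c d e = a *\<^sub>R bas 0 + b *\<^sub>R bas 1 + c *\<^sub>R bas 2 + d *\<^sub>R bas 3 + e *\<^sub>R bas 4"

lemma vec5_form:
  "vec5 a b c d e \<bullet> (Dmat *v vec5 a' b' c' d' e') = 2 * (a * a' + b * b' + c * c' + d * d') + e * e'"
  by (simp add: vec5_def matrix_vector_right_distrib matrix_vector_mult_scaleR
      inner_add_left inner_add_right bas_form)

lemma alice_rows_vec5:
  "alice_rows =
    [[vec5 1 (- 1) 0 0 0,
      vec5 1 1 0 0 0,
      vec5 0 0 1 (- 1) 0,
      vec5 0 0 1 1 0,
      vec5 0 0 0 0 1],
     [vec5 0 0 0 0 1,
      vec5 1 0 (- 1) 0 0,
      vec5 1 0 1 0 0,
      vec5 0 1 0 (- 1) 0,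
      vec5 0 1 0 1 0],
     [vec5 0 1 (- 1) 0 0,
      vec5 0 1 1 0 0,
      vec5 1 0 0 0 (- 1),
      vec5 1 0 0 0 1,
      vec5 0 0 0 1 0],
     [vec5 1 0 0 (- 1) 0,
      vec5 1 0 0 1 0,
      vec5 0 0 1 0 (- 1),
      vec5 0 0 1 0 1,
      vec5 0 1 0 0 0]]"
  by (simp add: alice_rows_def vec5_def)

text \<open>Doubling clears the denominators and does not affect which forms vanish.\<close>

lemma bob_rows_vec5:
  "map (map ((*\<^sub>R) 2)) bob_rows =
    [[vec5 2 0 0 0 0,
      vec5 0 2 0 0 0,
      vec5 0 0 2 0 0,
      vec5 0 0 0 2 0,
      vec5 0 0 0 0 2],
     [vec5 (- 1) (- 1) (- 1) 1 0,
      vec5 1 1 (- 1) 1 0,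
      vec5 (- 1) 1 (- 1) (- 1) 2,
      vec5 (- 1) 1 (- 1) (- 1) (- 2),
      vec5 1 (- 1) (- 1) (- 1) 0],
     [vec5 (- 1) 1 (- 1) 1 0,
      vec5 1 1 1 1 0,
      vec5 1 1 (- 1) (- 1) 2,
      vec5 1 1 (- 1) (- 1) (- 2),
      vec5 (- 1) 1 1 (- 1) 0]]"
  by (simp add: bob_rows_def vec5_def cvec0_def cvec1_def hvec_def hvec'_def dvec0_def dvec1_def
      kvec_def kvec'_def scaleR_add_right scaleR_diff_right)

lemma loses_form:
  assumes "x < 4" "y < 3" "a \<in> answers" "b \<in> answers" "loses x y a b"
  shows "alice_rows ! x ! a \<bullet> (Dmat *v (bob_rows ! y ! b)) = 0"
proof -
  have x: "x \<in> {0, 1, 2, 3}" and y: "y \<in> {0, 1, 2}" using assms by auto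
  have len: "y < length bob_rows" "b < length (bob_rows ! y)"
    using y assms(4) by (auto simp: bob_rows_def answers_def)
  have "alice_rows ! x ! a \<bullet> (Dmat *v (map (map ((*\<^sub>R) 2)) bob_rows ! y ! b)) = 0"
    using x y assms(3,4,5) unfolding answers_def winning_answers_def alice_rows_vec5 bob_rows_vec5
    by (elim insertE emptyE) (simp_all add: vec5_form)
  then show ?thesis using len by (simp add: matrix_vector_mult_scaleR)
qed

lemma loses_wins:
  assumes "x < 4" "y < 3" "a \<in> answers" "b \<in> answers" "loses x y a b"
  shows "wins x y a b = 0"
  using loses_form[OF assms] by (simp add: wins_def uvec_def vvec_def matrix_vector_mult_scaleR)

lemma answers_lessThan: "{..<5} = answers"
  by (auto simp: answers_def)

lemma matrix_sum_left: "(\<Sum>i\<in>I. A i) ** B = (\<Sum>i\<in>I. A i ** (B :: complex^'n^'n))"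
  by (induction I rule: infinite_finite_induct) (auto simp: matrix_distrib_right)

lemma matrix_sum_right: "B ** (\<Sum>i\<in>I. A i) = (\<Sum>i\<in>I. B ** (A i :: complex^'n^'n))"
  by (induction I rule: infinite_finite_induct) (auto simp: matrix_distrib_left)

lemma trace_sum: "trace (\<Sum>i\<in>I. A i) = (\<Sum>i\<in>I. trace (A i :: complex^'n^'n))"
  unfolding trace_def sum_component by (rule sum.swap)

lemma purified_expectation: "R \<bullet> (K ** R) = Re (trace ((R ** dagger R) ** K))"
  unfolding inner_matrix using trace_mul_sym[of "dagger R" "K ** R"] trace_mul_sym[of K "R ** dagger R"]
  by (simp add: matrix_mul_assoc)

context
  fixes rho R :: "complex^('a::finite \<times> 'b::finite)^('a \<times> 'b)"
    and M :: "nat \<Rightarrow> nat \<Rightarrow> complex^'a^'a" and N :: "nat \<Rightarrow> nat \<Rightarrow> complex^'b^'b" and \<epsilon> :: real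
  assumes R: "rho = R ** dagger R" and strategy: "quantum_strategy rho M N"
    and eps: "0 \<le> \<epsilon>" "winning_prob rho M N \<ge> 1 - \<epsilon>"
begin

lemma norm_purification: "norm R = 1"
proof -
  have "(norm R)\<^sup>2 = Re (trace rho)"
    unfolding norm_matrix R by (subst trace_mul_sym) simp
  then have "(norm R)\<^sup>2 = 1" using strategy by (simp add: quantum_strategy_def density_def)
  then show ?thesis using norm_ge_zero[of R] power2_eq_1_iff[of "norm R"] by auto
qed

lemma povm_M: "x < 4 \<Longrightarrow> a \<in> answers \<Longrightarrow> psd (M x a)" "x < 4 \<Longrightarrow> sum (M x) answers = mat 1"
  and povm_N: "y < 3 \<Longrightarrow> b \<in> answers \<Longrightarrow> psd (N y b)" "y < 3 \<Longrightarrow> sum (N y) answers = mat 1"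
  using strategy unfolding quantum_strategy_def povm5_def answers_lessThan[symmetric] by auto

definition pr :: "nat \<Rightarrow> nat \<Rightarrow> nat \<Rightarrow> nat \<Rightarrow> real" where
  "pr x y a b = Re (trace (rho ** kron (M x a) (N y b)))"

lemma pr_inner: "pr x y a b = R \<bullet> (kron (M x a) (N y b) ** R)"
  unfolding pr_def by (simp add: R purified_expectation)

lemma pr_nonneg: "x < 4 \<Longrightarrow> y < 3 \<Longrightarrow> a \<in> answers \<Longrightarrow> b \<in> answers \<Longrightarrow> 0 \<le> pr x y a b"
  using psd_kron[OF povm_M(1) povm_N(1)] unfolding pr_inner psd_iff by blast

lemma pr_total: "x < 4 \<Longrightarrow> y < 3 \<Longrightarrow> (\<Sum>a\<in>answers. \<Sum>b\<in>answers. pr x y a b) = 1"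
proof -
  assume xy: "x < 4" "y < 3"
  have "(\<Sum>a\<in>answers. \<Sum>b\<in>answers. pr x y a b) = R \<bullet> (kron (sum (M x) answers) (sum (N y) answers) ** R)"
    unfolding kron_sum_left by (simp add: pr_inner kron_sum_right matrix_sum_left inner_sum_right)
  then show ?thesis
    using norm_purification by (simp add: povm_M povm_N xy kron_one flip: power2_norm_eq_inner)
qed

text \<open>The twelve conditional losing probabilities are nonnegative and sum to at most
  \<open>12 * \<epsilon>\<close>, so each of them obeys that bound.\<close>

lemma losing_probability:
  assumes xy: "x < 4" "y < 3"
  shows "(\<Sum>a\<in>answers. \<Sum>b\<in>answers. if loses x y a b then pr x y a b else 0) \<le> 12 * \<epsilon>"
proof -
  define l where "l x y = (\<Sum>a\<in>answers. \<Sum>b\<in>answers. (1 - wins x y a b) * pr x y a b)" for x y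
  have w: "0 \<le> 1 - wins x y a b" for x y a b by (simp add: wins_def)
  have lnn: "0 \<le> l x y" if "x < 4" "y < 3" for x y
    unfolding l_def by (intro sum_nonneg mult_nonneg_nonneg w pr_nonneg that)
  have le: "l x y = 1 - (\<Sum>a\<in>answers. \<Sum>b\<in>answers. wins x y a b * pr x y a b)" if "x < 4" "y < 3" for x y
    unfolding l_def using pr_total[OF that] by (simp add: algebra_simps sum_subtractf)
  have "(\<Sum>a\<in>answers. \<Sum>b\<in>answers. if loses x y a b then pr x y a b else 0) \<le> l x y"
    unfolding l_def
  proof (intro sum_mono)
    fix a b assume "a \<in> answers" "b \<in> answers"
    then show "(if loses x y a b then pr x y a b else 0) \<le> (1 - wins x y a b) * pr x y a b"
      using loses_wins[OF xy] mult_nonneg_nonneg[OF w pr_nonneg[OF xy]] by simp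
  qed
  also have "l x y \<le> (\<Sum>y<3. l x y)"
    using xy lnn by (intro member_le_sum[of y "{..<3}" "l x"]) auto
  also have "\<dots> \<le> (\<Sum>x<4. \<Sum>y<3. l x y)"
    using xy lnn by (intro member_le_sum[of x "{..<4}" "\<lambda>x. \<Sum>y<3. l x y"] sum_nonneg) auto
  also have "\<dots> = (\<Sum>x<4. \<Sum>y<3. 1 - (\<Sum>a\<in>answers. \<Sum>b\<in>answers. wins x y a b * pr x y a b))"
    by (intro sum.cong refl le) auto
  also have "\<dots> = 12 - 12 * winning_prob rho M N"
    by (simp add: winning_prob_def pr_def answers_lessThan sum_subtractf)
  also have "\<dots> \<le> 12 * \<epsilon>" using eps by simp
  finally show ?thesis .
qed

lemma game_op:
  "game op_act R (sqrt (12 * \<epsilon>)) left_ops right_ops (\<lambda>x a. op_of (kron (M x a) (mat 1)))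
    (\<lambda>y b. op_of (kron (mat 1) (N y b)))"
proof -
  have e: "0 \<le> sqrt (12 * \<epsilon>)" using eps by simp
  interpret bipartite op_act R "sqrt (12 * \<epsilon>)" left_ops right_ops
    by (rule bipartite_op[OF norm_purification e])
  note p = pos_op_iff[OF norm_purification e]
  show ?thesis
  proof
    show "op_of (kron (M x a) (mat 1)) \<in> left_ops" for x a by (simp add: left_ops_def)
    show "op_of (kron (mat 1) (N y b)) \<in> right_ops" for y b by (simp add: right_ops_def)
    show "povm (\<lambda>a. op_of (kron (M x a) (mat 1)))" if "x < 4" for x
      using that povm_M psd_kron[OF _ psd_one]
      by (auto simp add: povm_def p op_eq_iff mat_of_sum kron_one simp flip: kron_sum_left)
    show "povm (\<lambda>b. op_of (kron (mat 1) (N y b)))" if "y < 3" for y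
      using that povm_N psd_kron[OF psd_one]
      by (auto simp add: povm_def p op_eq_iff mat_of_sum kron_one simp flip: kron_sum_right)
    show "(\<Sum>a\<in>answers. \<Sum>b\<in>answers. if loses x y a b
        then R \<bullet> op_act (op_of (kron (M x a) (mat 1)) * op_of (kron (mat 1) (N y b))) R else 0)
      \<le> (sqrt (12 * \<epsilon>))\<^sup>2" if "x < 4" "y < 3" for x y
      using losing_probability[OF that] eps by (simp add: op_act_def kron_mult pr_inner cong: if_cong)
  qed
qed

end

section \<open>Channels and fidelity\<close>

definition idx :: "5 \<Rightarrow> nat" where
  "idx m = (if m = 0 then 0 else if m = 1 then 1 else if m = 2 then 2 else if m = 3 then 3 else 4)"

lemma idx_sum: "(\<Sum>m\<in>UNIV. f (idx m)) = (\<Sum>i\<in>answers. f i)"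
  unfolding UNIV_5 answers_def by (simp add: idx_def)

definition schmidt :: "nat \<Rightarrow> real" where
  "schmidt i = (if i = 4 then 1 / sqrt 17 else 2 / sqrt 17)"

lemma psi_star_component: "psi_star $ (m, n) = (if m = n then of_real (schmidt (idx m)) else 0)"
proof -
  have k: "ket i i $ (m, n) = (if m = n \<and> m = i then 1 else 0)" for i
    by (auto simp: ket_def axis_def)
  have m: "m = 0 \<or> m = 1 \<or> m = 2 \<or> m = 3 \<or> m = 4" using UNIV_5 by blast
  have v: "schmidt (idx m) = (if m = 4 then 1 else 2) / sqrt 17"
    using m unfolding schmidt_def idx_def by (elim disjE) simp_all
  have "(2 *\<^sub>R ket 0 0 + 2 *\<^sub>R ket 1 1 + 2 *\<^sub>R ket 2 2 + 2 *\<^sub>R ket 3 3 + ket 4 4) $ (m, n)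
      = of_real (if m = n then if m = 4 then 1 else 2 else 0)"
    unfolding vector_add_component vector_scaleR_component k
    using m by (elim disjE) (simp_all add: of_real_def)
  then have "psi_star $ (m, n) = of_real ((if m = n then if m = 4 then 1 else 2 else 0) / sqrt 17)"
    unfolding psi_star_def vector_scaleR_component
    by (simp only: scaleR_conv_of_real divide_inverse of_real_mult mult.commute)
  then show ?thesis
    unfolding v by (cases "m = n") (simp_all only: simp_thms if_True if_False div_0 of_real_0)
qed

text \<open>The completely positive map whose Kraus operators, indexed by \<open>k\<close>, have as row \<open>m\<close> the row
  \<open>k\<close> of \<open>w m\<close>: the partial trace over the second factor after \<open>x \<mapsto> \<Sum>m. |m\<rangle> \<otimes> w m x\<close>.\<close>

definition kraus :: "('m \<Rightarrow> complex^'n^'n) \<Rightarrow> complex^'n^'n \<Rightarrow> complex^'m^'m" where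
  "kraus w X = (\<chi> m n. trace (w m ** X ** dagger (w n)))"

lemma trace_axis: "trace A = (\<Sum>k\<in>UNIV. cinner (axis k 1) (A *v axis k 1))"
  by (simp add: trace_def cinner_axis_left mult_axis)

lemma cinner_sum_left: "cinner (\<Sum>i\<in>I. f i) y = (\<Sum>i\<in>I. cinner (f i) y)"
  by (induction I rule: infinite_finite_induct) (auto simp: cinner_add_left, auto simp: cinner_def)

lemma cinner_sum_right: "cinner y (\<Sum>i\<in>I. f i) = (\<Sum>i\<in>I. cinner y (f i))"
  by (induction I rule: infinite_finite_induct) (auto simp: cinner_add_right, auto simp: cinner_def)

lemma mult_vec_sum: "A *v (\<Sum>i\<in>I. f i) = (\<Sum>i\<in>I. A *v (f i :: complex^'n))"
  by (induction I rule: infinite_finite_induct) (auto simp: matrix_vector_right_distrib)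

text \<open>The vectors \<open>z V k\<close> do not involve \<open>X\<close>. The same substitution
  therefore works in all blocks of a block matrix, which gives complete positivity.\<close>

lemma kraus_form:
  fixes w :: "'m::finite \<Rightarrow> complex^'n^'n"
  defines "z \<equiv> \<lambda>V k. \<Sum>m\<in>UNIV. V $ m *s (dagger (w m) *v axis k 1)"
  shows "cinner U (kraus w X *v V) = (\<Sum>k\<in>UNIV. cinner (z U k) (X *v z V k))"
proof -
  have entry: "kraus w X $ m $ n = (\<Sum>k\<in>UNIV. cinner (dagger (w m) *v axis k 1) (X *v (dagger (w n) *v axis k 1)))"
    for m n
    by (simp add: kraus_def trace_axis cinner_adjoint flip: matrix_vector_mul_assoc)
  have "cinner U (kraus w X *v V)
      = (\<Sum>m\<in>UNIV. \<Sum>n\<in>UNIV. \<Sum>k\<in>UNIV. cnj (U $ m) * V $ n * cinner (dagger (w m) *v axis k 1) (X *v (dagger (w n) *v axis k 1)))"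
    by (simp add: cinner_def[of U] matrix_vector_mult_def[of "kraus w X"] entry sum_distrib_left
        sum_distrib_right mult_ac)
  also have "\<dots> = (\<Sum>m\<in>UNIV. \<Sum>k\<in>UNIV. \<Sum>n\<in>UNIV. cnj (U $ m) * V $ n * cinner (dagger (w m) *v axis k 1) (X *v (dagger (w n) *v axis k 1)))"
    by (intro sum.cong refl sum.swap)
  also have "\<dots> = (\<Sum>k\<in>UNIV. \<Sum>m\<in>UNIV. \<Sum>n\<in>UNIV. cnj (U $ m) * V $ n * cinner (dagger (w m) *v axis k 1) (X *v (dagger (w n) *v axis k 1)))"
    by (rule sum.swap)
  also have "\<dots> = (\<Sum>k\<in>UNIV. cinner (z U k) (X *v z V k))"
    unfolding z_def cinner_sum_left
    by (simp add: cinner_sum_right mult_vec_sum mult_scale_vec cinner_scale_left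
        cinner_scale_right sum_distrib_left mult.assoc mult.left_commute)
  finally show ?thesis .
qed

lemma trace_dagger: "trace (dagger A) = cnj (trace A)"
  by (simp add: trace_def dagger_def)

lemma kraus_dagger: "dagger (kraus w X) = kraus w (dagger X)"
proof -
  have "cnj (trace (w m ** X ** dagger (w n))) = trace (w n ** dagger X ** dagger (w m))" for m n
    unfolding trace_dagger[symmetric] by (simp add: dagger_mult matrix_mul_assoc)
  then show ?thesis by (simp add: kraus_def dagger_def[of "vec_lambda _"])
qed

lemma kraus_completely_positive: "completely_positive (kraus w)"
  unfolding completely_positive_def
proof (intro allI impI)
  fix r and X :: "nat \<Rightarrow> nat \<Rightarrow> complex^'a^'a"
  assume X: "block_psd r X"
  show "block_psd r (\<lambda>i j. kraus w (X i j))" unfolding block_psd_def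
  proof (intro conjI allI impI)
    fix i j assume "i < r" "j < r"
    then show "dagger (kraus w (X j i)) = kraus w (X i j)"
      using X by (simp add: kraus_dagger block_psd_def)
  next
    fix V :: "nat \<Rightarrow> complex^'b"
    let ?z = "\<lambda>k i. \<Sum>m\<in>UNIV. V i $ m *s (dagger (w m) *v axis k 1)"
    have "(\<Sum>i<r. \<Sum>j<r. cinner (V i) (kraus w (X i j) *v V j))
        = (\<Sum>i<r. \<Sum>k\<in>UNIV. \<Sum>j<r. cinner (?z k i) (X i j *v ?z k j))"
      unfolding kraus_form by (intro sum.cong refl sum.swap)
    also have "\<dots> = (\<Sum>k\<in>UNIV. \<Sum>i<r. \<Sum>j<r. cinner (?z k i) (X i j *v ?z k j))" by (rule sum.swap)
    finally have "Re (\<Sum>i<r. \<Sum>j<r. cinner (V i) (kraus w (X i j) *v V j))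
        = (\<Sum>k\<in>UNIV. Re (\<Sum>i<r. \<Sum>j<r. cinner (?z k i) (X i j *v ?z k j)))" by simp
    also have "0 \<le> \<dots>" using X by (intro sum_nonneg) (simp add: block_psd_def)
    finally show "0 \<le> Re (\<Sum>i<r. \<Sum>j<r. cinner (V i) (kraus w (X i j) *v V j))" .
  qed
qed

lemma cscale_mult_left: "cscale c A ** B = cscale c (A ** B)"
  and cscale_mult_right: "A ** cscale c B = cscale c (A ** B)"
  by (simp_all add: cscale_def matrix_matrix_mult_def vec_eq_iff sum_distrib_left algebra_simps)

lemma trace_cscale: "trace (cscale c A) = c * trace A"
  by (simp add: trace_def cscale_def sum_distrib_left)

lemma kraus_add: "kraus w (X + Y) = kraus w X + kraus w Y"
  by (simp add: kraus_def vec_eq_iff matrix_distrib_left matrix_distrib_right trace_add)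

lemma kraus_cscale: "kraus w (cscale c X) = cscale c (kraus w X)"
  by (simp add: kraus_def vec_eq_iff cscale_mult_left cscale_mult_right trace_cscale)
     (simp add: cscale_def)

lemma kraus_trace: "trace (kraus w X) = trace ((\<Sum>m\<in>UNIV. dagger (w m) ** w m) ** X)"
proof -
  have "trace (kraus w X) = (\<Sum>m\<in>UNIV. trace (w m ** X ** dagger (w m)))"
    by (simp add: kraus_def trace_def[of "vec_lambda _"])
  also have "\<dots> = (\<Sum>m\<in>UNIV. trace ((dagger (w m) ** w m) ** X))"
    by (intro sum.cong refl) (metis matrix_mul_assoc trace_mul_sym)
  finally show ?thesis by (simp add: matrix_sum_left trace_sum)
qed

lemma block_psd_add: "block_psd r X \<Longrightarrow> block_psd r Y \<Longrightarrow> block_psd r (\<lambda>i j. X i j + Y i j)"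
  unfolding block_psd_def
  by (simp add: dagger_add matrix_vector_mult_add_rdistrib cinner_add_right sum.distrib)

lemma kraus_channel:
  assumes "(\<Sum>m\<in>UNIV. dagger (w m) ** w m) + (\<Sum>m\<in>UNIV. dagger (u m) ** u m) = mat 1"
  shows "channel (\<lambda>X. kraus w X + kraus u X)"
  unfolding channel_def
proof (intro conjI allI)
  show "clinear_map (\<lambda>X. kraus w X + kraus u X)"
    by (simp add: clinear_map_def kraus_add kraus_cscale) (simp add: cscale_def vec_eq_iff algebra_simps)
  show "completely_positive (\<lambda>X. kraus w X + kraus u X)"
    using kraus_completely_positive[of w] kraus_completely_positive[of u] block_psd_add
    unfolding completely_positive_def by blast
  show "trace (kraus w X + kraus u X) = trace X" for X
  proof -
    have "trace (kraus w X + kraus u X)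
        = trace (((\<Sum>m\<in>UNIV. dagger (w m) ** w m) + (\<Sum>m\<in>UNIV. dagger (u m) ** u m)) ** X)"
      by (simp add: kraus_trace trace_add matrix_distrib_right)
    then show ?thesis by (simp add: assms)
  qed
qed

lemma trace_kron: "trace (kron A B) = trace A * trace B"
  by (simp add: trace_def kron_def sum_pairs sum_product)

lemma sum_if_const: "(\<Sum>i\<in>I. if b then f i else 0) = (if b then \<Sum>i\<in>I. f i else 0)"
  by simp

lemma matrix_unit_expansion:
  "rho = (\<Sum>i\<in>UNIV. \<Sum>j\<in>UNIV. \<Sum>s\<in>UNIV. \<Sum>t\<in>UNIV.
     cscale (rho $ (i, s) $ (j, t)) (kron (matrix_unit i j) (matrix_unit s t)))"
proof -
  have e: "cscale c (kron (matrix_unit i j) (matrix_unit s t)) $ (p, p') $ (q, q')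
      = (if i = p then if j = q then if s = p' then if t = q' then c else 0 else 0 else 0 else 0)"
    for c and i j p q :: 'a and s t p' q' :: 'b
    by (auto simp: cscale_def kron_def matrix_unit_def)
  show ?thesis by (simp add: vec_eq_iff e sum_if_const)
qed

lemma tensor_kraus:
  "tensor_map (kraus w) (kraus u) rho $ (m, m') $ (n, n')
    = trace (kron (w m) (u m') ** rho ** dagger (kron (w n) (u n')))"
proof -
  have "trace (kron (w m) (u m') ** kron A B ** dagger (kron (w n) (u n'))) = kraus w A $ m $ n * kraus u B $ m' $ n'" for A B
    by (simp add: kron_dagger kron_mult trace_kron kraus_def)
  then show ?thesis
    by (subst (2) matrix_unit_expansion)
       (simp add: tensor_map_def matrix_sum_left matrix_sum_right trace_sum cscale_mult_left cscale_mult_right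
          trace_cscale, simp add: cscale_def kron_def)
qed

definition fid :: "complex^(5 \<times> 5)^(5 \<times> 5) \<Rightarrow> real" where
  "fid T = Re (cinner psi_star (T *v psi_star))"

lemma fid_add: "fid (S + T) = fid S + fid T"
  by (simp add: fid_def matrix_vector_mult_add_rdistrib cinner_add_right)

lemma fid_diagonal:
  "fid T = Re (\<Sum>m\<in>UNIV. \<Sum>n\<in>UNIV. of_real (schmidt (idx m) * schmidt (idx n)) * T $ (m, m) $ (n, n))"
proof -
  have "(T *v psi_star) $ p = (\<Sum>n\<in>UNIV. of_real (schmidt (idx n)) * T $ p $ (n, n))" for p
    by (simp add: matrix_vector_mult_def sum_pairs psi_star_component if_distrib[of "(*) _"] mult.commute cong: if_cong)
  then show ?thesis
    by (simp add: fid_def cinner_def sum_pairs psi_star_component if_distrib[of cnj] if_distrib[of "\<lambda>x. x * _"]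
        cong: if_cong) (simp add: sum_distrib_left mult.assoc)
qed

text \<open>Before the partial trace the output is the sum of the vectors (m, m') tensored with
  \<open>kron (w m) (u m') ** R\<close>; the overlap with the target keeps m = m', weighted by the
  Schmidt coefficients.\<close>

lemma fid_tensor_kraus:
  fixes w :: "5 \<Rightarrow> complex^'a^'a" and u :: "5 \<Rightarrow> complex^'b^'b"
  assumes "rho = R ** dagger R"
  shows "fid (tensor_map (kraus w) (kraus u) rho)
    = (norm ((\<Sum>m\<in>UNIV. schmidt (idx m) *\<^sub>R kron (w m) (u m)) ** R))\<^sup>2"
proof -
  let ?F = "\<Sum>m\<in>UNIV. schmidt (idx m) *\<^sub>R kron (w m) (u m)"
  have d: "dagger (schmidt i *\<^sub>R A) = schmidt i *\<^sub>R dagger A" for i and A :: "complex^('a \<times> 'b)^('a \<times> 'b)"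
    by (simp add: dagger_def vec_eq_iff)
  have tr: "trace (c *\<^sub>R A) = of_real c * trace A" for c and A :: "complex^('a \<times> 'b)^('a \<times> 'b)"
    by (simp add: trace_def scaleR_sum_right flip: scaleR_conv_of_real)
  have "(norm (?F ** R))\<^sup>2 = Re (trace (?F ** rho ** dagger ?F))"
    unfolding norm_matrix assms by (subst trace_mul_sym) (simp add: dagger_mult matrix_mul_assoc)
  also have "trace (?F ** rho ** dagger ?F) = (\<Sum>m\<in>UNIV. \<Sum>n\<in>UNIV. of_real (schmidt (idx m) * schmidt (idx n))
      * trace (kron (w m) (u m) ** rho ** dagger (kron (w n) (u n))))"
    unfolding dagger_sum d matrix_sum_left matrix_scale_left
    by (simp add: matrix_sum_right trace_sum matrix_scale_right tr sum_distrib_left mult.assoc)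
  finally show ?thesis by (simp add: fid_diagonal tensor_kraus)
qed

lemma cscale_add: "cscale c (A + B) = cscale c A + cscale c B"
  by (simp add: cscale_def vec_eq_iff algebra_simps)

lemma tensor_map_add:
  "tensor_map (\<lambda>X. L X + L' X) (\<lambda>X. K X + K' X) rho
    = tensor_map L K rho + tensor_map L K' rho + (tensor_map L' K rho + tensor_map L' K' rho)"
  by (simp add: tensor_map_def kron_add_left kron_add_right cscale_add sum.distrib algebra_simps)

text \<open>The three terms involving a completion are squared norms and may be dropped.\<close>

lemma fid_two_kraus:
  fixes w w' :: "5 \<Rightarrow> complex^'a^'a" and u u' :: "5 \<Rightarrow> complex^'b^'b"
  assumes "rho = R ** dagger R"
  shows "(norm ((\<Sum>m\<in>UNIV. schmidt (idx m) *\<^sub>R kron (w m) (u m)) ** R))\<^sup>2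
    \<le> fid (tensor_map (\<lambda>X. kraus w X + kraus w' X) (\<lambda>X. kraus u X + kraus u' X) rho)"
  unfolding tensor_map_add fid_add fid_tensor_kraus[OF assms] by simp

lemma psd_complement:
  fixes k :: "'i \<Rightarrow> complex^'n^'n"
  assumes "\<And>v :: complex^'n^'n. (\<Sum>i\<in>I. (norm (k i ** v))\<^sup>2) \<le> (norm v)\<^sup>2"
  shows "psd (mat 1 - (\<Sum>i\<in>I. dagger (k i) ** k i))"
proof -
  have "v \<bullet> ((mat 1 - (\<Sum>i\<in>I. dagger (k i) ** k i)) ** v) = (norm v)\<^sup>2 - (\<Sum>i\<in>I. (norm (k i ** v))\<^sup>2)" for v :: "complex^'n^'n"
  proof -
    have "(mat 1 - S) ** v = v - S ** v" for S :: "complex^'n^'n"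
      using matrix_distrib_right[of "mat 1 - S" S v] by (simp add: algebra_simps)
    then show ?thesis
      by (simp add: inner_diff_right matrix_sum_left inner_sum_right norm_gram power2_norm_eq_inner)
  qed
  then show ?thesis using assms by (simp add: psd_iff dagger_diff dagger_sum dagger_mult)
qed

text \<open>The missing weight is factored as \<open>dagger f ** f\<close> and sent to the basis
  state 0, which restores the trace.\<close>

lemma kraus_completion:
  fixes w :: "nat \<Rightarrow> complex^'n^'n"
  assumes "psd (mat 1 - (\<Sum>i\<in>answers. dagger (w i) ** w i))"
  obtains u where "channel (\<lambda>X. kraus (w \<circ> idx) X + kraus u X)"
proof -
  obtain f where f: "mat 1 - (\<Sum>i\<in>answers. dagger (w i) ** w i) = dagger f ** f"
    using psd_factor[OF assms] by metis
  define u :: "5 \<Rightarrow> complex^'n^'n" where "u m = (if m = 0 then f else 0)" for m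
  have "dagger (u m) ** u m = (if m = 0 then dagger f ** f else 0)" for m
    by (simp add: u_def dagger_def matrix_matrix_mult_def vec_eq_iff)
  then have "(\<Sum>m\<in>UNIV. dagger (u m) ** u m) = dagger f ** f" by simp
  moreover have "(\<Sum>m\<in>UNIV. dagger ((w \<circ> idx) m) ** (w \<circ> idx) m) = (\<Sum>i\<in>answers. dagger (w i) ** w i)"
    unfolding o_def by (rule idx_sum)
  ultimately have "channel (\<lambda>X. kraus (w \<circ> idx) X + kraus u X)"
    by (intro kraus_channel) (simp flip: f)
  then show ?thesis by (rule that)
qed

lemma left_completion:
  fixes w :: "nat \<Rightarrow> complex^'a^'a"
  assumes "\<And>v :: complex^('a::finite \<times> 'b::finite)^('a \<times> 'b).
    (\<Sum>i\<in>answers. (norm (kron (w i) (mat 1) ** v))\<^sup>2) \<le> (norm v)\<^sup>2"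
  obtains u where "channel (\<lambda>X. kraus (w \<circ> idx) X + kraus u X)"
proof -
  have "psd (kron (mat 1 - (\<Sum>i\<in>answers. dagger (w i) ** w i)) (mat 1 :: complex^'b^'b))"
    using psd_complement[where k = "\<lambda>i. kron (w i) (mat 1 :: complex^'b^'b)", OF assms]
    by (simp add: kron_dagger kron_mult kron_diff_left kron_one flip: kron_sum_left)
  then show ?thesis using kraus_completion psd_kron_left_iff that by blast
qed

lemma right_completion:
  fixes w :: "nat \<Rightarrow> complex^'b^'b"
  assumes "\<And>v :: complex^('a::finite \<times> 'b::finite)^('a \<times> 'b).
    (\<Sum>i\<in>answers. (norm (kron (mat 1) (w i) ** v))\<^sup>2) \<le> (norm v)\<^sup>2"
  obtains u where "channel (\<lambda>X. kraus (w \<circ> idx) X + kraus u X)"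
proof -
  have "psd (kron (mat 1 :: complex^'a^'a) (mat 1 - (\<Sum>i\<in>answers. dagger (w i) ** w i)))"
    using psd_complement[where k = "\<lambda>i. kron (mat 1 :: complex^'a^'a) (w i)", OF assms]
    by (simp add: kron_dagger kron_mult kron_diff_right kron_one flip: kron_sum_right)
  then show ?thesis using kraus_completion psd_kron_left_iff psd_swap_sides that by blast
qed

section \<open>Boundedness of the fidelities under the supremum\<close>

lemma cinner_matrix_unit: "cinner x (matrix_unit p q *v y) = cnj (x $ p) * y $ q"
proof -
  have "(matrix_unit p q *v y) $ i = (if i = p then y $ q else 0)" for i
    by (cases "i = p") (simp_all add: matrix_vector_mult_def matrix_unit_def if_distrib[of "\<lambda>c. c * _"] cong: if_cong)
  then show ?thesis by (simp add: cinner_def if_distrib[of "(*) _"] cong: if_cong)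
qed

lemma block_psd_matrix_unit: "block_psd r (\<lambda>a b. matrix_unit (s a) (s b))"
  unfolding block_psd_def
proof (intro conjI allI impI)
  show "dagger (matrix_unit (s b) (s a)) = matrix_unit (s a) (s b)" for a b
    by (auto simp: dagger_def matrix_unit_def vec_eq_iff)
  fix w :: "nat \<Rightarrow> complex^'a"
  have "(\<Sum>a<r. \<Sum>b<r. cinner (w a) (matrix_unit (s a) (s b) *v w b))
      = cnj (\<Sum>a<r. w a $ s a) * (\<Sum>a<r. w a $ s a)"
    by (simp add: cinner_matrix_unit sum_product)
  then show "0 \<le> Re (\<Sum>a<r. \<Sum>b<r. cinner (w a) (matrix_unit (s a) (s b) *v w b))"
    by (simp only: cnj_mult_self) simp
qed

lemma channel_diagonal:
  fixes L :: "complex^'n^'n \<Rightarrow> complex^'m^'m"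
  assumes L: "channel L"
  shows "0 \<le> Re (L (matrix_unit i i) $ m $ m)" "Re (L (matrix_unit i i) $ m $ m) \<le> 1"
proof -
  have "block_psd 1 (\<lambda>a b. L (matrix_unit i i))"
    using L block_psd_matrix_unit[of 1 "\<lambda>_. i"] unfolding channel_def completely_positive_def by blast
  then have nn: "0 \<le> Re (L (matrix_unit i i) $ m $ m)" for m
    unfolding block_psd_def by (auto simp: mult_axis cinner_axis_left dest!: spec[of _ "\<lambda>_. axis m 1"])
  then show "0 \<le> Re (L (matrix_unit i i) $ m $ m)" .
  have "trace (L (matrix_unit i i)) = 1"
    using L by (simp add: channel_def trace_def matrix_unit_def)
  then have "(\<Sum>m\<in>UNIV. Re (L (matrix_unit i i) $ m $ m)) = 1"
    by (simp add: trace_def flip: Re_sum)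
  then show "Re (L (matrix_unit i i) $ m $ m) \<le> 1"
    using member_le_sum[of m UNIV "\<lambda>m. Re (L (matrix_unit i i) $ m $ m)"] nn by simp
qed

text \<open>Positivity of the \<open>2 \<times> 2\<close> block matrix of the images of the matrix units at \<open>i\<close> and \<open>j\<close>, tested on
  \<open>e\<^sub>m\<close> and a multiple of \<open>e\<^sub>n\<close>.\<close>

lemma channel_entry:
  fixes L :: "complex^'n^'n \<Rightarrow> complex^'m^'m"
  assumes L: "channel L"
  shows "cmod (L (matrix_unit i j) $ m $ n) \<le> 1"
proof -
  define s :: "nat \<Rightarrow> 'n" where "s a = (if a = 0 then i else j)" for a
  define x where "x = L (matrix_unit i j) $ m $ n"
  define c where "c = - cnj x"
  define w :: "nat \<Rightarrow> complex^'m" where "w a = (if a = 0 then axis m 1 else c *s axis n 1)" for a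
  have B: "block_psd 2 (\<lambda>a b. L (matrix_unit (s a) (s b)))"
    using L block_psd_matrix_unit[of 2 s] unfolding channel_def completely_positive_def by blast
  have "dagger (L (matrix_unit (s 0) (s 1))) = L (matrix_unit (s 1) (s 0))"
    using B unfolding block_psd_def by auto
  then have "L (matrix_unit j i) = dagger (L (matrix_unit i j))" by (simp add: s_def)
  then have y: "L (matrix_unit j i) $ n $ m = cnj x" by (simp add: x_def dagger_def)
  have "0 \<le> Re (\<Sum>a<2. \<Sum>b<2. cinner (w a) (L (matrix_unit (s a) (s b)) *v w b))"
    using B unfolding block_psd_def by blast
  also have "(\<Sum>a<2. \<Sum>b<2. cinner (w a) (L (matrix_unit (s a) (s b)) *v w b))
      = L (matrix_unit i i) $ m $ m + c * x + cnj c * cnj x + cnj c * c * L (matrix_unit j j) $ n $ n"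
    by (simp add: numeral_2_eq_2 w_def s_def mult_scale_vec cinner_scale_left cinner_scale_right
        cinner_axis_left mult_axis y x_def[symmetric])
  finally have "2 * (cmod x)\<^sup>2 \<le> Re (L (matrix_unit i i) $ m $ m) + (cmod x)\<^sup>2 * Re (L (matrix_unit j j) $ n $ n)"
    by (simp add: c_def mult.commute[of x "cnj x"] cnj_mult_self)
  also have "\<dots> \<le> 1 + (cmod x)\<^sup>2 * 1"
    using channel_diagonal[OF L] by (intro add_mono mult_left_mono) auto
  finally have "(cmod x)\<^sup>2 \<le> 1" by simp
  then show ?thesis unfolding x_def[symmetric] by (simp add: power_le_one_iff)
qed

text \<open>Crude but independent of the channels; it serves to make the supremum in
  \<open>Xi\<close> an upper bound.\<close>

lemma fid_le:
  fixes rho :: "complex^('a::finite \<times> 'b::finite)^('a \<times> 'b)"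
  assumes L: "channel L" and K: "channel K"
  shows "fid (tensor_map L K rho)
    \<le> (\<Sum>m\<in>UNIV. \<Sum>n\<in>UNIV. \<bar>schmidt (idx m) * schmidt (idx n)\<bar> *
        (\<Sum>i\<in>UNIV. \<Sum>j\<in>UNIV. \<Sum>s\<in>UNIV. \<Sum>t\<in>UNIV. cmod (rho $ (i, s) $ (j, t))))"
proof -
  have "cmod (tensor_map L K rho $ p $ q)
      \<le> (\<Sum>i\<in>UNIV. \<Sum>j\<in>UNIV. \<Sum>s\<in>UNIV. \<Sum>t\<in>UNIV. cmod (rho $ (i, s) $ (j, t)))" for p q
  proof -
    have e: "cmod (cscale (rho $ (i, s) $ (j, t)) (kron (L (matrix_unit i j)) (K (matrix_unit s t))) $ p $ q)
        \<le> cmod (rho $ (i, s) $ (j, t))" for i j :: 'a and s t :: 'b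
    proof -
      have "cmod (L (matrix_unit i j) $ fst p $ fst q) * cmod (K (matrix_unit s t) $ snd p $ snd q) \<le> 1 * 1"
        using channel_entry[OF L] channel_entry[OF K] by (intro mult_mono) auto
      then show ?thesis by (simp add: cscale_def kron_def norm_mult mult_left_le)
    qed
    show ?thesis
      unfolding tensor_map_def sum_component
      by (rule sum_norm_le, rule sum_norm_le, rule sum_norm_le, rule sum_norm_le, rule e)
  qed
  then have "cmod (\<Sum>m\<in>UNIV. \<Sum>n\<in>UNIV. of_real (schmidt (idx m) * schmidt (idx n)) * tensor_map L K rho $ (m, m) $ (n, n))
    \<le> (\<Sum>m\<in>UNIV. \<Sum>n\<in>UNIV. \<bar>schmidt (idx m) * schmidt (idx n)\<bar> *
        (\<Sum>i\<in>UNIV. \<Sum>j\<in>UNIV. \<Sum>s\<in>UNIV. \<Sum>t\<in>UNIV. cmod (rho $ (i, s) $ (j, t))))"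
    by (intro sum_norm_le) (simp add: norm_mult abs_mult mult_left_mono)
  then show ?thesis
    unfolding fid_diagonal by (rule order_trans[OF complex_Re_le_cmod])
qed

lemma fid_le_Xi:
  assumes "channel L" "channel K"
  shows "fid (tensor_map L K rho) \<le> Xi rho psi_star"
  unfolding Xi_def fid_def[symmetric]
proof (rule cSup_upper)
  show "bdd_above {fid (tensor_map L K rho) |L K. channel L \<and> channel K}"
    using fid_le by (intro bdd_aboveI) blast
qed (use assms in blast)

lemma extraction_fidelity:
  fixes rho :: "complex^('a::finite \<times> 'b::finite)^('a \<times> 'b)"
  assumes strategy: "quantum_strategy rho M N"
    and eps: "0 \<le> \<epsilon>" "winning_prob rho M N \<ge> 1 - \<epsilon>"
  shows "0 \<le> Xi rho psi_star" "1 - 12 * 10^9 * \<epsilon> \<le> Xi rho psi_star"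
proof -
  have "psd rho" using strategy by (simp add: quantum_strategy_def density_def)
  then obtain f where "rho = dagger f ** f" by (rule psd_factor)
  then obtain R where R: "rho = R ** dagger R" by (metis dagger_dagger)
  interpret game op_act R "sqrt (12 * \<epsilon>)" left_ops right_ops
    "\<lambda>x a. op_of (kron (M x a) (mat 1))" "\<lambda>y b. op_of (kron (mat 1) (N y b))"
    by (rule game_op[OF R strategy eps])
  have sch: "schmidt = (\<lambda>i. if i = 4 then 1 / sqrt 17 else 2 / sqrt 17)"
    by (rule ext) (rule schmidt_def)
  obtain W W' where W: "\<forall>i\<in>answers. W i \<in> (left_ops :: ('a \<times> 'b) op set) \<and> W' i \<in> (right_ops :: ('a \<times> 'b) op set)"
    and cW: "\<forall>v. (\<Sum>i\<in>answers. (norm (op_act (W i) v))\<^sup>2) \<le> (norm v)\<^sup>2"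
    and cW': "\<forall>v. (\<Sum>i\<in>answers. (norm (op_act (W' i) v))\<^sup>2) \<le> (norm v)\<^sup>2"
    and f: "1 - 10^9 * (sqrt (12 * \<epsilon>))\<^sup>2
      \<le> (norm (\<Sum>i\<in>answers. schmidt i *\<^sub>R op_act (W i * W' i) R))\<^sup>2"
    using extraction[OF sch] by blast
  have "\<forall>i\<in>answers. \<exists>A. W i = op_of (kron A (mat 1))" "\<forall>i\<in>answers. \<exists>B. W' i = op_of (kron (mat 1) B)"
    using W unfolding left_ops_def right_ops_def by blast+
  then obtain w w' where w: "\<forall>i\<in>answers. W i = op_of (kron (w i) (mat 1))"
    and w': "\<forall>i\<in>answers. W' i = op_of (kron (mat 1) (w' i))"
    using bchoice[of answers] by metis
  have c: "(\<Sum>i\<in>answers. (norm (kron (w i) (mat 1) ** v))\<^sup>2) \<le> (norm v)\<^sup>2"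
    "(\<Sum>i\<in>answers. (norm (kron (mat 1) (w' i) ** v))\<^sup>2) \<le> (norm v)\<^sup>2" for v :: "complex^('a \<times> 'b)^('a \<times> 'b)"
  proof -
    have "norm (op_act (W i) v) = norm (kron (w i) (mat 1) ** v)"
      "norm (op_act (W' i) v) = norm (kron (mat 1) (w' i) ** v)" if "i \<in> answers" for i
      using that w w' by (simp_all add: op_act_def)
    then show "(\<Sum>i\<in>answers. (norm (kron (w i) (mat 1) ** v))\<^sup>2) \<le> (norm v)\<^sup>2"
      "(\<Sum>i\<in>answers. (norm (kron (mat 1) (w' i) ** v))\<^sup>2) \<le> (norm v)\<^sup>2"
      using spec[OF cW, of v] spec[OF cW', of v] by simp_all
  qed
  obtain u where u: "channel (\<lambda>X. kraus (w \<circ> idx) X + kraus u X)" by (rule left_completion[OF c(1)])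
  obtain u' where u': "channel (\<lambda>X. kraus (w' \<circ> idx) X + kraus u' X)" by (rule right_completion[OF c(2)])
  have "(\<Sum>i\<in>answers. schmidt i *\<^sub>R op_act (W i * W' i) R)
      = (\<Sum>i\<in>answers. schmidt i *\<^sub>R kron (w i) (w' i)) ** R"
    unfolding matrix_sum_left using w w' by (intro sum.cong refl) (simp add: op_act_def kron_mult matrix_scale_left)
  also have "(\<Sum>i\<in>answers. schmidt i *\<^sub>R kron (w i) (w' i))
      = (\<Sum>m\<in>UNIV. schmidt (idx m) *\<^sub>R kron ((w \<circ> idx) m) ((w' \<circ> idx) m))"
    unfolding o_def by (rule idx_sum[symmetric])
  finally have "(norm (\<Sum>i\<in>answers. schmidt i *\<^sub>R op_act (W i * W' i) R))\<^sup>2 \<le> Xi rho psi_star"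
    using order_trans[OF fid_two_kraus[OF R] fid_le_Xi[OF u u']] by simp
  then show "0 \<le> Xi rho psi_star" "1 - 12 * 10^9 * \<epsilon> \<le> Xi rho psi_star"
    using f eps order_trans[OF zero_le_power2] by auto
qed

theorem theorem2p1:
  fixes rho :: "complex^('a::finite \<times> 'b::finite)^('a \<times> 'b)"
    and M :: "nat \<Rightarrow> nat \<Rightarrow> complex^'a^'a"
    and N :: "nat \<Rightarrow> nat \<Rightarrow> complex^'b^'b"
    and \<epsilon> :: real
  assumes "quantum_strategy rho M N"
    and "0 \<le> \<epsilon>" and "\<epsilon> \<le> 1"
    and "winning_prob rho M N \<ge> 1 - \<epsilon>"
  shows "d_ext rho psi_star \<le> min 1 (2 ^ 21 * sqrt \<epsilon>)"
proof -
  note Xi = extraction_fidelity[OF assms(1,2,4)]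
  \<comment> \<open>\<open>12 * 10^9\<close> is below \<open>2^42\<close>.\<close>
  have "1 - Xi rho psi_star \<le> (2^21)\<^sup>2 * \<epsilon>" using Xi(2) assms(2) by simp
  then have "sqrt (1 - Xi rho psi_star) \<le> sqrt ((2^21)\<^sup>2 * \<epsilon>)" by (rule real_sqrt_le_mono)
  then show ?thesis using Xi(1) by (simp add: d_ext_def real_sqrt_mult)
qed

end
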